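(* Let $b>0$, $\sigma\in\mathbb N$, let $\lambda\in W^{15,\infty}(\mathbb R^2)$ be real-valued, and let $n\in\mathbb N_0$. Suppose $\psi_0(x,y)=\alpha_0(y)\chi_n(x)$, where $\chi_n$ is an eigenfunction, normalized by $\|\chi_n\|_{L^2(\mathbb R_x)}=1$, of $H$ for its $n$-th eigenvalue $E_n$, and $\alpha_0:\mathbb R\to\mathbb C$ is a given amplitude such that $\psi_0\in\Sigma^2$. Let $\phi\in C^1([0,T_{\max}),\Sigma^2)$ be the unique maximal solution to $$ i\partial_t\phi=\lambda(0,y)F_{\rm av}(\phi),\qquad \phi|_{t=0}=\psi_0(x,y).$$ Then, for all $t\in[0,T_{\max})$, $$\phi(t,x,y)=\alpha_0(y)\chi_n(x)e^{-it\omega_n(y)},\qquad \omega_n(y):=\lambda(0,y)\,|\alpha_0(y)|^{2\sigma}\,\|\chi_n\|_{L_x^{2\sigma+2}}^{2\sigma+2}.$$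
   Context: $\mathbb N=\{1,2,\dots\}$, $\mathbb N_0=\mathbb N\cup\{0\}$. $H=-\frac12\partial_x^2+\frac12b^2x^2$ is the one-dimensional harmonic oscillator acting in the variable $x$, with (simple) eigenvalues $E_n=b(n+\frac12)$, $n\in\mathbb N_0$, on $L^2(\mathbb R_x)$; $e^{-i\theta H}$ is the associated unitary group, acting on $L^2(\mathbb R^2)$ (coordinates $(x,y)$) through $x$. $\Sigma^2=\{u\in L^2(\mathbb R^2):\|u\|_{\Sigma^2}<\infty\}$ with $\|u\|_{\Sigma^2}^2=\|u\|_{L^2}^2+\|Hu\|_{L^2}^2+\|\partial_y^2u\|_{L^2}^2$. The averaged nonlinearity is $$F_{\rm av}(u)=\frac{b}{2\pi}\int_0^{2\pi/b}e^{i\theta H}\left(\left|e^{-i\theta H}u\right|^{2\sigma}e^{-i\theta H}u\right)d\theta .$$ $\lambda(0,y)$ denotes the restriction to $x=0$ of the continuous representative of $\lambda$. For $\psi_0\in\Sigma^2$ the initial value problem $i\partial_t\phi=\lambda(0,y)F_{\rm av}(\phi)$, $\phi|_{t=0}=\psi_0$, has a unique maximal solution in $C^1([0,T_{\max}),\Sigma^2)$ for some $T_{\max}\in(0,\infty]$. *)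

theory Defs
  imports "HOL-Analysis.Analysis"
begin

section \<open>The Hilbert space of square integrable functions\<close>

definition sq_integrable :: "('a::euclidean_space \<Rightarrow> complex) \<Rightarrow> bool" where
  "sq_integrable f \<longleftrightarrow>
     f \<in> borel_measurable lborel \<and> integrable lborel (\<lambda>z. (norm (f z))\<^sup>2)"

definition ae_equal :: "('a::euclidean_space \<Rightarrow> complex) \<Rightarrow> ('a \<Rightarrow> complex) \<Rightarrow> bool" where
  "ae_equal f g \<longleftrightarrow> sq_integrable f \<and> sq_integrable g \<and> (AE z in lborel. f z = g z)"

lemma sq_integrable_zero: "sq_integrable (\<lambda>_. 0)"
  by (simp add: sq_integrable_def)

lemma sq_integrable_mult: "sq_integrable (\<lambda>z. c * f z)" if "sq_integrable f"
  using that by (auto simp: sq_integrable_def norm_mult power_mult_distrib)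

lemma sq_integrable_add: "sq_integrable (\<lambda>z. f z + g z)"
  if f: "sq_integrable f" and g: "sq_integrable g"
proof -
  have [measurable]: "f \<in> borel_measurable lborel" "g \<in> borel_measurable lborel"
    using f g by (auto simp: sq_integrable_def)
  have i: "integrable lborel (\<lambda>z. 2 * (norm (f z))\<^sup>2 + 2 * (norm (g z))\<^sup>2)"
    using f g by (auto simp: sq_integrable_def)
  have le: "(norm (f z + g z))\<^sup>2 \<le> 2 * (norm (f z))\<^sup>2 + 2 * (norm (g z))\<^sup>2" for z
  proof -
    have "(norm (f z + g z))\<^sup>2 \<le> (norm (f z) + norm (g z))\<^sup>2"
      by (intro power_mono norm_triangle_ineq) auto
    also have "\<dots> \<le> 2 * (norm (f z))\<^sup>2 + 2 * (norm (g z))\<^sup>2"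
      using sum_squares_bound[of "norm (f z)" "norm (g z)"] by (simp add: power2_sum)
    finally show ?thesis .
  qed
  have "integrable lborel (\<lambda>z. (norm (f z + g z))\<^sup>2)"
    by (rule Bochner_Integration.integrable_bound[OF i]) (use le in \<open>auto intro!: AE_I2\<close>)
  then show ?thesis by (simp add: sq_integrable_def)
qed

lemma sq_integrable_inner: "integrable lborel (\<lambda>z. f z \<bullet> g z)"
  if f: "sq_integrable f" and g: "sq_integrable g"
proof -
  have [measurable]: "f \<in> borel_measurable lborel" "g \<in> borel_measurable lborel"
    using f g by (auto simp: sq_integrable_def)
  have i: "integrable lborel (\<lambda>z. (norm (f z))\<^sup>2 + (norm (g z))\<^sup>2)"
    using f g by (auto simp: sq_integrable_def)
  have le: "\<bar>f z \<bullet> g z\<bar> \<le> (norm (f z))\<^sup>2 + (norm (g z))\<^sup>2" for z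
  proof -
    have "\<bar>f z \<bullet> g z\<bar> \<le> norm (f z) * norm (g z)"
      by (rule Cauchy_Schwarz_ineq2)
    also have "\<dots> \<le> (norm (f z))\<^sup>2 + (norm (g z))\<^sup>2"
      using sum_squares_bound[of "norm (f z)" "norm (g z)"]
        mult_nonneg_nonneg[OF norm_ge_zero norm_ge_zero, of "f z" "g z"] by linarith
    finally show ?thesis .
  qed
  show ?thesis
    by (rule Bochner_Integration.integrable_bound[OF i]) (use le in \<open>auto intro!: AE_I2\<close>)
qed

quotient_type (overloaded) 'a L2 = "'a::euclidean_space \<Rightarrow> complex" / partial: ae_equal
proof (rule part_equivpI)
  show "\<exists>f::'a \<Rightarrow> complex. ae_equal f f"
    by (rule exI[of _ "\<lambda>_. 0"]) (simp add: ae_equal_def sq_integrable_zero)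
  show "symp (ae_equal :: ('a \<Rightarrow> complex) \<Rightarrow> _)"
    by (auto simp: symp_def ae_equal_def eq_commute)
  show "transp (ae_equal :: ('a \<Rightarrow> complex) \<Rightarrow> _)"
    unfolding transp_def ae_equal_def by (auto elim!: eventually_elim2)
qed

text \<open>
  The class of a function; the value \<open>0\<close> outside the square integrable functions is a
  dummy. Conversely, \<open>rep_L2 u\<close> is a chosen (Borel measurable) representative of \<open>u\<close>.
\<close>

definition to_L2 :: "('a::euclidean_space \<Rightarrow> complex) \<Rightarrow> 'a L2" where
  "to_L2 f = abs_L2 (if sq_integrable f then f else (\<lambda>_. 0))"

instantiation L2 :: (euclidean_space) real_inner
begin

lift_definition zero_L2 :: "'a L2" is "\<lambda>_. 0"
  by (simp add: ae_equal_def sq_integrable_zero)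

lift_definition plus_L2 :: "'a L2 \<Rightarrow> 'a L2 \<Rightarrow> 'a L2" is "\<lambda>f g z. f z + g z"
  by (auto simp: ae_equal_def sq_integrable_add)

lift_definition uminus_L2 :: "'a L2 \<Rightarrow> 'a L2" is "\<lambda>f z. - f z"
  by (auto simp: ae_equal_def sq_integrable_def)

definition minus_L2 :: "'a L2 \<Rightarrow> 'a L2 \<Rightarrow> 'a L2" where
  "minus_L2 u v = u + (- v)"

lift_definition scaleR_L2 :: "real \<Rightarrow> 'a L2 \<Rightarrow> 'a L2" is "\<lambda>r f z. complex_of_real r * f z"
  by (auto simp: ae_equal_def sq_integrable_mult)

text \<open>
  The real part of the usual sesquilinear inner product, which induces the usual norm.
\<close>

lift_definition inner_L2 :: "'a L2 \<Rightarrow> 'a L2 \<Rightarrow> real" is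
  "\<lambda>f g. LINT z|lborel. f z \<bullet> g z"
  by (auto simp: ae_equal_def sq_integrable_def intro!: integral_cong_AE)

lift_definition norm_L2 :: "'a L2 \<Rightarrow> real" is
  "\<lambda>f. sqrt (LINT z|lborel. (norm (f z))\<^sup>2)"
  by (auto simp: ae_equal_def sq_integrable_def intro!: integral_cong_AE)

definition dist_L2 :: "'a L2 \<Rightarrow> 'a L2 \<Rightarrow> real" where
  "dist_L2 u v = norm (u - v)"

definition sgn_L2 :: "'a L2 \<Rightarrow> 'a L2" where
  "sgn_L2 u = inverse (norm u) *\<^sub>R u"

definition uniformity_L2 :: "('a L2 \<times> 'a L2) filter" where
  "uniformity_L2 = (INF e\<in>{0<..}. principal {(u, v). dist u v < e})"

definition open_L2 :: "'a L2 set \<Rightarrow> bool" where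
  "open_L2 U \<longleftrightarrow> (\<forall>u\<in>U. \<forall>\<^sub>F (u', v) in uniformity. u' = u \<longrightarrow> v \<in> U)"

instance
proof
  fix u v w :: "'a L2" and r s :: real
  show "u + v + w = u + (v + w)"
    by transfer (auto simp: ae_equal_def sq_integrable_add add.assoc)
  show "u + v = v + u"
    by transfer (auto simp: ae_equal_def sq_integrable_add add.commute)
  show "0 + u = u"
    by transfer (auto simp: ae_equal_def)
  show "- u + u = 0"
    by transfer (auto simp: ae_equal_def sq_integrable_zero)
  show "u - v = u + - v"
    by (rule minus_L2_def)
  show "r *\<^sub>R (u + v) = r *\<^sub>R u + r *\<^sub>R v"
    by transfer (auto simp: ae_equal_def distrib_left intro!: sq_integrable_add sq_integrable_mult)
  show "(r + s) *\<^sub>R u = r *\<^sub>R u + s *\<^sub>R u"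
    by transfer (auto simp: ae_equal_def distrib_right intro!: sq_integrable_add sq_integrable_mult)
  show "r *\<^sub>R s *\<^sub>R u = (r * s) *\<^sub>R u"
    by transfer (simp add: ae_equal_def sq_integrable_mult mult.assoc)
  show "1 *\<^sub>R u = u"
    by transfer (auto simp: ae_equal_def)
  show "sgn u = inverse (norm u) *\<^sub>R u"
    by (rule sgn_L2_def)
  show "dist u v = norm (u - v)"
    by (rule dist_L2_def)
  show "uniformity = (INF e\<in>{0<..}. principal {(u::'a L2, v). dist u v < e})"
    by (rule uniformity_L2_def)
  show "open U \<longleftrightarrow> (\<forall>u\<in>U. \<forall>\<^sub>F (u', v) in uniformity. u' = u \<longrightarrow> v \<in> U)" for U :: "'a L2 set"
    by (rule open_L2_def)
  show "u \<bullet> v = v \<bullet> u"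
    by transfer (simp add: inner_commute)
  show "(u + v) \<bullet> w = u \<bullet> w + v \<bullet> w"
    by transfer (simp add: ae_equal_def inner_add_left sq_integrable_inner)
  show "(r *\<^sub>R u) \<bullet> v = r * (u \<bullet> v)"
    by transfer (simp flip: scaleR_conv_of_real)
  show "0 \<le> u \<bullet> u"
    by transfer simp
  show "norm u = sqrt (u \<bullet> u)"
    by transfer (simp add: power2_norm_eq_inner)
  show "u \<bullet> u = 0 \<longleftrightarrow> u = 0"
  proof transfer
    fix f :: "'a \<Rightarrow> complex" assume "ae_equal f f"
    then have f: "sq_integrable f" by (simp add: ae_equal_def)
    have "(LINT z|lborel. f z \<bullet> f z) = 0 \<longleftrightarrow> (AE z in lborel. f z \<bullet> f z = 0)"
      by (intro integral_nonneg_eq_0_iff_AE sq_integrable_inner f) auto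
    then show "(LINT z|lborel. f z \<bullet> f z) = 0 \<longleftrightarrow> ae_equal f (\<lambda>_. 0)"
      using f by (simp add: ae_equal_def sq_integrable_zero)
  qed
qed

end

lift_definition scaleC_L2 :: "complex \<Rightarrow> 'a::euclidean_space L2 \<Rightarrow> 'a L2" (infixr \<open>*\<^sub>C\<close> 75)
  is "\<lambda>c f z. c * f z"
  by (auto simp: ae_equal_def sq_integrable_mult)


section \<open>Test functions, weak derivatives and Sobolev spaces\<close>

definition dir_deriv :: "'a::euclidean_space \<Rightarrow> ('a \<Rightarrow> real) \<Rightarrow> 'a \<Rightarrow> real" where
  "dir_deriv e f z = deriv (\<lambda>s. f (z + s *\<^sub>R e)) 0"

primrec C_k :: "nat \<Rightarrow> ('a::euclidean_space \<Rightarrow> real) \<Rightarrow> bool" where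
  "C_k 0 f \<longleftrightarrow> continuous_on UNIV f"
| "C_k (Suc k) f \<longleftrightarrow> continuous_on UNIV f \<and>
     (\<forall>e\<in>Basis. (\<forall>z. (\<lambda>s. f (z + s *\<^sub>R e)) differentiable (at 0)) \<and> C_k k (dir_deriv e f))"

definition test_function :: "('a::euclidean_space \<Rightarrow> real) \<Rightarrow> bool" where
  "test_function f \<longleftrightarrow> (\<forall>k. C_k k f) \<and> compact (closure {z. f z \<noteq> 0})"

definition locally_integrable ::
    "('a::euclidean_space \<Rightarrow> 'b::{banach, second_countable_topology}) \<Rightarrow> bool" where
  "locally_integrable u \<longleftrightarrow> (\<forall>K. compact K \<longrightarrow> set_integrable lborel K u)"

text \<open>
  \<open>v\<close> is the distributional derivative of \<open>u\<close> taken successively in the directions listed in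
  \<open>es\<close>.
\<close>

definition weak_deriv :: "'a::euclidean_space list \<Rightarrow>
    ('a \<Rightarrow> 'b::{banach, second_countable_topology}) \<Rightarrow> ('a \<Rightarrow> 'b) \<Rightarrow> bool" where
  "weak_deriv es u v \<longleftrightarrow> locally_integrable u \<and> locally_integrable v \<and>
     (\<forall>f. test_function f \<longrightarrow>
        (LINT z|lborel. foldr dir_deriv es f z *\<^sub>R u z)
          = (- 1) ^ length es *\<^sub>R (LINT z|lborel. f z *\<^sub>R v z))"

definition L_infty :: "('a::euclidean_space \<Rightarrow> real) \<Rightarrow> bool" where
  "L_infty u \<longleftrightarrow> u \<in> borel_measurable lborel \<and> (\<exists>C. AE z in lborel. \<bar>u z\<bar> \<le> C)"

definition W_infty :: "nat \<Rightarrow> ('a::euclidean_space \<Rightarrow> real) \<Rightarrow> bool" where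
  "W_infty k u \<longleftrightarrow> L_infty u \<and>
     (\<forall>es. set es \<subseteq> Basis \<and> length es \<le> k \<longrightarrow> (\<exists>v. L_infty v \<and> weak_deriv es u v))"

definition continuous_rep :: "('a::euclidean_space \<Rightarrow> real) \<Rightarrow> 'a \<Rightarrow> real" where
  "continuous_rep u = (THE g. continuous_on UNIV g \<and> (AE z in lborel. u z = g z))"


section \<open>The harmonic oscillator and its unitary group\<close>

text \<open>
  \<open>harm_osc b e u v\<close> says that \<open>u\<close> belongs to the domain of the self-adjoint operator
  \<open>H = - 1/2 \<partial>\<^sub>x\<^sup>2 + 1/2 b\<^sup>2 x\<^sup>2\<close> and that \<open>H u = v\<close>. Here \<open>x = z \<bullet> e\<close> is the
  coordinate in the direction of the unit vector \<open>e\<close>; the domain is the maximal one, i.e.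
  \<open>H u\<close> is taken in the sense of distributions and has to be square integrable. With \<open>e = 1\<close> this
  is the operator on the line, with \<open>e = (1, 0)\<close> it is the operator on the plane acting
  through the first variable.
\<close>

definition harm_osc :: "real \<Rightarrow> 'a::euclidean_space \<Rightarrow> 'a L2 \<Rightarrow> 'a L2 \<Rightarrow> bool" where
  "harm_osc b e u v \<longleftrightarrow>
     (\<forall>f. test_function f \<longrightarrow>
        (LINT z|lborel. (- (1/2) * dir_deriv e (dir_deriv e f) z
                          + (1/2) * b\<^sup>2 * (z \<bullet> e)\<^sup>2 * f z) *\<^sub>R rep_L2 u z)
          = (LINT z|lborel. f z *\<^sub>R rep_L2 v z))"

text \<open>
  An unbounded operator \<open>A\<close> is given by its graph. \<open>exp_group A \<theta>\<close> is \<open>e\<^sup>-\<^sup>i\<^sup>\<theta>\<^sup>A\<close>: the strongly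
  continuous one-parameter unitary group whose infinitesimal generator is exactly \<open>- i A\<close>,
  domain included. Surjectivity of each \<open>U \<theta>\<close> follows from the group law.
\<close>

definition unitary_group :: "(real \<Rightarrow> 'a::euclidean_space L2 \<Rightarrow> 'a L2) \<Rightarrow> bool" where
  "unitary_group U \<longleftrightarrow>
     (\<forall>\<theta> u v. U \<theta> (u + v) = U \<theta> u + U \<theta> v) \<and>
     (\<forall>\<theta> c u. U \<theta> (c *\<^sub>C u) = c *\<^sub>C U \<theta> u) \<and>
     (\<forall>\<theta> u. norm (U \<theta> u) = norm u) \<and>
     (\<forall>u. U 0 u = u) \<and>
     (\<forall>\<theta> \<eta> u. U (\<theta> + \<eta>) u = U \<theta> (U \<eta> u)) \<and>
     (\<forall>u. continuous_on UNIV (\<lambda>\<theta>. U \<theta> u))"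

definition generated_by ::
    "(real \<Rightarrow> 'a::euclidean_space L2 \<Rightarrow> 'a L2) \<Rightarrow> ('a L2 \<Rightarrow> 'a L2 \<Rightarrow> bool) \<Rightarrow> bool" where
  "generated_by U A \<longleftrightarrow>
     (\<forall>u v. A u v \<longleftrightarrow> ((\<lambda>\<theta>. U \<theta> u) has_vector_derivative ((- \<i>) *\<^sub>C v)) (at 0))"

definition exp_group ::
    "('a::euclidean_space L2 \<Rightarrow> 'a L2 \<Rightarrow> bool) \<Rightarrow> real \<Rightarrow> 'a L2 \<Rightarrow> 'a L2" where
  "exp_group A = (THE U. unitary_group U \<and> generated_by U A)"


section \<open>The averaged equation on the plane\<close>

type_synonym plane = "real \<times> real"

abbreviation H_plane :: "real \<Rightarrow> plane L2 \<Rightarrow> plane L2 \<Rightarrow> bool" where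
  "H_plane b \<equiv> harm_osc b (1, 0)"

definition dyy :: "plane L2 \<Rightarrow> plane L2 \<Rightarrow> bool" where
  "dyy u v \<longleftrightarrow> weak_deriv [(0, 1), (0, 1)] (rep_L2 u) (rep_L2 v)"

definition Sigma2 :: "real \<Rightarrow> plane L2 set" where
  "Sigma2 b = {u. (\<exists>v. H_plane b u v) \<and> (\<exists>w. dyy u w)}"

definition Sigma2_norm :: "real \<Rightarrow> plane L2 \<Rightarrow> real" where
  "Sigma2_norm b u =
     sqrt ((norm u)\<^sup>2 + (norm (THE v. H_plane b u v))\<^sup>2 + (norm (THE w. dyy u w))\<^sup>2)"

text \<open>
  For \<open>u\<close> in \<open>Sigma2 b\<close>, which embeds into the bounded functions, the function below is square
  integrable, so the dummy value of \<open>to_L2\<close> is not taken.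
\<close>

definition nonlin :: "nat \<Rightarrow> plane L2 \<Rightarrow> plane L2" where
  "nonlin \<sigma> u = to_L2 (\<lambda>z. complex_of_real (norm (rep_L2 u z) ^ (2 * \<sigma>)) * rep_L2 u z)"

text \<open>
  The integral over \<open>\<theta>\<close> is the library's vector-valued integral, taken in \<open>L2\<close>;
  \<open>exp_group (H_plane b) (- \<theta>)\<close> is \<open>e\<^sup>i\<^sup>\<theta>\<^sup>H\<close>.
\<close>

definition F_av :: "real \<Rightarrow> nat \<Rightarrow> plane L2 \<Rightarrow> plane L2" where
  "F_av b \<sigma> u = (b / (2 * pi)) *\<^sub>R
     integral {0 .. 2 * pi / b}
       (\<lambda>\<theta>. exp_group (H_plane b) (- \<theta>) (nonlin \<sigma> (exp_group (H_plane b) \<theta> u)))"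

definition mult_trace :: "(plane \<Rightarrow> real) \<Rightarrow> plane L2 \<Rightarrow> plane L2" where
  "mult_trace lam u =
     to_L2 (\<lambda>z. complex_of_real (continuous_rep lam (0, snd z)) * rep_L2 u z)"

definition time_interval :: "ereal \<Rightarrow> real set" where
  "time_interval T = {t. 0 \<le> t \<and> ereal t < T}"

definition C1_Sigma2 ::
    "real \<Rightarrow> real set \<Rightarrow> (real \<Rightarrow> plane L2) \<Rightarrow> (real \<Rightarrow> plane L2) \<Rightarrow> bool" where
  "C1_Sigma2 b I \<phi> \<phi>' \<longleftrightarrow>
     (\<forall>t\<in>I. \<phi> t \<in> Sigma2 b \<and> \<phi>' t \<in> Sigma2 b \<and>
        ((\<lambda>s. Sigma2_norm b ((1 / (s - t)) *\<^sub>R (\<phi> s - \<phi> t) - \<phi>' t)) \<longlongrightarrow> 0) (at t within I) \<and>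
        ((\<lambda>s. Sigma2_norm b (\<phi>' s - \<phi>' t)) \<longlongrightarrow> 0) (at t within I))"

definition solution :: "real \<Rightarrow> nat \<Rightarrow> (plane \<Rightarrow> real) \<Rightarrow> plane L2 \<Rightarrow> ereal \<Rightarrow>
    (real \<Rightarrow> plane L2) \<Rightarrow> bool" where
  "solution b \<sigma> lam \<psi>\<^sub>0 T \<phi> \<longleftrightarrow> 0 < T \<and> \<phi> 0 = \<psi>\<^sub>0 \<and>
     (\<exists>\<phi>'. C1_Sigma2 b (time_interval T) \<phi> \<phi>' \<and>
        (\<forall>t\<in>time_interval T. \<i> *\<^sub>C \<phi>' t = mult_trace lam (F_av b \<sigma> (\<phi> t))))"

definition maximal_solution :: "real \<Rightarrow> nat \<Rightarrow> (plane \<Rightarrow> real) \<Rightarrow> plane L2 \<Rightarrow> ereal \<Rightarrow>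
    (real \<Rightarrow> plane L2) \<Rightarrow> bool" where
  "maximal_solution b \<sigma> lam \<psi>\<^sub>0 T \<phi> \<longleftrightarrow> solution b \<sigma> lam \<psi>\<^sub>0 T \<phi> \<and>
     \<not> (\<exists>T' > T. \<exists>\<psi>. solution b \<sigma> lam \<psi>\<^sub>0 T' \<psi> \<and> (\<forall>t\<in>time_interval T. \<psi> t = \<phi> t))"

definition Lp_norm :: "real \<Rightarrow> real L2 \<Rightarrow> real" where
  "Lp_norm p u = (LINT x|lborel. norm (rep_L2 u x) powr p) powr (1 / p)"

end

(*
The Hermite functions h_j form an orthonormal system that is total even among functions integrable
against Gaussians (by moment determinacy), so expanding in h_j(x) diagonalizes H, identifies its
unitary group, and shows that an eigenfunction for E_n is a unimodular multiple of h_n.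
On u = beta(y) h_n(x) the group acts by the phase exp(-i theta E_n), hence F_av(u) is the projection
of |u|^(2 sigma) u onto the n-th mode, i.e. F_av(u) = ||h_n||^(2 sigma + 2) |beta(y)|^(2 sigma) u with
the L^(2 sigma + 2) norm. The phase-rotated initial datum psi(t) therefore solves the equation in L^2.
For uniqueness, note that ||exp(-i theta H) u||_infinity is bounded by the Sigma^2 norm of u uniformly
in theta, because only the moduli of the Hermite coefficients of u enter the estimate. Thus F_av is Lipschitz
in L^2 along phi and psi, and Gronwall's inequality gives phi = psi. Boundedness, not smoothness, of psi(t) is what enters:
the phase need not preserve Sigma^2, but psi(t) is bounded because |psi(t)| = |psi_0|.
*)
theory Submission
  imports Defs "HOL-Probability.Probability"
begin

section \<open>The space of square integrable functions\<close>

text \<open>\<open>exp_group\<close>, \<open>Sigma2_norm\<close> and \<open>continuous_rep\<close>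
  are definite descriptions, so each becomes usable only after existence and uniqueness are proved.
  Moreover \<open>harm_osc\<close> and \<open>dyy\<close> are tested on compactly supported
  functions, whereas the argument has to test with Hermite functions. The bridge is the class
  \<open>gauss_integrable\<close>: it contains the square integrable and the bounded functions,
  survives restriction to almost every line and partial integration, and in it vanishing Hermite
  coefficients force vanishing a.e. The fundamental lemma of the calculus of variations is then a
  corollary, because Gaussian-times-polynomial functions are limits of cut-off ones. Products f(x)
  g(y) of test functions separate the two variables. An explicit fundamental solution is used twice:
  that of \<kappa>^2 - d^2/dy^2 bounds each mode in y, with \<kappa> tuned to the energy of the
  mode, and that of (1 - d_x^2)(1 - d_y^2) shows that \<lambda> has a bounded continuous
  representative.\<close>

lemma sq_integrable_rep [simp]: "sq_integrable (rep_L2 u)"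
  using Quotient_rep_reflp[OF Quotient_L2, of u] by (simp add: ae_equal_def)

lemma measurable_rep [measurable]: "rep_L2 u \<in> borel_measurable borel"
  using sq_integrable_rep[of u] by (simp add: sq_integrable_def)

lemma rep_to_L2: "AE z in lborel. rep_L2 (to_L2 f) z = f z" if "sq_integrable f"
proof -
  have "ae_equal f f" using that by (simp add: ae_equal_def)
  then have "ae_equal (rep_L2 (abs_L2 f)) f"
    by (rule Quotient_rep_abs[OF Quotient_L2])
  then show ?thesis using that by (simp add: ae_equal_def to_L2_def)
qed

lemma L2_eqI: "u = v" if "AE z in lborel. rep_L2 u z = rep_L2 v z"
  using that Quotient_rel_rep[OF Quotient_L2, of u v] by (simp add: ae_equal_def)

lemma to_L2_rep [simp]: "to_L2 (rep_L2 u) = u"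
  by (rule L2_eqI) (rule rep_to_L2, simp)

lemma to_L2_eqI: "to_L2 f = u" if "sq_integrable f" "AE z in lborel. f z = rep_L2 u z"
proof (rule L2_eqI)
  show "AE z in lborel. rep_L2 (to_L2 f) z = rep_L2 u z"
    using rep_to_L2[OF that(1)] that(2) by eventually_elim simp
qed

lemma abs_L2_eq: "abs_L2 f = to_L2 f" if "sq_integrable f"
  using that by (simp add: to_L2_def)

lemma rep_add: "AE z in lborel. rep_L2 (u + v) z = rep_L2 u z + rep_L2 v z"
proof -
  have "u + v = to_L2 (\<lambda>z. rep_L2 u z + rep_L2 v z)"
    using plus_L2.abs_eq[of "rep_L2 u" "rep_L2 v"]
    by (simp add: ae_equal_def abs_L2_eq sq_integrable_add)
  then show ?thesis using rep_to_L2[OF sq_integrable_add[of "rep_L2 u" "rep_L2 v"]] by simp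
qed

lemma rep_scaleC: "AE z in lborel. rep_L2 (c *\<^sub>C u) z = c * rep_L2 u z"
proof -
  have "c *\<^sub>C u = to_L2 (\<lambda>z. c * rep_L2 u z)"
    using scaleC_L2.abs_eq[of "rep_L2 u"]
    by (simp add: ae_equal_def abs_L2_eq sq_integrable_mult)
  then show ?thesis using rep_to_L2[OF sq_integrable_mult[of "rep_L2 u"]] by simp
qed

lemma rep_scaleR: "AE z in lborel. rep_L2 (r *\<^sub>R u) z = r *\<^sub>R rep_L2 u z"
proof -
  have "r *\<^sub>R u = to_L2 (\<lambda>z. complex_of_real r * rep_L2 u z)"
    using scaleR_L2.abs_eq[of "rep_L2 u"]
    by (simp add: ae_equal_def abs_L2_eq sq_integrable_mult)
  then show ?thesis
    using rep_to_L2[OF sq_integrable_mult[of "rep_L2 u"]] by (simp add: scaleR_conv_of_real)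
qed

lemma rep_zero: "AE z in lborel. rep_L2 0 z = 0"
  using rep_scaleR[of 0] by simp

lemma scaleR_eq_scaleC: "r *\<^sub>R u = complex_of_real r *\<^sub>C u"
proof (rule L2_eqI)
  show "AE z in lborel. rep_L2 (r *\<^sub>R u) z = rep_L2 (complex_of_real r *\<^sub>C u) z"
    using rep_scaleR[of r u] rep_scaleC[of "of_real r" u]
    by eventually_elim (simp add: scaleR_conv_of_real)
qed

lemma rep_minus: "AE z in lborel. rep_L2 (u - v) z = rep_L2 u z - rep_L2 v z"
proof -
  have "u - v = u + (- 1) *\<^sub>R v" by simp
  moreover have "AE z in lborel. rep_L2 (u + (- 1) *\<^sub>R v) z = rep_L2 u z - rep_L2 v z"
    using rep_add[of u "(- 1) *\<^sub>R v"] rep_scaleR[of "- 1" v] by eventually_elim simp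
  ultimately show ?thesis by simp
qed

lemma rep_sum:
  "AE z in lborel. rep_L2 (\<Sum>k<N. u k) z = (\<Sum>k<(N::nat). rep_L2 (u k) z)"
proof (induction N)
  case 0 show ?case using rep_zero by simp
next
  case (Suc N)
  show ?case using rep_add[of "\<Sum>k<N. u k" "u N"] Suc by (simp, eventually_elim) simp
qed

lemma inner_L2_eq: "u \<bullet> v = (LINT z|lborel. rep_L2 u z \<bullet> rep_L2 v z)"
  using inner_L2.abs_eq[of "rep_L2 u" "rep_L2 v"]
  by (simp add: ae_equal_def abs_L2_eq)

lemma norm_L2_sq: "(norm u)\<^sup>2 = (LINT z|lborel. (norm (rep_L2 u z))\<^sup>2)"
  by (simp add: power2_norm_eq_inner inner_L2_eq)

lemma inner_L2_cong:
  "u \<bullet> v = (LINT z|lborel. f z \<bullet> g z)"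
  if "AE z in lborel. rep_L2 u z = f z" "AE z in lborel. rep_L2 v z = g z"
    and [measurable]: "f \<in> borel_measurable borel" "g \<in> borel_measurable borel"
  unfolding inner_L2_eq
  by (rule integral_cong_AE) (use that(1,2) in \<open>auto elim!: eventually_elim2\<close>)

lemma inner_to_L2: "to_L2 f \<bullet> v = (LINT z|lborel. f z \<bullet> rep_L2 v z)" if "sq_integrable f"
  by (rule inner_L2_cong[OF rep_to_L2[OF that]]) (use that in \<open>auto simp: sq_integrable_def\<close>)

lemma norm_to_L2: "(norm (to_L2 f))\<^sup>2 = (LINT z|lborel. (norm (f z))\<^sup>2)" if "sq_integrable f"
proof -
  have "(norm (to_L2 f))\<^sup>2 = (LINT z|lborel. f z \<bullet> f z)"
    unfolding power2_norm_eq_inner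
    by (rule inner_L2_cong[OF rep_to_L2[OF that] rep_to_L2[OF that]])
       (use that in \<open>auto simp: sq_integrable_def\<close>)
  then show ?thesis by (simp add: power2_norm_eq_inner)
qed

lemma scaleC_add_right: "c *\<^sub>C (u + v) = c *\<^sub>C u + c *\<^sub>C v"
proof (rule L2_eqI)
  show "AE z in lborel. rep_L2 (c *\<^sub>C (u + v)) z = rep_L2 (c *\<^sub>C u + c *\<^sub>C v) z"
    using rep_scaleC[of c "u + v"] rep_add[of u v] rep_add[of "c *\<^sub>C u" "c *\<^sub>C v"]
      rep_scaleC[of c u] rep_scaleC[of c v]
    by eventually_elim (simp add: algebra_simps)
qed

lemma scaleC_add_left: "(a + c) *\<^sub>C u = a *\<^sub>C u + c *\<^sub>C u"
proof (rule L2_eqI)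
  show "AE z in lborel. rep_L2 ((a + c) *\<^sub>C u) z = rep_L2 (a *\<^sub>C u + c *\<^sub>C u) z"
    using rep_scaleC[of "a + c" u] rep_add[of "a *\<^sub>C u" "c *\<^sub>C u"]
      rep_scaleC[of c u] rep_scaleC[of a u]
    by eventually_elim (simp add: algebra_simps)
qed

lemma scaleC_scaleC [simp]: "a *\<^sub>C c *\<^sub>C u = (a * c) *\<^sub>C u"
proof (rule L2_eqI)
  show "AE z in lborel. rep_L2 (a *\<^sub>C c *\<^sub>C u) z = rep_L2 ((a * c) *\<^sub>C u) z"
    using rep_scaleC[of "a * c" u] rep_scaleC[of a "c *\<^sub>C u"] rep_scaleC[of c u]
    by eventually_elim (simp add: algebra_simps)
qed

lemma scaleC_one [simp]: "1 *\<^sub>C u = u"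
  using scaleR_eq_scaleC[of 1 u] by simp

lemma scaleC_zero_left [simp]: "0 *\<^sub>C u = 0"
  using scaleR_eq_scaleC[of 0 u] by simp

lemma scaleC_zero_right [simp]: "c *\<^sub>C 0 = 0"
  by (metis scaleC_scaleC scaleC_zero_left mult_zero_right)

lemma scaleC_scaleR: "c *\<^sub>C (r *\<^sub>R u) = r *\<^sub>R (c *\<^sub>C u)"
  by (simp add: scaleR_eq_scaleC mult.commute)

lemma scaleC_minus_one: "(- 1) *\<^sub>C u = - u"
  using scaleR_eq_scaleC[of "- 1" u] by simp

lemma scaleC_minus_left: "(- c) *\<^sub>C u = - (c *\<^sub>C u)"
  using scaleC_scaleC[of "-1" c u] scaleC_minus_one[of "c *\<^sub>C u"] by simp

lemma scaleC_minus_right: "c *\<^sub>C (- u) = - (c *\<^sub>C u)"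
  using scaleC_scaleC[of c "-1" u] scaleC_minus_one[of "u"] by (simp add: scaleC_minus_left)

lemma scaleC_diff_right: "c *\<^sub>C (u - v) = c *\<^sub>C u - c *\<^sub>C v"
  using scaleC_add_right[of c u "- v"] by (simp add: scaleC_minus_right)

lemma scaleC_diff_left: "(a - c) *\<^sub>C u = a *\<^sub>C u - c *\<^sub>C u"
  using scaleC_add_left[of a "- c" u] by (simp add: scaleC_minus_left)

lemma norm_scaleC: "norm (c *\<^sub>C u) = norm c * norm u"
proof -
  have "(norm (c *\<^sub>C u))\<^sup>2 = (LINT z|lborel. (norm (c * rep_L2 u z))\<^sup>2)"
    unfolding norm_L2_sq
    by (rule integral_cong_AE) (use rep_scaleC[of c u] in \<open>auto elim!: eventually_mono\<close>)
  also have "\<dots> = (norm c * norm u)\<^sup>2"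
    by (simp add: norm_mult power_mult_distrib norm_L2_sq)
  finally show ?thesis by (simp add: power2_eq_iff_nonneg)
qed

lemma inner_scaleC: "(c *\<^sub>C u) \<bullet> v = u \<bullet> (cnj c *\<^sub>C v)"
proof -
  have "(c *\<^sub>C u) \<bullet> v = (LINT z|lborel. (c * rep_L2 u z) \<bullet> rep_L2 v z)"
    by (rule inner_L2_cong[OF rep_scaleC]) auto
  also have "\<dots> = (LINT z|lborel. rep_L2 u z \<bullet> (cnj c * rep_L2 v z))"
    by (simp add: inner_complex_def algebra_simps)
  also have "\<dots> = u \<bullet> (cnj c *\<^sub>C v)"
    by (rule inner_L2_cong[OF _ rep_scaleC, symmetric]) auto
  finally show ?thesis .
qed

text \<open>The positive part of \<open>\<bar>u\<bar> - M\<close> is dominated by \<open>\<bar>u - u\<^sub>n\<bar>\<close>.\<close>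

lemma AE_norm_le_closed:
  fixes u :: "'a::euclidean_space L2"
  assumes lim: "X \<longlonglongrightarrow> u" and le: "\<And>n. AE z in lborel. norm (rep_L2 (X n) z) \<le> M"
  shows "AE z in lborel. norm (rep_L2 u z) \<le> M"
proof -
  let ?p = "\<lambda>z. (max 0 (norm (rep_L2 u z) - M))\<^sup>2"
  have dom: "AE z in lborel. norm (?p z) \<le> (norm (rep_L2 (u - X n) z))\<^sup>2" for n
    using rep_minus[of u "X n"] le[of n]
  proof eventually_elim
    case (elim z)
    have "max 0 (norm (rep_L2 u z) - M) \<le> norm (rep_L2 (u - X n) z)"
      using elim norm_triangle_sub[of "rep_L2 u z" "rep_L2 (X n) z"] by auto
    then show ?case by (simp add: power_mono)
  qed
  have i: "integrable lborel (\<lambda>z. (norm (rep_L2 v z))\<^sup>2)" for v :: "'a L2"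
    using sq_integrable_rep[of v] by (simp add: sq_integrable_def)
  have ip: "integrable lborel ?p"
    by (rule Bochner_Integration.integrable_bound[OF i[of "u - X 0"]]) (use dom[of 0] in auto)
  have "(LINT z|lborel. ?p z) \<le> (norm (u - X n))\<^sup>2" for n
    unfolding norm_L2_sq by (rule integral_mono_AE[OF ip i]) (use dom[of n] in auto)
  moreover have "(\<lambda>n. (norm (u - X n))\<^sup>2) \<longlonglongrightarrow> 0"
    using tendsto_power[OF tendsto_norm[OF tendsto_diff[OF tendsto_const lim]], of u 2] by simp
  ultimately have "(LINT z|lborel. ?p z) \<le> 0"
    by (meson LIMSEQ_le_const)
  then have "(LINT z|lborel. ?p z) = 0"
    by (intro antisym) auto
  then have "AE z in lborel. ?p z = 0"
    using integral_nonneg_eq_0_iff_AE[OF ip] by auto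
  then show ?thesis by eventually_elim (auto simp: max_def split: if_splits)
qed

section \<open>Completeness of the space of square integrable functions\<close>

lemma nn_integral_L2: "(\<integral>\<^sup>+ z. ennreal ((norm (rep_L2 u z))\<^sup>2) \<partial>lborel) = ennreal ((norm u)\<^sup>2)"
  unfolding norm_L2_sq
  by (rule nn_integral_eq_integral) (use sq_integrable_rep[of u] in \<open>auto simp: sq_integrable_def\<close>)

lemma sq_integrableI_nn:
  assumes [measurable]: "f \<in> borel_measurable borel"
    and fin: "(\<integral>\<^sup>+ z. ennreal ((norm (f z))\<^sup>2) \<partial>lborel) < \<infinity>"
  shows "sq_integrable f"
  unfolding sq_integrable_def
  using fin by (auto intro!: integrableI_bounded)

text \<open>Riesz-Fischer argument: the partial sums of the moduli \<open>d n\<close> have L2 norm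
  at most 2, so by monotone convergence their supremum is finite a.e., and there the telescoping
  series converges absolutely.\<close>

lemma AE_summable_diffs:
  fixes Y :: "nat \<Rightarrow> 'a::euclidean_space L2"
  assumes Y: "\<And>n. norm (Y (Suc n) - Y n) \<le> (1/2) ^ n"
  shows "AE z in lborel. convergent (\<lambda>n. rep_L2 (Y n) z)"
proof -
  define d where "d = (\<lambda>n z. norm (rep_L2 (Y (Suc n) - Y n) z))"
  have d_meas [measurable]: "d n \<in> borel_measurable borel" for n unfolding d_def by measurable
  have S: "sq_integrable (\<lambda>z. complex_of_real (\<Sum>n<N. d n z)) \<and>
      norm (to_L2 (\<lambda>z. complex_of_real (\<Sum>n<N. d n z))) \<le> (\<Sum>n<N. (1/2) ^ n)" for N
  proof (induction N)
    case 0
    have "to_L2 (\<lambda>_::'a. 0) = 0"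
      by (rule to_L2_eqI[OF sq_integrable_zero]) (use rep_zero in \<open>auto elim: eventually_mono\<close>)
    then show ?case by (simp add: sq_integrable_zero)
  next
    case (Suc N)
    let ?S = "\<lambda>z. complex_of_real (\<Sum>n<N. d n z)" and ?d = "\<lambda>z. complex_of_real (d N z)"
    have dN: "sq_integrable ?d"
      using sq_integrable_rep[of "Y (Suc N) - Y N"] by (simp add: sq_integrable_def d_def)
    have "(norm (to_L2 ?d))\<^sup>2 = (norm (Y (Suc N) - Y N))\<^sup>2"
      using norm_to_L2[OF dN] norm_L2_sq[of "Y (Suc N) - Y N"] by (simp add: d_def)
    then have n: "norm (to_L2 ?d) = norm (Y (Suc N) - Y N)" by (simp add: power2_eq_iff_nonneg)
    have sq: "sq_integrable (\<lambda>z. ?S z + ?d z)" using Suc dN by (intro sq_integrable_add) auto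
    have "to_L2 (\<lambda>z. ?S z + ?d z) = to_L2 ?S + to_L2 ?d"
    proof (rule to_L2_eqI[OF sq])
      show "AE z in lborel. ?S z + ?d z = rep_L2 (to_L2 ?S + to_L2 ?d) z"
        using rep_add[of "to_L2 ?S" "to_L2 ?d"] rep_to_L2[OF conjunct1[OF Suc]] rep_to_L2[OF dN]
        by eventually_elim simp
    qed
    then have "norm (to_L2 (\<lambda>z. ?S z + ?d z)) \<le> (\<Sum>n<N. (1/2) ^ n) + (1/2) ^ N"
      using norm_triangle_ineq[of "to_L2 ?S" "to_L2 ?d"] conjunct2[OF Suc] n Y[of N] by simp
    then show ?case using sq by simp
  qed
  \<comment> \<open>The bound 4 is the square of the geometric sum 1 + 1/2 + 1/4 + ... = 2.\<close>
  have S2: "(\<integral>\<^sup>+ z. ennreal ((\<Sum>n<N. d n z)\<^sup>2) \<partial>lborel) \<le> 4" for N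
  proof -
    let ?S = "\<lambda>z. complex_of_real (\<Sum>n<N. d n z)"
    have "(\<integral>\<^sup>+ z. ennreal ((\<Sum>n<N. d n z)\<^sup>2) \<partial>lborel) = (\<integral>\<^sup>+ z. ennreal ((norm (?S z))\<^sup>2) \<partial>lborel)"
      by (simp flip: of_real_sum)
    also have "\<dots> = ennreal ((norm (to_L2 ?S))\<^sup>2)"
      unfolding norm_to_L2[OF conjunct1[OF S]]
      by (rule nn_integral_eq_integral) (use S[of N] in \<open>auto simp: sq_integrable_def\<close>)
    also have "\<dots> \<le> ennreal (2\<^sup>2)"
    proof (intro ennreal_leI power_mono)
      have "(\<Sum>n<N. (1/2::real) ^ n) \<le> 2"
        using sum_le_suminf[of "\<lambda>n. (1/2::real)^n" "{..<N}"] suminf_geometric[of "1/2::real"]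
        by (auto simp: summable_geometric)
      then show "norm (to_L2 ?S) \<le> 2" using S[of N] by linarith
    qed auto
    finally show ?thesis by simp
  qed
  have inc: "incseq (\<lambda>N z. ennreal ((\<Sum>n<N. d n z)\<^sup>2))"
    by (auto simp: incseq_def le_fun_def d_def intro!: ennreal_leI power_mono sum_mono2 sum_nonneg)
  have "(\<integral>\<^sup>+ z. (SUP N. ennreal ((\<Sum>n<N. d n z)\<^sup>2)) \<partial>lborel) \<le> 4"
    by (subst nn_integral_monotone_convergence_SUP[OF inc]) (auto intro!: SUP_least S2)
  then have "AE z in lborel. (SUP N. ennreal ((\<Sum>n<N. d n z)\<^sup>2)) \<noteq> \<infinity>"
    by (intro nn_integral_noteq_infinite) (auto simp: top_unique)
  moreover have "AE z in lborel. \<forall>n. rep_L2 (Y (Suc n) - Y n) z = rep_L2 (Y (Suc n)) z - rep_L2 (Y n) z"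
    unfolding AE_all_countable using rep_minus by auto
  ultimately show ?thesis
  proof eventually_elim
    case (elim z)
    then obtain B where B: "(SUP N. ennreal ((\<Sum>n<N. d n z)\<^sup>2)) = ennreal B" "B \<ge> 0"
      by (cases "SUP N. ennreal ((\<Sum>n<N. d n z)\<^sup>2)") auto
    have "ennreal ((\<Sum>n<N. d n z)\<^sup>2) \<le> ennreal B" for N
      unfolding B(1)[symmetric] by (rule SUP_upper) auto
    then have "(\<Sum>n<N. d n z)\<^sup>2 \<le> B" for N
      using B(2) by (simp add: ennreal_le_iff)
    then have "(\<Sum>n<N. d n z) \<le> sqrt B" for N
      by (meson real_le_rsqrt)
    then have "summable (\<lambda>n. d n z)"
      by (intro summableI_nonneg_bounded) (auto simp: d_def)
    then have "summable (\<lambda>n. rep_L2 (Y (Suc n)) z - rep_L2 (Y n) z)"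
      using elim(2) by (auto intro: summable_norm_cancel simp: d_def)
    then have "convergent (\<lambda>n. (rep_L2 (Y n) z - rep_L2 (Y 0) z) + rep_L2 (Y 0) z)"
      unfolding summable_iff_convergent sum_lessThan_telescope[of "\<lambda>n. rep_L2 (Y n) z"]
      by (intro convergent_add convergent_const)
    then show ?case by simp
  qed
qed

text \<open>The pointwise limit from \<open>AE_summable_diffs\<close> is only a candidate. Fatou's
  lemma bounds its distance to \<open>Y m\<close> by the Cauchy tail, which yields both its square
  integrability and convergence in norm.\<close>

lemma L2_fast_convergent:
  fixes Y :: "nat \<Rightarrow> 'a::euclidean_space L2"
  assumes Y: "\<And>n. norm (Y (Suc n) - Y n) \<le> (1/2) ^ n" and C: "Cauchy Y"
  shows "convergent Y"
proof -
  define f where "f = (\<lambda>z. lim (\<lambda>n. rep_L2 (Y n) z))"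
  have [measurable]: "f \<in> borel_measurable borel" unfolding f_def by measurable
  have fl: "AE z in lborel. (\<lambda>n. rep_L2 (Y n) z) \<longlonglongrightarrow> f z"
    using AE_summable_diffs[of Y, OF Y] by eventually_elim (simp add: f_def convergent_LIMSEQ_iff)
  have Fatou: "(\<integral>\<^sup>+ z. ennreal ((norm (rep_L2 (Y m) z - f z))\<^sup>2) \<partial>lborel) \<le> ennreal (e\<^sup>2)"
    if e: "\<And>n. n \<ge> m \<Longrightarrow> norm (Y m - Y n) \<le> e" "e \<ge> 0" for m e
  proof -
    have "(\<integral>\<^sup>+ z. ennreal ((norm (rep_L2 (Y m) z - f z))\<^sup>2) \<partial>lborel)
        = (\<integral>\<^sup>+ z. liminf (\<lambda>n. ennreal ((norm (rep_L2 (Y m) z - rep_L2 (Y n) z))\<^sup>2)) \<partial>lborel)"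
    proof (rule nn_integral_cong_AE)
      show "AE z in lborel. ennreal ((norm (rep_L2 (Y m) z - f z))\<^sup>2)
          = liminf (\<lambda>n. ennreal ((norm (rep_L2 (Y m) z - rep_L2 (Y n) z))\<^sup>2))"
        using fl
      proof eventually_elim
        case (elim z)
        have "(\<lambda>n. ennreal ((norm (rep_L2 (Y m) z - rep_L2 (Y n) z))\<^sup>2))
            \<longlonglongrightarrow> ennreal ((norm (rep_L2 (Y m) z - f z))\<^sup>2)"
          by (intro tendsto_intros tendsto_ennrealI elim)
        then show ?case by (intro lim_imp_Liminf[symmetric]) auto
      qed
    qed
    also have "\<dots> \<le> liminf (\<lambda>n. \<integral>\<^sup>+ z. ennreal ((norm (rep_L2 (Y m) z - rep_L2 (Y n) z))\<^sup>2) \<partial>lborel)"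
      by (rule nn_integral_liminf) measurable
    also have "\<dots> = liminf (\<lambda>n. ennreal ((norm (Y m - Y n))\<^sup>2))"
    proof -
      have "(\<integral>\<^sup>+ z. ennreal ((norm (rep_L2 (Y m) z - rep_L2 (Y n) z))\<^sup>2) \<partial>lborel) = ennreal ((norm (Y m - Y n))\<^sup>2)" for n
        unfolding nn_integral_L2[symmetric]
        by (rule nn_integral_cong_AE) (use rep_minus[of "Y m" "Y n"] in \<open>auto elim: eventually_mono\<close>)
      then show ?thesis by simp
    qed
    also have "\<dots> \<le> ennreal (e\<^sup>2)"
    proof (rule Liminf_le)
      show "eventually (\<lambda>n. ennreal ((norm (Y m - Y n))\<^sup>2) \<le> ennreal (e\<^sup>2)) sequentially"
        using eventually_ge_at_top[of m]
        by eventually_elim (use e in \<open>auto intro!: ennreal_leI power_mono\<close>)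
    qed simp
    finally show ?thesis .
  qed
  have Ce: "\<exists>M. \<forall>m\<ge>M. \<forall>n\<ge>m. norm (Y m - Y n) \<le> e" if "e > 0" for e
    using CauchyD[OF C that] by (meson less_imp_le order_trans)
  have sqf: "sq_integrable f"
  proof -
    obtain M where M: "\<And>n. n \<ge> M \<Longrightarrow> norm (Y M - Y n) \<le> 1" using Ce[of 1] by auto
    \<comment> \<open>Fatou controls only the difference to a member of the sequence;
      \<open>f\<close> is then recovered as \<open>Y M\<close> minus that difference.\<close>
    have "sq_integrable (\<lambda>z. rep_L2 (Y M) z - f z)"
      by (rule sq_integrableI_nn) (use Fatou[of M 1] M in \<open>auto simp: order_le_less_trans\<close>)
    then have "sq_integrable (\<lambda>z. rep_L2 (Y M) z + (- 1) * (rep_L2 (Y M) z - f z))"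
      by (intro sq_integrable_add sq_integrable_mult) auto
    then show ?thesis by simp
  qed
  have "Y \<longlonglongrightarrow> to_L2 f"
  proof (rule LIMSEQ_I)
    fix r :: real assume r: "r > 0"
    obtain M where M: "\<And>m n. m \<ge> M \<Longrightarrow> n \<ge> m \<Longrightarrow> norm (Y m - Y n) \<le> r / 2"
      using Ce[of "r / 2"] r by auto
    have "norm (Y m - to_L2 f) < r" if "m \<ge> M" for m
    proof -
      have "ennreal ((norm (Y m - to_L2 f))\<^sup>2) = (\<integral>\<^sup>+ z. ennreal ((norm (rep_L2 (Y m) z - f z))\<^sup>2) \<partial>lborel)"
        unfolding nn_integral_L2[symmetric]
        by (rule nn_integral_cong_AE)
           (use rep_minus[of "Y m" "to_L2 f"] rep_to_L2[OF sqf] in \<open>auto elim: eventually_elim2\<close>)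
      also have "\<dots> \<le> ennreal ((r/2)\<^sup>2)" using Fatou[of m "r/2"] M that r by auto
      finally have "norm (Y m - to_L2 f) \<le> r / 2"
        using r by (simp add: power2_le_iff_abs_le ennreal_le_iff)
      then show ?thesis using r by simp
    qed
    then show "\<exists>no. \<forall>n\<ge>no. norm (Y n - to_L2 f) < r" by blast
  qed
  then show ?thesis by (auto simp: convergent_def)
qed

text \<open>Completeness allows series over modes to be summed by the Cauchy criterion and
  continuous integrands, such as the one in \<open>F_av\<close>, to be integrated.\<close>

instance L2 :: (euclidean_space) banach
proof
  fix X :: "nat \<Rightarrow> 'a L2" assume X: "Cauchy X"
  have "\<forall>n. \<exists>N. \<forall>k\<ge>N. \<forall>l\<ge>N. norm (X k - X l) < (1/2) ^ n"
    using CauchyD[OF X] by (meson zero_less_power half_gt_zero zero_less_one)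
  then obtain N where N: "\<And>n k l. k \<ge> N n \<Longrightarrow> l \<ge> N n \<Longrightarrow> norm (X k - X l) < (1/2) ^ n"
    by metis
  \<comment> \<open>The summand \<open>n\<close> makes \<open>r\<close> strictly increasing, and the
    sum makes it dominate each \<open>N n\<close>; \<open>N\<close> itself need not be
    monotone.\<close>
  define r where "r = (\<lambda>n. n + (\<Sum>i\<le>n. N i))"
  have r: "strict_mono r" by (auto simp: strict_mono_Suc_iff r_def)
  have "N n \<le> r n" for n
    using member_le_sum[of n "{..n}" N] by (simp add: r_def)
  moreover have "N n \<le> r (Suc n)" for n
    using \<open>N n \<le> r n\<close> r by (meson strict_mono_less lessI less_imp_le order_trans)
  ultimately have "norm ((X \<circ> r) (Suc n) - (X \<circ> r) n) \<le> (1/2) ^ n" for n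
    using N[of n "r (Suc n)" "r n"] by simp
  then have "convergent (X \<circ> r)"
    by (rule L2_fast_convergent) (rule Cauchy_subseq_Cauchy[OF X r])
  then show "convergent X"
    using X r by (metis Cauchy_converges_subseq convergent_def)
qed

section \<open>Unitary groups of diagonal operators\<close>

lemma bounded_bilinear_scaleC: "bounded_bilinear (\<lambda>c u. c *\<^sub>C u)"
  by (rule bounded_bilinear.intro)
     (auto simp: scaleC_add_left scaleC_add_right scaleR_eq_scaleC norm_scaleC scaleR_conv_of_real mult.commute
           intro: exI[of _ 1])

lemma cis_derivative:
  "((\<lambda>\<theta>. cis (r * \<theta>)) has_vector_derivative (\<i> * of_real r * cis (r * \<theta>))) (at \<theta>)"
  using exp_scaleR_has_vector_derivative_right[of "\<i> * of_real r" \<theta> UNIV]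
  by (simp add: cis_conv_exp scaleR_conv_of_real algebra_simps)

lemma cis_scaleC_derivative:
  "((\<lambda>\<theta>. cis (r * \<theta>) *\<^sub>C w) has_vector_derivative (\<i> * of_real r * cis (r * \<theta>)) *\<^sub>C w) (at \<theta>)"
proof -
  from bounded_linear.has_vector_derivative[OF bounded_bilinear.bounded_linear_left[OF bounded_bilinear_scaleC] cis_derivative]
  show ?thesis .
qed

text \<open>Orthogonal projections rather than basis vectors, because in the application each
  eigenspace is infinite-dimensional: it consists of all \<open>herm k x * c y\<close> with c square
  integrable. Totality is assumed as joint injectivity of the projections; the expansion of a vector
  is derived from it in \<open>P_sums\<close>.\<close>

locale spectral_family =
  fixes P :: "nat \<Rightarrow> 'a::euclidean_space L2 \<Rightarrow> 'a L2" and E :: "nat \<Rightarrow> real"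
  assumes P_add: "P k (u + v) = P k u + P k v"
    and P_scaleC: "P k (c *\<^sub>C u) = c *\<^sub>C P k u"
    and P_sym: "P k u \<bullet> v = u \<bullet> P k v"
    and P_P: "P j (P k u) = (if j = k then P k u else 0)"
    and total: "(\<And>k. P k u = 0) \<Longrightarrow> u = 0"
begin

lemma P_scaleR: "P k (r *\<^sub>R u) = r *\<^sub>R P k u"
  by (simp add: scaleR_eq_scaleC P_scaleC)

lemma P_orth: "j \<noteq> k \<Longrightarrow> P j u \<bullet> P k v = 0"
  by (simp add: P_sym P_P)

lemma P_norm: "(norm (P k u))\<^sup>2 = u \<bullet> P k u"
  by (simp add: power2_norm_eq_inner P_sym P_P)

lemma norm_P_le: "norm (P k u) \<le> norm u"
proof -
  have "(norm (P k u))\<^sup>2 \<le> norm u * norm (P k u)"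
    unfolding P_norm by (rule norm_cauchy_schwarz)
  then show ?thesis
    by (metis mult.commute mult_right_le_imp_le norm_ge_zero not_less order.order_iff_strict power2_eq_square)
qed

lemma bounded_linear_P: "bounded_linear (P k)"
  by (rule bounded_linear_intro[where K = 1]) (auto simp: P_add P_scaleR norm_P_le)

lemma norm_sum_scaleC_P:
  "finite A \<Longrightarrow> (norm (\<Sum>k\<in>A. c k *\<^sub>C P k u))\<^sup>2 = (\<Sum>k\<in>A. (norm (c k))\<^sup>2 * (norm (P k u))\<^sup>2)"
proof (induction A rule: finite_induct)
  case (insert k A)
  have "(c k *\<^sub>C P k u) \<bullet> (\<Sum>j\<in>A. c j *\<^sub>C P j u) = 0"
    unfolding inner_sum_right
  proof (intro sum.neutral ballI)
    fix j assume "j \<in> A"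
    then have "k \<noteq> j" using insert(2) by auto
    then show "(c k *\<^sub>C P k u) \<bullet> (c j *\<^sub>C P j u) = 0"
      unfolding P_scaleC[symmetric] by (rule P_orth)
  qed
  then have "(norm (c k *\<^sub>C P k u + (\<Sum>j\<in>A. c j *\<^sub>C P j u)))\<^sup>2
      = (norm (c k *\<^sub>C P k u))\<^sup>2 + (norm (\<Sum>j\<in>A. c j *\<^sub>C P j u))\<^sup>2"
    by (intro norm_add_Pythagorean) (simp add: orthogonal_def)
  then show ?case
    using insert by (simp add: norm_scaleC power_mult_distrib)
qed simp

lemma bessel: "(\<Sum>k<N. (norm (P k u))\<^sup>2) \<le> (norm u)\<^sup>2"
proof -
  let ?S = "\<Sum>k<N. P k u"
  have S: "(norm ?S)\<^sup>2 = (\<Sum>k<N. (norm (P k u))\<^sup>2)"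
    using norm_sum_scaleC_P[of "{..<N}" "\<lambda>_. 1" u] by simp
  have "(\<Sum>k<N. (norm (P k u))\<^sup>2) = ?S \<bullet> u"
    by (simp add: P_norm inner_sum_left inner_commute[of u])
  also have "\<dots> \<le> norm ?S * norm u" by (rule norm_cauchy_schwarz)
  finally have "(norm ?S)\<^sup>2 \<le> norm ?S * norm u" using S by simp
  then have "norm ?S \<le> norm u"
    by (metis mult_left_le_imp_le norm_ge_zero not_less order.order_iff_strict power2_eq_square)
  then show ?thesis using S by (metis norm_ge_zero power_mono)
qed

lemma summable_norm_P: "summable (\<lambda>k. (norm (P k u))\<^sup>2)"
  by (rule summableI_nonneg_bounded[OF _ bessel]) simp

text \<open>Orthogonality turns the squared norm of a block of the series into a block of the scalar
  series, so the Cauchy criterion carries over.\<close>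

lemma summable_scaleC_P:
  assumes "summable (\<lambda>k. (norm (c k))\<^sup>2 * (norm (P k u))\<^sup>2)"
  shows "summable (\<lambda>k. c k *\<^sub>C P k u)"
  unfolding summable_Cauchy
proof (intro allI impI)
  fix e :: real assume e: "e > 0"
  then obtain N where N: "\<And>m n. m \<ge> N \<Longrightarrow> norm (\<Sum>k=m..<n. (norm (c k))\<^sup>2 * (norm (P k u))\<^sup>2) < e\<^sup>2"
    using assms unfolding summable_Cauchy by (meson zero_less_power)
  have "norm (\<Sum>k=m..<n. c k *\<^sub>C P k u) < e" if "m \<ge> N" for m n
  proof -
    have "(norm (\<Sum>k=m..<n. c k *\<^sub>C P k u))\<^sup>2 < e\<^sup>2"
      using N[OF that, of n] by (simp add: norm_sum_scaleC_P)
    then show ?thesis using e by (simp add: power2_less_imp_less)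
  qed
  then show "\<exists>N. \<forall>m\<ge>N. \<forall>n. norm (\<Sum>k=m..<n. c k *\<^sub>C P k u) < e" by blast
qed

definition mult :: "(nat \<Rightarrow> complex) \<Rightarrow> 'a L2 \<Rightarrow> 'a L2" where
  "mult c u = (\<Sum>k. c k *\<^sub>C P k u)"

lemma summable_mult_P: "(\<And>k. norm (c k) \<le> 1) \<Longrightarrow> summable (\<lambda>k. c k *\<^sub>C P k u)"
  by (rule summable_scaleC_P, rule summable_comparison_test[OF _ summable_norm_P[of u]])
     (auto intro!: exI[of _ 0] mult_left_le_one_le power_le_one)

lemma P_mult:
  assumes "\<And>k. norm (c k) \<le> 1"
  shows "P k (mult c u) = c k *\<^sub>C P k u"
proof -
  have "P k (mult c u) = (\<Sum>j. P k (c j *\<^sub>C P j u))"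
    unfolding mult_def
    by (rule bounded_linear.suminf[OF bounded_linear_P summable_mult_P[OF assms]])
  also have "\<dots> = (\<Sum>j\<in>{k}. P k (c j *\<^sub>C P j u))"
    by (rule suminf_finite) (auto simp: P_scaleC P_P)
  finally show ?thesis by (simp add: P_scaleC P_P)
qed

lemma eqI: "(\<And>k. P k u = P k v) \<Longrightarrow> u = v"
  using total[of "u - v"] linear_diff[OF bounded_linear.linear[OF bounded_linear_P], of _ u v] by auto

text \<open>The series with all multipliers 1 converges by Bessel's inequality and has the same
  projections as \<open>u\<close>, so totality identifies its sum.\<close>

lemma P_sums: "(\<lambda>k. P k u) sums u"
proof -
  have "mult (\<lambda>_. 1) u = u" by (rule eqI) (simp add: P_mult)
  then show ?thesis using summable_sums[OF summable_mult_P[of "\<lambda>_. 1" u]] by (simp add: mult_def)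
qed

lemma inner_sums: "(\<lambda>k. P k u \<bullet> P k v) sums (u \<bullet> v)"
  using bounded_linear.sums[OF bounded_linear_inner_left P_sums, of u v]
  by (simp add: P_sym P_P)

lemma norm_sums: "(\<lambda>k. (norm (P k u))\<^sup>2) sums (norm u)\<^sup>2"
  using inner_sums[of u u] by (simp add: power2_norm_eq_inner)

text \<open>Dominated convergence for series (Tannery), applied to the squared norms of the modes.
  It reduces the strong limits in \<open>U_continuous\<close> and \<open>generated_by_U\<close> to
  scalar limits in each mode.\<close>

lemma tendsto_zeroI:
  assumes lim: "\<And>k. ((\<lambda>t. P k (X t)) \<longlongrightarrow> 0) F"
    and le: "\<And>t k. (norm (P k (X t)))\<^sup>2 \<le> M k" and M: "summable M" and F: "F \<noteq> bot"
  shows "(X \<longlongrightarrow> 0) F"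
proof -
  have "((\<lambda>t. \<Sum>k. (norm (P k (X t)))\<^sup>2) \<longlongrightarrow> (\<Sum>k. (0::real))) F"
  proof (rule tannerys_theorem[THEN conjunct2, THEN conjunct2, OF _ _ M F])
    show "((\<lambda>t. (norm (P k (X t)))\<^sup>2) \<longlongrightarrow> 0) F" for k
      using tendsto_power[OF tendsto_norm[OF lim[of k]], of 2] by simp
  qed (use le in \<open>auto intro: always_eventually\<close>)
  moreover have "(\<Sum>k. (norm (P k v))\<^sup>2) = (norm v)\<^sup>2" for v
    using norm_sums[of v] by (simp add: sums_iff)
  ultimately have "((\<lambda>t. (norm (X t))\<^sup>2) \<longlongrightarrow> 0) F" by simp
  from tendsto_real_sqrt[OF this] have "((\<lambda>t. norm (X t)) \<longlongrightarrow> 0) F" by simp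
  then show ?thesis by (rule tendsto_norm_zero_cancel)
qed

section \<open>The diagonal unitary group, its generator and its uniqueness\<close>

definition U :: "real \<Rightarrow> 'a L2 \<Rightarrow> 'a L2" where
  "U \<theta> = mult (\<lambda>k. cis (- (E k * \<theta>)))"

lemma P_U: "P k (U \<theta> u) = cis (- (E k * \<theta>)) *\<^sub>C P k u"
  unfolding U_def by (rule P_mult) simp

lemma U_P: "U \<theta> (P k u) = cis (- (E k * \<theta>)) *\<^sub>C P k u"
  by (rule eqI) (simp add: P_U P_P P_scaleC)

lemma P_diff: "P k (u - v) = P k u - P k v"
  by (rule linear_diff[OF bounded_linear.linear[OF bounded_linear_P]])

lemma norm_U: "norm (U \<theta> u) = norm u"
proof -
  have "(norm (U \<theta> u))\<^sup>2 = (norm u)\<^sup>2"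
    using norm_sums[of "U \<theta> u"] norm_sums[of u] by (simp add: P_U norm_scaleC sums_iff)
  then show ?thesis by (simp add: power2_eq_iff_nonneg)
qed

lemma U_continuous: "continuous_on UNIV (\<lambda>\<theta>. U \<theta> u)"
  unfolding continuous_on_eq_continuous_at[OF open_UNIV] isCont_def
proof
  fix \<eta> :: real
  have "((\<lambda>\<theta>. U \<theta> u - U \<eta> u) \<longlongrightarrow> 0) (at \<eta>)"
  proof (rule tendsto_zeroI)
    fix k
    have "isCont (\<lambda>\<theta>. cis (- E k * \<theta>) *\<^sub>C P k u) \<eta>"
      by (rule has_vector_derivative_continuous[OF cis_scaleC_derivative])
    then have "((\<lambda>\<theta>. cis (- E k * \<theta>) *\<^sub>C P k u - cis (- E k * \<eta>) *\<^sub>C P k u) \<longlongrightarrow> 0) (at \<eta>)"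
      unfolding isCont_def by (simp add: LIM_zero)
    then show "((\<lambda>\<theta>. P k (U \<theta> u - U \<eta> u)) \<longlongrightarrow> 0) (at \<eta>)"
      by (simp add: P_diff P_U)
    have "norm (P k (U \<theta> u - U \<eta> u)) \<le> 2 * norm (P k u)" for \<theta>
      using norm_triangle_ineq4[of "P k (U \<theta> u)" "P k (U \<eta> u)"] by (simp add: P_diff P_U norm_scaleC)
    then have "(norm (P k (U \<theta> u - U \<eta> u)))\<^sup>2 \<le> (2 * norm (P k u))\<^sup>2" for \<theta>
      by (intro power_mono) auto
    then show "(norm (P k (U \<theta> u - U \<eta> u)))\<^sup>2 \<le> 4 * (norm (P k u))\<^sup>2" for \<theta>
      by (simp add: power_mult_distrib)
  qed (simp_all add: summable_mult summable_norm_P)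
  then show "((\<lambda>\<theta>. U \<theta> u) \<longlongrightarrow> U \<eta> u) (at \<eta>)" by (rule LIM_zero_cancel)
qed

lemma unitary_group_U: "unitary_group U"
  unfolding unitary_group_def
proof (intro conjI allI)
  show "U \<theta> (u + v) = U \<theta> u + U \<theta> v" for \<theta> u v
    by (rule eqI) (simp add: P_U P_add scaleC_add_right)
  show "U \<theta> (c *\<^sub>C u) = c *\<^sub>C U \<theta> u" for \<theta> c u
    by (rule eqI) (simp add: P_U P_scaleC mult.commute)
  show "U 0 u = u" for u
    by (rule eqI) (simp add: P_U)
  show "U (\<theta> + \<eta>) u = U \<theta> (U \<eta> u)" for \<theta> \<eta> u
    by (rule eqI) (simp add: P_U cis_mult algebra_simps)
qed (rule norm_U U_continuous)+

lemma norm_cis_minus_one: "norm (cis x - 1) \<le> \<bar>x\<bar>"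
proof -
  have "(norm (cis x - 1))\<^sup>2 = 2 - 2 * cos x"
    using sin_cos_squared_add[of x] by (simp add: cmod_power2 power2_diff)
  also have "\<dots> = (2 * sin (x / 2))\<^sup>2"
    using cos_double_sin[of "x / 2"] by (simp add: power_mult_distrib)
  also have "\<dots> \<le> x\<^sup>2"
    using abs_sin_x_le_abs_x[of "x / 2"] by (subst abs_le_square_iff[symmetric]) (simp add: abs_mult)
  finally show ?thesis by (metis abs_ge_zero power2_abs power2_le_imp_le)
qed

text \<open>The domains have to match exactly. If the weighted modes
  \<open>E k *\<^sub>R P k u\<close> are the modes of some v, the difference quotients converge
  modewise and are dominated by the modes of v. Conversely, the bounded operators \<open>P k\<close>
  can be applied to a derivative that is known to exist.\<close>

lemma generated_by_U: "generated_by U (\<lambda>u v. \<forall>k. P k v = E k *\<^sub>R P k u)"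
  unfolding generated_by_def
proof (intro allI iffI)
  fix u v assume v: "\<forall>k. P k v = E k *\<^sub>R P k u"
  define X where "X = (\<lambda>h. (1 / h) *\<^sub>R (U h u - u) + \<i> *\<^sub>C v)"
  have PX: "P k (X h) = ((cis (- E k * h) - 1) / of_real h + \<i> * of_real (E k)) *\<^sub>C P k u" for k h
    using v by (simp add: X_def P_add P_scaleC P_scaleR P_diff P_U scaleC_add_left scaleR_eq_scaleC
        scaleC_diff_left diff_divide_distrib scaleC_diff_right)
  have "(X \<longlongrightarrow> 0) (at 0)"
  proof (rule tendsto_zeroI)
    fix k
    let ?c = "\<lambda>h. (cis (- E k * h) - 1) / of_real h + \<i> * of_real (E k)"
    have "((\<lambda>h. norm (cis (- E k * h) - 1 - h *\<^sub>R (- (\<i> * of_real (E k)))) / norm h) \<longlongrightarrow> 0) (at 0)"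
      using cis_derivative[of "- E k" 0] by (simp add: has_vector_derivative_def has_derivative_at)
    moreover have "eventually (\<lambda>h. norm (cis (- E k * h) - 1 - h *\<^sub>R (- (\<i> * of_real (E k)))) / norm h = norm (?c h)) (at 0)"
      unfolding eventually_at_filter
    proof (intro always_eventually allI impI)
      fix h :: real assume "h \<noteq> 0"
      then have "cis (- E k * h) - 1 - h *\<^sub>R (- (\<i> * of_real (E k))) = of_real h * ?c h"
        by (simp add: scaleR_conv_of_real field_simps)
      then show "norm (cis (- E k * h) - 1 - h *\<^sub>R (- (\<i> * of_real (E k)))) / norm h = norm (?c h)"
        using \<open>h \<noteq> 0\<close> by (simp only: norm_mult norm_of_real real_norm_def) simp
    qed
    ultimately have "((\<lambda>h. norm (?c h)) \<longlongrightarrow> 0) (at 0)"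
      by (rule Lim_transform_eventually)
    then have "(?c \<longlongrightarrow> 0) (at 0)" by (rule tendsto_norm_zero_cancel)
    from bounded_linear.tendsto[OF bounded_bilinear.bounded_linear_left[OF bounded_bilinear_scaleC] this]
    show "((\<lambda>h. P k (X h)) \<longlongrightarrow> 0) (at 0)" by (simp add: PX)
    \<comment> \<open>The bound is uniform in h; at h = 0 it holds because the quotient is then 0 by
      convention. The unbounded factor \<open>E k\<close> is absorbed below by
      \<open>E k *\<^sub>R P k u = P k v\<close>, which makes the majorant summable.\<close>
    have "norm (?c h) \<le> 2 * \<bar>E k\<bar>" for h
    proof -
      have "norm ((cis (- E k * h) - 1) / of_real h) \<le> \<bar>E k\<bar>"
        using norm_cis_minus_one[of "- E k * h"]
        by (cases "h = 0") (auto simp: norm_divide field_simps abs_mult)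
      then show ?thesis
        using norm_triangle_ineq[of "(cis (- E k * h) - 1) / of_real h" "\<i> * of_real (E k)"]
        by (simp add: norm_mult)
    qed
    then have "norm (P k (X h)) \<le> 2 * \<bar>E k\<bar> * norm (P k u)" for h
      unfolding PX norm_scaleC by (rule mult_right_mono) simp
    also have "2 * \<bar>E k\<bar> * norm (P k u) = 2 * norm (P k v)" using v by simp
    finally have "norm (P k (X h)) \<le> 2 * norm (P k v)" for h .
    then have "(norm (P k (X h)))\<^sup>2 \<le> (2 * norm (P k v))\<^sup>2" for h
      by (intro power_mono) auto
    then show "(norm (P k (X h)))\<^sup>2 \<le> 4 * (norm (P k v))\<^sup>2" for h
      by (simp add: power_mult_distrib)
  qed (simp_all add: summable_mult summable_norm_P)
  then have "((\<lambda>h. norm (X h)) \<longlongrightarrow> 0) (at 0)" by (rule tendsto_norm_zero)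
  moreover have "eventually (\<lambda>h. norm (X h) = norm (U h u - u - h *\<^sub>R ((- \<i>) *\<^sub>C v)) / norm h) (at 0)"
    unfolding eventually_at_filter
  proof (intro always_eventually allI impI)
    fix h :: real assume "h \<noteq> 0"
    then have "U h u - u - h *\<^sub>R ((- \<i>) *\<^sub>C v) = h *\<^sub>R X h"
      by (simp add: X_def scaleR_add_right scaleC_minus_left)
    then show "norm (X h) = norm (U h u - u - h *\<^sub>R ((- \<i>) *\<^sub>C v)) / norm h"
      using \<open>h \<noteq> 0\<close> by simp
  qed
  ultimately have "((\<lambda>h. norm (U h u - u - h *\<^sub>R ((- \<i>) *\<^sub>C v)) / norm h) \<longlongrightarrow> 0) (at 0)"
    by (rule Lim_transform_eventually)
  moreover have "U 0 u = u" by (rule eqI) (simp add: P_U)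
  ultimately show "((\<lambda>\<theta>. U \<theta> u) has_vector_derivative (- \<i>) *\<^sub>C v) (at 0)"
    by (simp add: has_vector_derivative_def has_derivative_at bounded_linear_scaleR_left)
next
  fix u v k assume D: "((\<lambda>\<theta>. U \<theta> u) has_vector_derivative (- \<i>) *\<^sub>C v) (at 0)"
  have "((\<lambda>\<theta>. P k (U \<theta> u)) has_vector_derivative P k ((- \<i>) *\<^sub>C v)) (at 0)"
    by (rule bounded_linear.has_vector_derivative[OF bounded_linear_P D])
  moreover have "((\<lambda>\<theta>. P k (U \<theta> u)) has_vector_derivative (\<i> * of_real (- E k) * cis (- E k * 0)) *\<^sub>C P k u) (at 0)"
    using cis_scaleC_derivative[of "- E k" "P k u" 0] by (simp add: P_U)
  ultimately have "P k ((- \<i>) *\<^sub>C v) = (\<i> * of_real (- E k) * cis (- E k * 0)) *\<^sub>C P k u"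
    by (rule vector_derivative_unique_at)
  then have "\<i> *\<^sub>C P k ((- \<i>) *\<^sub>C v) = \<i> *\<^sub>C ((\<i> * of_real (- E k)) *\<^sub>C P k u)" by simp
  then show "P k v = E k *\<^sub>R P k u" by (simp add: P_scaleC scaleR_eq_scaleC)
qed

text \<open>The generator fixes \<open>V\<close> on each eigenspace through a differential equation.
  On a general vector \<open>V\<close> is then known by duality: it preserves inner products, and
  the modes of \<open>V \<theta> u\<close> are tested against eigenvectors only.\<close>

lemma unitary_group_unique:
  assumes V: "unitary_group V" and gen: "generated_by V (\<lambda>u v. \<forall>k. P k v = E k *\<^sub>R P k u)"
  shows "V = U"
proof -
  have V_add: "V \<theta> (u + v) = V \<theta> u + V \<theta> v" and V_scaleC: "V \<theta> (c *\<^sub>C u) = c *\<^sub>C V \<theta> u"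
    and V_norm: "norm (V \<theta> u) = norm u" and V_0: "V 0 u = u"
    and V_plus: "V (\<theta> + \<eta>) u = V \<theta> (V \<eta> u)" for \<theta> \<eta> c u v
    using V unfolding unitary_group_def by auto
  have bl: "bounded_linear (V \<theta>)" for \<theta>
    by (rule bounded_linear_intro[where K = 1]) (auto simp: V_add V_scaleC scaleR_eq_scaleC V_norm)
  \<comment> \<open>Polarization: an additive isometry preserves the real inner product.\<close>
  have V_inner: "V \<theta> u \<bullet> V \<theta> v = u \<bullet> v" for \<theta> u v
  proof -
    have n: "V \<theta> w \<bullet> V \<theta> w = w \<bullet> w" for w
      by (metis V_norm power2_norm_eq_inner)
    show ?thesis
      using n[of "u + v"] n[of u] n[of v]
      by (simp add: V_add inner_add_left inner_add_right inner_commute)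
  qed
  have V_P: "V \<theta> (P k u) = cis (- (E k * \<theta>)) *\<^sub>C P k u" for \<theta> k u
  proof -
    let ?e = "P k u"
    have D0: "((\<lambda>\<theta>. V \<theta> ?e) has_vector_derivative (- \<i>) *\<^sub>C (E k *\<^sub>R ?e)) (at 0)"
    proof -
      have "\<forall>j. P j (E k *\<^sub>R ?e) = E j *\<^sub>R P j ?e" by (simp add: P_scaleR P_P)
      then show ?thesis using gen unfolding generated_by_def by blast
    qed
    have D: "((\<lambda>\<theta>. V \<theta> ?e) has_vector_derivative (- \<i> * of_real (E k)) *\<^sub>C V \<theta> ?e) (at \<theta>)" for \<theta>
    proof -
      have "((\<lambda>h. V \<theta> (V h ?e)) has_vector_derivative V \<theta> ((- \<i>) *\<^sub>C (E k *\<^sub>R ?e))) (at 0)"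
        by (rule bounded_linear.has_vector_derivative[OF bl D0])
      then have "((\<lambda>h. V (\<theta> + h) ?e) has_vector_derivative (- \<i> * of_real (E k)) *\<^sub>C V \<theta> ?e) (at 0)"
        by (simp add: V_plus V_scaleC scaleR_eq_scaleC)
      then show ?thesis
        by (simp add: has_vector_derivative_def has_derivative_at)
    qed
    \<comment> \<open>Rotating back by the expected phase leaves a function with zero derivative,
      hence a constant.\<close>
    define g where "g = (\<lambda>\<theta>. cis (E k * \<theta>) *\<^sub>C V \<theta> ?e)"
    have "(g has_vector_derivative 0) (at \<theta> within UNIV)" for \<theta>
    proof -
      have "(g has_vector_derivative (cis (E k * \<theta>) *\<^sub>C ((- \<i> * of_real (E k)) *\<^sub>C V \<theta> ?e)
           + (\<i> * of_real (E k) * cis (E k * \<theta>)) *\<^sub>C V \<theta> ?e)) (at \<theta>)"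
        unfolding g_def by (rule bounded_bilinear.has_vector_derivative[OF bounded_bilinear_scaleC cis_derivative D])
      then show ?thesis by (simp add: algebra_simps flip: scaleC_add_left)
    qed
    then have "g \<theta> = g 0"
      using has_vector_derivative_zero_constant[of UNIV g] by (metis UNIV_I convex_UNIV)
    then have "cis (E k * \<theta>) *\<^sub>C V \<theta> ?e = ?e" by (simp add: g_def V_0)
    then have "cis (- (E k * \<theta>)) *\<^sub>C cis (E k * \<theta>) *\<^sub>C V \<theta> ?e = cis (- (E k * \<theta>)) *\<^sub>C ?e" by simp
    then show ?thesis by (simp add: cis_mult)
  qed
  have "V \<theta> u = U \<theta> u" for \<theta> u
  proof (rule eqI)
    fix k
    have "P k (V \<theta> u) \<bullet> w = P k (U \<theta> u) \<bullet> w" for w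
    proof -
      \<comment> \<open>The inserted \<open>V (\<theta> + - \<theta>)\<close> is the identity;
        splitting it by the group law lets \<open>V \<theta>\<close> cancel on both sides of the
        inner product.\<close>
      have "P k (V \<theta> u) \<bullet> w = V \<theta> u \<bullet> V (\<theta> + - \<theta>) (P k w)" by (simp add: P_sym V_0)
      also have "\<dots> = u \<bullet> V (- \<theta>) (P k w)" unfolding V_plus V_inner ..
      also have "\<dots> = P k (U \<theta> u) \<bullet> w" by (simp add: V_P P_U inner_scaleC P_sym P_scaleC cis_cnj)
      finally show ?thesis .
    qed
    then show "P k (V \<theta> u) = P k (U \<theta> u)" by (metis inner_commute vector_eq_rdot)
  qed
  then show ?thesis by (intro ext)
qed

text \<open>Resolves the definite description in \<open>exp_group\<close>: the diagonal group has
  this generator, and no other unitary group does.\<close>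

lemma exp_group_eq: "exp_group A = U" if "\<And>u v. A u v \<longleftrightarrow> (\<forall>k. P k v = E k *\<^sub>R P k u)"
proof -
  have "A = (\<lambda>u v. \<forall>k. P k v = E k *\<^sub>R P k u)" by (intro ext) (rule that)
  then show ?thesis
    unfolding exp_group_def
    by (intro the_equality conjI) (simp_all add: unitary_group_U generated_by_U unitary_group_unique)
qed

end

section \<open>Test functions\<close>

abbreviation has_dir_deriv :: "'a::euclidean_space \<Rightarrow> ('a \<Rightarrow> real) \<Rightarrow> real \<Rightarrow> 'a \<Rightarrow> bool" where
  "has_dir_deriv e f d z \<equiv> ((\<lambda>s. f (z + s *\<^sub>R e)) has_real_derivative d) (at 0)"

lemma dir_deriv_eq: "has_dir_deriv e f d z \<Longrightarrow> dir_deriv e f z = d"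
  unfolding dir_deriv_def by (rule DERIV_imp_deriv)

lemma C_k_continuous: "C_k k f \<Longrightarrow> continuous_on UNIV f"
  by (cases k) auto

lemma C_k_SucI:
  assumes "continuous_on UNIV f" "\<And>e z. e \<in> Basis \<Longrightarrow> has_dir_deriv e f (D e z) z"
    "\<And>e. e \<in> Basis \<Longrightarrow> C_k k (D e)"
  shows "C_k (Suc k) f"
proof -
  have "dir_deriv e f = D e" if "e \<in> Basis" for e
    using assms(2)[OF that] by (intro ext dir_deriv_eq)
  then show ?thesis
    using assms by (auto simp: real_differentiable_def)
qed

lemma C_k_SucD:
  assumes "C_k (Suc k) f" "e \<in> Basis"
  shows "has_dir_deriv e f (dir_deriv e f z) z" "C_k k (dir_deriv e f)"
  using assms by (auto simp: dir_deriv_def DERIV_deriv_iff_real_differentiable)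

lemma C_k_pred: "C_k (Suc k) f \<Longrightarrow> C_k k f"
proof (induction k arbitrary: f)
  case (Suc k)
  then show ?case by (intro C_k_SucI[where D = "\<lambda>e. dir_deriv e f"])
      (auto intro: C_k_SucD C_k_continuous simp del: C_k.simps)
qed auto

lemma C_k_const: "C_k k (\<lambda>_. c)"
proof (induction k arbitrary: c)
  case (Suc k)
  show ?case by (rule C_k_SucI[where D = "\<lambda>_ _. 0"]) (auto simp: Suc)
qed auto

lemma C_k_add: "C_k k f \<Longrightarrow> C_k k g \<Longrightarrow> C_k k (\<lambda>z. f z + g z)"
proof (induction k arbitrary: f g)
  case (Suc k)
  show ?case
    by (rule C_k_SucI[where D = "\<lambda>e z. dir_deriv e f z + dir_deriv e g z"])
       (use Suc in \<open>auto intro!: continuous_on_add DERIV_add C_k_SucD Suc.IH intro: C_k_continuous simp del: C_k.simps\<close>)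
qed (auto intro: continuous_on_add)

lemma C_k_mult: "C_k k f \<Longrightarrow> C_k k g \<Longrightarrow> C_k k (\<lambda>z. f z * g z)"
proof (induction k arbitrary: f g)
  case (Suc k)
  show ?case
  proof (rule C_k_SucI[where D = "\<lambda>e z. dir_deriv e f z * g z + dir_deriv e g z * f z"])
    fix e z :: 'a assume e: "e \<in> Basis"
    show "has_dir_deriv e (\<lambda>z. f z * g z) (dir_deriv e f z * g z + dir_deriv e g z * f z) z"
      using DERIV_mult[OF C_k_SucD(1)[OF Suc.prems(1) e] C_k_SucD(1)[OF Suc.prems(2) e], of z z] by simp
    show "C_k k (\<lambda>z. dir_deriv e f z * g z + dir_deriv e g z * f z)"
      by (intro C_k_add Suc.IH Suc.prems[THEN C_k_SucD(2)] e Suc.prems[THEN C_k_pred])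
  qed (use Suc.prems in \<open>auto intro!: continuous_on_mult intro: C_k_continuous simp del: C_k.simps\<close>)
qed (auto intro: continuous_on_mult)

lemma has_derivative_shift [simp]:
  fixes f :: "real \<Rightarrow> real"
  shows "((\<lambda>s. f (z + s)) has_real_derivative d) (at 0) \<longleftrightarrow> (f has_real_derivative d) (at z)"
  using DERIV_shift[of f d 0 z] by (simp add: add.commute)

lemma has_dir_deriv_real:
  fixes f :: "real \<Rightarrow> real"
  shows "has_dir_deriv 1 f d z \<longleftrightarrow> (f has_real_derivative d) (at z)"
  by simp

lemma dir_deriv_real: "dir_deriv 1 f = deriv f" for f :: "real \<Rightarrow> real"
proof
  show "dir_deriv 1 f x = deriv f x" for x
    unfolding dir_deriv_def deriv_def by simp
qed

lemma C_k_realI: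
  assumes "\<And>x. (f has_real_derivative f' x) (at x)" "C_k k f'"
  shows "C_k (Suc k) f"
  by (rule C_k_SucI[where D = "\<lambda>_. f'"])
     (use assms in \<open>auto simp: continuous_on_eq_continuous_at intro: DERIV_isCont\<close>)

lemma C_k_realD:
  fixes f :: "real \<Rightarrow> real"
  assumes "C_k (Suc k) f"
  shows "(f has_real_derivative deriv f x) (at x)" "C_k k (deriv f)"
  using C_k_SucD[OF assms, of 1] by (auto simp: dir_deriv_real)

lemma C_k_affine: "C_k k f \<Longrightarrow> C_k k (\<lambda>x::real. f (a * x + c))"
proof (induction k arbitrary: f)
  case 0
  then show ?case by (auto intro!: continuous_on_compose2[of UNIV f] continuous_intros)
next
  case (Suc k)
  show ?case
  proof (rule C_k_realI)
    show "((\<lambda>x. f (a * x + c)) has_real_derivative a * deriv f (a * x + c)) (at x)" for x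
      by (rule DERIV_chain2[OF C_k_realD(1)[OF Suc.prems], THEN DERIV_cong]) (auto intro!: derivative_eq_intros)
    show "C_k k (\<lambda>x. a * deriv f (a * x + c))"
      by (intro C_k_mult C_k_const Suc.IH C_k_realD(2)[OF Suc.prems])
  qed
qed

lemma Basis_plane: "Basis = {(1, 0), (0, 1) :: real \<times> real}"
  by (auto simp: Basis_prod_def)

lemma C_k_fst: "C_k k f \<Longrightarrow> C_k k (\<lambda>z::real \<times> real. f (fst z))"
proof (induction k arbitrary: f)
  case 0
  then show ?case by (auto intro!: continuous_on_compose2[of UNIV f] continuous_intros)
next
  case (Suc k)
  show ?case
  proof (rule C_k_SucI[where D = "\<lambda>e z. if e = (1, 0) then deriv f (fst z) else 0"])
    show "continuous_on UNIV (\<lambda>z::real \<times> real. f (fst z))"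
      using C_k_continuous[OF Suc.prems] by (auto intro!: continuous_on_compose2[of UNIV f] continuous_intros)
  next
    fix e z :: "real \<times> real" assume "e \<in> Basis"
    then show "has_dir_deriv e (\<lambda>z. f (fst z)) (if e = (1, 0) then deriv f (fst z) else 0) z"
      using has_dir_deriv_real[of f "deriv f (fst z)" "fst z"] C_k_realD(1)[OF Suc.prems]
      by (auto simp: Basis_plane)
  next
    fix e :: "real \<times> real"
    show "C_k k (\<lambda>z::real \<times> real. if e = (1, 0) then deriv f (fst z) else 0)"
      by (cases "e = (1, 0)") (simp_all add: C_k_const Suc.IH[OF C_k_realD(2)[OF Suc.prems]] del: C_k.simps)
  qed
qed

lemma C_k_snd: "C_k k f \<Longrightarrow> C_k k (\<lambda>z::real \<times> real. f (snd z))"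
proof (induction k arbitrary: f)
  case 0
  then show ?case by (auto intro!: continuous_on_compose2[of UNIV f] continuous_intros)
next
  case (Suc k)
  show ?case
  proof (rule C_k_SucI[where D = "\<lambda>e z. if e = (0, 1) then deriv f (snd z) else 0"])
    show "continuous_on UNIV (\<lambda>z::real \<times> real. f (snd z))"
      using C_k_continuous[OF Suc.prems] by (auto intro!: continuous_on_compose2[of UNIV f] continuous_intros)
  next
    fix e z :: "real \<times> real" assume "e \<in> Basis"
    then show "has_dir_deriv e (\<lambda>z. f (snd z)) (if e = (0, 1) then deriv f (snd z) else 0) z"
      using has_dir_deriv_real[of f "deriv f (snd z)" "snd z"] C_k_realD(1)[OF Suc.prems]
      by (auto simp: Basis_plane)
  next
    fix e :: "real \<times> real"
    show "C_k k (\<lambda>z::real \<times> real. if e = (0, 1) then deriv f (snd z) else 0)"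
      by (cases "e = (0, 1)") (simp_all add: C_k_const Suc.IH[OF C_k_realD(2)[OF Suc.prems]] del: C_k.simps)
  qed
qed

text \<open>Gives smoothness of all orders from one closure property, without formulas for higher
  derivatives; it is applied to the ranges of \<open>flat_exp\<close> and \<open>pg\<close>.\<close>

lemma C_k_family:
  fixes S :: "(real \<Rightarrow> real) set"
  assumes S: "\<And>f. f \<in> S \<Longrightarrow> \<exists>f'\<in>S. \<forall>x. (f has_real_derivative f' x) (at x)" and f: "f \<in> S"
  shows "C_k k f"
  using f
proof (induction k arbitrary: f)
  case 0
  then show ?case using S[OF 0] by (auto simp: continuous_on_eq_continuous_at intro: DERIV_isCont)
next
  case (Suc k)
  then show ?case using S[OF Suc.prems] C_k_realI by blast
qed

lemma test_function_iff: "test_function f \<longleftrightarrow> (\<forall>k. C_k k f) \<and> bounded {z. f z \<noteq> 0}"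
  by (simp add: test_function_def)

lemma test_function_continuous: "test_function f \<Longrightarrow> continuous_on UNIV f"
  unfolding test_function_def using C_k_continuous by blast

lemma test_function_measurable: "test_function f \<Longrightarrow> f \<in> borel_measurable borel"
  by (intro borel_measurable_continuous_onI test_function_continuous)

lemma test_function_mult_smooth:
  "(\<And>k. C_k k f) \<Longrightarrow> test_function g \<Longrightarrow> test_function (\<lambda>z. f z * g z)"
  unfolding test_function_iff by (auto intro: C_k_mult elim!: bounded_subset)

lemma test_function_affine:
  fixes f :: "real \<Rightarrow> real"
  assumes "test_function f" "a \<noteq> 0"
  shows "test_function (\<lambda>x. f (a * x + c))"
proof -
  have "{x. f (a * x + c) \<noteq> 0} \<subseteq> (\<lambda>x. (1 / a) *\<^sub>R (x + (- c))) ` {x. f x \<noteq> 0}"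
  proof
    fix x assume "x \<in> {x. f (a * x + c) \<noteq> 0}"
    then show "x \<in> (\<lambda>x. (1 / a) *\<^sub>R (x + (- c))) ` {x. f x \<noteq> 0}"
      using assms(2) by (intro image_eqI[of _ _ "a * x + c"]) auto
  qed
  moreover have "bounded ((\<lambda>x. (1 / a) *\<^sub>R (x + (- c))) ` {x. f x \<noteq> 0})"
    using assms(1) bounded_scaling[OF bounded_translation, of "{x. f x \<noteq> 0}" "1 / a" "- c"]
    by (simp add: test_function_iff image_image add.commute)
  ultimately show ?thesis
    using assms by (auto simp: test_function_iff intro: C_k_affine bounded_subset)
qed

lemma test_function_tensor:
  assumes "test_function f" "test_function g"
  shows "test_function (\<lambda>z::real \<times> real. f (fst z) * g (snd z))"
proof -
  have "{z. f (fst z) * g (snd z) \<noteq> 0} = {x. f x \<noteq> 0} \<times> {y. g y \<noteq> 0}" by auto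
  moreover have "C_k k (\<lambda>z::real \<times> real. f (fst z) * g (snd z))" for k
    using assms unfolding test_function_iff by (intro C_k_mult C_k_fst C_k_snd) auto
  ultimately show ?thesis
    using assms by (simp add: test_function_iff bounded_Times del: mult_eq_0_iff)
qed

lemma test_function_has_dir_deriv:
  "test_function f \<Longrightarrow> e \<in> Basis \<Longrightarrow> has_dir_deriv e f (dir_deriv e f z) z"
  unfolding test_function_def using C_k_SucD(1) by blast

text \<open>Off the closed support the function vanishes along a short segment in direction e, so
  the derivative is 0 there and the support does not grow.\<close>

lemma test_function_dir_deriv:
  assumes f: "test_function f" and e: "e \<in> Basis"
  shows "test_function (dir_deriv e f)"
proof -
  have "{z. dir_deriv e f z \<noteq> 0} \<subseteq> closure {z. f z \<noteq> 0}"
  proof (rule ccontr)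
    assume "\<not> ?thesis"
    then obtain z where z: "dir_deriv e f z \<noteq> 0" "z \<in> - closure {z. f z \<noteq> 0}" by auto
    have "open ((\<lambda>s. z + s *\<^sub>R e) -` (- closure {z. f z \<noteq> 0}))"
      by (intro continuous_open_vimage) (auto intro!: continuous_intros)
    then have "((\<lambda>s. f (z + s *\<^sub>R e)) has_real_derivative 0) (at 0)"
    proof (rule has_field_derivative_transform_within_open[OF DERIV_const])
      show "0 \<in> (\<lambda>s. z + s *\<^sub>R e) -` (- closure {z. f z \<noteq> 0})" using z(2) by simp
      show "0 = f (z + s *\<^sub>R e)" if "s \<in> (\<lambda>s. z + s *\<^sub>R e) -` (- closure {z. f z \<noteq> 0})" for s
        using that closure_subset[of "{z. f z \<noteq> 0}"] by auto
    qed
    then show False using z(1) dir_deriv_eq by blast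
  qed
  moreover have "bounded (closure {z. f z \<noteq> 0})" using f by (simp add: test_function_iff bounded_closure)
  ultimately show ?thesis
    using f e C_k_SucD(2) unfolding test_function_iff by (blast intro: bounded_subset)
qed

lemma test_function_deriv:
  fixes f :: "real \<Rightarrow> real"
  assumes "test_function f"
  shows "test_function (deriv f)" "(f has_real_derivative deriv f x) (at x)"
  using test_function_dir_deriv[OF assms, of 1] test_function_has_dir_deriv[OF assms, of 1 x]
  by (auto simp: dir_deriv_real)

lemma test_function_bounded:
  assumes f: "test_function f"
  obtains C R where "\<And>z. \<bar>f z\<bar> \<le> C" "\<And>z. f z \<noteq> 0 \<Longrightarrow> norm z \<le> R" "C \<ge> 0" "R \<ge> 0"
proof -
  obtain R where R: "\<And>z. f z \<noteq> 0 \<Longrightarrow> norm z \<le> R"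
    using f by (auto simp: test_function_iff bounded_iff)
  have "compact (f ` cball 0 R)"
    by (rule compact_continuous_image) (use test_function_continuous[OF f] in \<open>auto intro: continuous_on_subset\<close>)
  then obtain C where C: "\<And>z. z \<in> cball 0 R \<Longrightarrow> \<bar>f z\<bar> \<le> C"
    using compact_imp_bounded[of "f ` cball 0 R"] unfolding bounded_iff by fastforce
  show ?thesis
  proof (rule that[of "max 0 C" "max 0 R"])
    show "\<bar>f z\<bar> \<le> max 0 C" for z
      using C[of z] R[of z] by (cases "f z = 0") auto
    show "norm z \<le> max 0 R" if "f z \<noteq> 0" for z using R[OF that] by simp
  qed auto
qed

text \<open>On the support, where the norm is at most R, the factor
  \<open>exp (a * R\<^sup>2)\<close> compensates the Gaussian. This brings test functions and
  Hermite functions under the same integrability lemmas.\<close>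

lemma test_function_gauss_bound:
  assumes f: "test_function f" and a: "a \<ge> 0"
  obtains C where "\<And>z. \<bar>f z\<bar> \<le> C * exp (- a * (norm z)\<^sup>2)" "C \<ge> 0"
proof -
  obtain C R where CR: "\<And>z. \<bar>f z\<bar> \<le> C" "\<And>z. f z \<noteq> 0 \<Longrightarrow> norm z \<le> R" "C \<ge> 0" "R \<ge> 0"
    by (rule test_function_bounded[OF f]) auto
  show ?thesis
  proof (rule that)
    show "\<bar>f z\<bar> \<le> C * exp (a * R\<^sup>2) * exp (- a * (norm z)\<^sup>2)" for z
    proof (cases "f z = 0")
      case False
      have "1 \<le> exp (a * R\<^sup>2 + - a * (norm z)\<^sup>2)"
        using CR(2)[OF False] a by (auto intro!: mult_left_mono power_mono)
      then have "C * 1 \<le> C * exp (a * R\<^sup>2 + - a * (norm z)\<^sup>2)"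
        using CR(3) by (intro mult_left_mono)
      then show ?thesis using CR(1)[of z] by (simp add: exp_add[symmetric] mult.assoc)
    qed (use CR in auto)
  qed (use CR in auto)
qed

lemma dir_deriv_tensor:
  fixes f g :: "real \<Rightarrow> real"
  shows "test_function f \<Longrightarrow> dir_deriv (1, 0) (\<lambda>z. f (fst z) * g (snd z)) = (\<lambda>z. deriv f (fst z) * g (snd z))"
    and "test_function g \<Longrightarrow> dir_deriv (0, 1) (\<lambda>z. f (fst z) * g (snd z)) = (\<lambda>z. f (fst z) * deriv g (snd z))"
proof -
  assume f: "test_function f"
  show "dir_deriv (1, 0) (\<lambda>z. f (fst z) * g (snd z)) = (\<lambda>z. deriv f (fst z) * g (snd z))"
  proof
    show "dir_deriv (1, 0) (\<lambda>z. f (fst z) * g (snd z)) z = deriv f (fst z) * g (snd z)" for z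
      using test_function_has_dir_deriv[OF f, of 1 "fst z"]
      by (intro dir_deriv_eq) (auto simp: dir_deriv_real intro!: derivative_eq_intros)
  qed
next
  assume g: "test_function g"
  show "dir_deriv (0, 1) (\<lambda>z. f (fst z) * g (snd z)) = (\<lambda>z. f (fst z) * deriv g (snd z))"
  proof
    show "dir_deriv (0, 1) (\<lambda>z. f (fst z) * g (snd z)) z = f (fst z) * deriv g (snd z)" for z
      using test_function_has_dir_deriv[OF g, of 1 "snd z"]
      by (intro dir_deriv_eq) (auto simp: dir_deriv_real intro!: derivative_eq_intros)
  qed
qed

section \<open>A smooth bump with compact support\<close>

definition flat_exp :: "real poly \<Rightarrow> real \<Rightarrow> real" where
  "flat_exp p x = (if x > 0 then poly p (inverse x) * exp (- inverse x) else 0)"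

lemma poly_exp_tendsto_0: "((\<lambda>y. poly p y * exp (- y)) \<longlongrightarrow> (0::real)) at_top"
proof -
  have "((\<lambda>y. \<Sum>i\<le>degree p. coeff p i * (y ^ i / exp y)) \<longlongrightarrow> (\<Sum>i\<le>degree p. coeff p i * 0)) at_top"
    by (intro tendsto_intros tendsto_power_div_exp_0)
  moreover have "(\<Sum>i\<le>degree p. coeff p i * (y ^ i / exp y)) = poly p y * exp (- y)" for y
    by (simp add: poly_altdef sum_distrib_right exp_minus divide_inverse mult.assoc)
  ultimately show ?thesis by simp
qed

text \<open>With y = 1/x the derivative of p(y) exp(-y) is y^2 (p - p')(y) exp(-y), so the family is
  closed under differentiation. At 0 from the right the difference quotient is y p(y) exp(-y), which
  tends to 0 as y grows.\<close>

lemma flat_exp_deriv: "(flat_exp p has_real_derivative flat_exp (monom 1 2 * (p - pderiv p)) x) (at x)"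
proof -
  consider "x > 0" | "x < 0" | "x = 0" by linarith
  then show ?thesis
  proof cases
    case 1
    have "((\<lambda>x. poly p (inverse x) * exp (- inverse x)) has_real_derivative
        flat_exp (monom 1 2 * (p - pderiv p)) x) (at x)"
      using 1 by (auto intro!: derivative_eq_intros poly_DERIV[THEN DERIV_chain2]
          simp: flat_exp_def poly_monom power2_eq_square algebra_simps)
    then show ?thesis
      by (rule has_field_derivative_transform_within_open[of _ _ _ "{0<..}"]) (use 1 in \<open>auto simp: flat_exp_def\<close>)
  next
    case 2
    show ?thesis
      by (rule has_field_derivative_transform_within_open[of "\<lambda>_. 0" _ _ "{..<0}"]) (use 2 in \<open>auto simp: flat_exp_def\<close>)
  next
    case 3
    have "((\<lambda>h. poly (monom 1 1 * p) (inverse h) * exp (- inverse h)) \<longlongrightarrow> 0) (at_right 0)"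
      by (rule filterlim_compose[OF poly_exp_tendsto_0 filterlim_inverse_at_top_right])
    then have "((\<lambda>h. (flat_exp p (0 + h) - flat_exp p 0) / h) \<longlongrightarrow> 0) (at_right 0)"
      by (rule Lim_transform_eventually)
         (auto simp: eventually_at_filter flat_exp_def poly_monom divide_inverse intro!: always_eventually)
    moreover have "((\<lambda>h. (flat_exp p (0 + h) - flat_exp p 0) / h) \<longlongrightarrow> 0) (at_left 0)"
      by (rule Lim_transform_eventually[OF tendsto_const])
         (auto simp: eventually_at_filter flat_exp_def intro!: always_eventually)
    ultimately have "((\<lambda>h. (flat_exp p (0 + h) - flat_exp p 0) / h) \<longlongrightarrow> 0) (at 0)"
      by (simp add: filterlim_split_at)
    then show ?thesis using 3 by (simp add: DERIV_def flat_exp_def)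
  qed
qed

lemma test_function_bump:
  obtains \<eta> :: "real \<Rightarrow> real" where "test_function \<eta>" "\<eta> 0 = 1"
proof -
  have C: "C_k k (flat_exp p)" for k p
    by (rule C_k_family[of "range flat_exp"]) (use flat_exp_deriv in blast)+
  \<comment> \<open>The product of the flat functions of 1 + x and 1 - x lives on (-1, 1); its value
    at 0 is exp(-2), which the factor \<open>exp 2\<close> normalizes.\<close>
  let ?\<eta> = "\<lambda>x. exp 2 * (flat_exp 1 (1 * x + 1) * flat_exp 1 ((- 1) * x + 1))"
  have "{x. ?\<eta> x \<noteq> 0} \<subseteq> cball 0 1" by (auto simp: flat_exp_def split: if_splits)
  then have "bounded {x. ?\<eta> x \<noteq> 0}" by (rule bounded_subset[OF bounded_cball])
  moreover have "C_k k ?\<eta>" for k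
    by (intro C_k_mult C_k_const C_k_affine C)
  ultimately have "test_function ?\<eta>"
    by (simp add: test_function_iff)
  moreover have "?\<eta> 0 = 1" by (simp add: flat_exp_def flip: exp_add)
  ultimately show ?thesis by (rule that)
qed

section \<open>Hermite functions\<close>

lemma integrable_gauss_real:
  assumes "a > 0"
  shows "integrable lborel (\<lambda>x::real. exp (- a * x\<^sup>2))"
proof -
  \<comment> \<open>The standard deviation for which the normal density has the exponent
    \<open>- a * x\<^sup>2\<close>, that is 2 s^2 = 1/a.\<close>
  define s where "s = sqrt (1 / (2 * a))"
  have s: "s > 0" "2 * s\<^sup>2 = 1 / a" using assms by (auto simp: s_def)
  have "integrable lborel (\<lambda>x. sqrt (2 * pi * s\<^sup>2) * normal_density 0 s x)"
    by (intro integrable_mult_right integrable_normal_density) (use s in auto)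
  moreover have "sqrt (2 * pi * s\<^sup>2) * normal_density 0 s x = exp (- a * x\<^sup>2)" for x
    unfolding normal_density_def using s assms by simp
  ultimately show ?thesis by simp
qed

text \<open>Induction on the degree with arbitrary rate: each further factor x costs half of the
  rate, since |x| <= (2/c) exp(c|x|/2).\<close>

lemma poly_exp_abs_bound:
  fixes p :: "real poly"
  assumes "c > 0"
  shows "\<exists>C\<ge>0. \<forall>x. \<bar>poly p x\<bar> \<le> C * exp (c * \<bar>x\<bar>)"
  using assms
proof (induction p arbitrary: c)
  case 0
  show ?case by (rule exI[of _ 0]) simp
next
  case (pCons a p)
  then obtain C where C: "C \<ge> 0" "\<And>x. \<bar>poly p x\<bar> \<le> C * exp (c / 2 * \<bar>x\<bar>)"
    by (metis half_gt_zero)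
  have "\<bar>poly (pCons a p) x\<bar> \<le> (\<bar>a\<bar> + 2 / c * C) * exp (c * \<bar>x\<bar>)" for x
  proof -
    have "c / 2 * \<bar>x\<bar> \<le> exp (c / 2 * \<bar>x\<bar>)"
      using exp_ge_add_one_self[of "c / 2 * \<bar>x\<bar>"] by linarith
    then have "\<bar>x\<bar> \<le> 2 / c * exp (c / 2 * \<bar>x\<bar>)" using pCons.prems by (simp add: field_simps)
    then have "\<bar>x\<bar> * \<bar>poly p x\<bar> \<le> (2 / c * exp (c / 2 * \<bar>x\<bar>)) * (C * exp (c / 2 * \<bar>x\<bar>))"
      using C pCons.prems by (intro mult_mono) auto
    also have "\<dots> = 2 / c * C * exp (c * \<bar>x\<bar>)" by (simp flip: exp_add)
    finally have "\<bar>x * poly p x\<bar> \<le> 2 / c * C * exp (c * \<bar>x\<bar>)" by (simp add: abs_mult)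
    moreover have "\<bar>a\<bar> * 1 \<le> \<bar>a\<bar> * exp (c * \<bar>x\<bar>)"
      using pCons.prems by (intro mult_left_mono) auto
    ultimately show ?thesis
      using abs_triangle_ineq[of a "x * poly p x"] by (simp add: algebra_simps)
  qed
  then show ?case using C pCons.prems by (intro exI[of _ "\<bar>a\<bar> + 2 / c * C"]) auto
qed

lemma poly_gauss_bound:
  fixes p :: "real poly"
  assumes "0 < a'" "a' < a"
  obtains C where "\<And>x. \<bar>poly p x * exp (- a * x\<^sup>2)\<bar> \<le> C * exp (- a' * x\<^sup>2)" "C \<ge> 0"
proof -
  define d where "d = a - a'"
  have d: "d > 0" using assms by (simp add: d_def)
  obtain C where C: "C \<ge> 0" "\<And>x. \<bar>poly p x\<bar> \<le> C * exp (1 * \<bar>x\<bar>)"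
    using poly_exp_abs_bound[of 1 p] by auto
  have "\<bar>poly p x * exp (- a * x\<^sup>2)\<bar> \<le> C * exp (1 / (4 * d)) * exp (- a' * x\<^sup>2)" for x
  proof -
    \<comment> \<open>Completing the square with d = a - a': the growth exp |x| allowed to the
      polynomial is absorbed by exp(-d x^2) at the price of the constant exp(1/(4d)).\<close>
    have "0 \<le> (2 * d * \<bar>x\<bar> - 1)\<^sup>2 / (4 * d)" using d by simp
    also have "\<dots> = d * x\<^sup>2 - \<bar>x\<bar> + 1 / (4 * d)" using d by (simp add: power2_eq_square field_simps)
    finally have "\<bar>x\<bar> + - a * x\<^sup>2 \<le> 1 / (4 * d) + - a' * x\<^sup>2" by (simp add: d_def algebra_simps)
    then have "exp (\<bar>x\<bar> + - a * x\<^sup>2) \<le> exp (1 / (4 * d) + - a' * x\<^sup>2)" by simp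
    then have "C * (exp \<bar>x\<bar> * exp (- a * x\<^sup>2)) \<le> C * (exp (1 / (4 * d)) * exp (- a' * x\<^sup>2))"
      using C(1) by (intro mult_left_mono) (simp_all only: exp_add)
    moreover have "\<bar>poly p x\<bar> * exp (- a * x\<^sup>2) \<le> C * exp \<bar>x\<bar> * exp (- a * x\<^sup>2)"
      using C(2)[of x] by (intro mult_right_mono) auto
    ultimately show ?thesis unfolding abs_mult abs_exp_cancel mult.assoc by linarith
  qed
  then show ?thesis using C(1) by (intro that[of "C * exp (1 / (4 * d))"]) auto
qed

lemma integrable_poly_gauss:
  fixes p :: "real poly"
  assumes "a > 0"
  shows "integrable lborel (\<lambda>x. poly p x * exp (- a * x\<^sup>2))"
proof -
  obtain C where C: "\<And>x. \<bar>poly p x * exp (- a * x\<^sup>2)\<bar> \<le> C * exp (- (a / 2) * x\<^sup>2)" "C \<ge> 0"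
    using poly_gauss_bound[of "a / 2" a p] assms by auto
  have "integrable lborel (\<lambda>x. C * exp (- (a / 2) * x\<^sup>2))"
    using assms by (intro integrable_mult_right integrable_gauss_real) auto
  then show ?thesis
    by (rule Bochner_Integration.integrable_bound)
       (use C in \<open>auto intro!: borel_measurable_continuous_onI continuous_intros simp: abs_mult\<close>)
qed

lemma poly_gauss_tendsto_0:
  fixes p :: "real poly"
  assumes "a > 0"
  shows "((\<lambda>x. poly p x * exp (- a * x\<^sup>2)) \<longlongrightarrow> 0) at_top" "((\<lambda>x. poly p x * exp (- a * x\<^sup>2)) \<longlongrightarrow> 0) at_bot"
proof -
  obtain C where C: "\<And>x. \<bar>poly p x * exp (- a * x\<^sup>2)\<bar> \<le> C * exp (- (a / 2) * x\<^sup>2)" "C \<ge> 0"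
    using poly_gauss_bound[of "a / 2" a p] assms by auto
  have lim: "((\<lambda>x::real. C * exp (- (a / 2) * x\<^sup>2)) \<longlongrightarrow> 0) at_top" "((\<lambda>x::real. C * exp (- (a / 2) * x\<^sup>2)) \<longlongrightarrow> 0) at_bot"
  proof -
    have "filterlim (\<lambda>x::real. - (a / 2) * x\<^sup>2) at_bot at_top" "filterlim (\<lambda>x::real. - (a / 2) * x\<^sup>2) at_bot at_bot"
      using assms
      by (intro filterlim_tendsto_neg_mult_at_bot[OF tendsto_const] filterlim_pow_at_top
          filterlim_pow_at_bot_even filterlim_ident; simp)+
    then show "((\<lambda>x::real. C * exp (- (a / 2) * x\<^sup>2)) \<longlongrightarrow> 0) at_top" "((\<lambda>x::real. C * exp (- (a / 2) * x\<^sup>2)) \<longlongrightarrow> 0) at_bot"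
      by (auto intro!: tendsto_mult_right_zero filterlim_compose[OF exp_at_bot])
  qed
  have le: "\<forall>x. norm (poly p x * exp (- a * x\<^sup>2)) \<le> C * exp (- (a / 2) * x\<^sup>2)"
    using C(1) by simp
  show "((\<lambda>x. poly p x * exp (- a * x\<^sup>2)) \<longlongrightarrow> 0) at_top" "((\<lambda>x. poly p x * exp (- a * x\<^sup>2)) \<longlongrightarrow> 0) at_bot"
    by (rule Lim_null_comparison[OF always_eventually[OF le]], rule lim)+
qed

text \<open>Fundamental theorem of calculus with zero limits at infinity. The first conclusion
  drives the integrations by parts against Gaussian weights; the second is the one-dimensional
  Sobolev inequality behind \<open>herm_sum_bound\<close>.\<close>

lemma integral_derivative_line:
  fixes F f :: "real \<Rightarrow> real"
  assumes F: "\<And>x. (F has_real_derivative f x) (at x)" and f: "\<And>x. isCont f x"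
    and int: "integrable lborel f" and top: "(F \<longlongrightarrow> 0) at_top" and bot: "(F \<longlongrightarrow> 0) at_bot"
  shows "(LINT x|lborel. f x) = 0" and "\<bar>F x\<bar> \<le> (LINT x|lborel. \<bar>f x\<bar>)"
proof -
  have si: "set_integrable lborel A f" if "A \<in> sets borel" for A
    unfolding set_integrable_def by (rule integrable_mult_indicator) (use that int in auto)
  have "(LBINT x=-\<infinity>..\<infinity>. f x) = 0 - 0"
  proof (rule interval_integral_FTC_integrable)
    show "((F \<circ> real_of_ereal) \<longlongrightarrow> 0) (at_right (- \<infinity>))"
      using bot by (simp add: ereal_tendsto_simps)
    show "((F \<circ> real_of_ereal) \<longlongrightarrow> 0) (at_left \<infinity>)"
      using top by (simp add: ereal_tendsto_simps)
  qed (use F f si in \<open>auto simp: has_real_derivative_iff_has_vector_derivative\<close>)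
  then show "(LINT x|lborel. f x) = 0"
    by (simp add: interval_lebesgue_integral_def set_lebesgue_integral_def)
  have "(LBINT x=-\<infinity>..ereal x. f x) = F x - 0"
  proof (rule interval_integral_FTC_integrable)
    show "((F \<circ> real_of_ereal) \<longlongrightarrow> 0) (at_right (- \<infinity>))"
      using bot by (simp add: ereal_tendsto_simps)
    have "isCont F x" using F DERIV_isCont by blast
    then show "((F \<circ> real_of_ereal) \<longlongrightarrow> F x) (at_left (ereal x))"
      by (simp add: ereal_tendsto_simps isCont_def filterlim_at_split)
  qed (use F f si in \<open>auto simp: has_real_derivative_iff_has_vector_derivative\<close>)
  then have "F x = (LINT y|lborel. indicator (einterval (- \<infinity>) (ereal x)) y * f y)"
    by (simp add: interval_lebesgue_integral_def set_lebesgue_integral_def)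
  also have "\<bar>\<dots>\<bar> \<le> (LINT y|lborel. \<bar>indicator (einterval (- \<infinity>) (ereal x)) y * f y\<bar>)"
    by (rule integral_abs_bound)
  also have "\<dots> \<le> (LINT x|lborel. \<bar>f x\<bar>)"
    using si[of "einterval (- \<infinity>) (ereal x)"] int
    by (intro integral_mono) (auto simp: set_integrable_def indicator_def)
  finally show "\<bar>F x\<bar> \<le> (LINT x|lborel. \<bar>f x\<bar>)" .
qed

section \<open>Hermite functions as polynomials times a Gaussian\<close>

locale oscillator =
  fixes b :: real
  assumes b_pos: "b > 0"
begin

text \<open>Calculus on Hermite functions is reduced to algebra on the polynomial factor of p(x)
  exp(-b x^2/2): \<open>D\<close> represents d/dx, \<open>L\<close> the oscillator, and
  \<open>I (p * q)\<close> is the L2 product of \<open>pg p\<close> and \<open>pg q\<close>.\<close>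

definition pg :: "real poly \<Rightarrow> real \<Rightarrow> real" where
  "pg p x = poly p x * exp (- (b / 2) * x\<^sup>2)"

definition D :: "real poly \<Rightarrow> real poly" where
  "D p = pderiv p - [:0, b:] * p"

definition I :: "real poly \<Rightarrow> real" where
  "I p = (LINT x|lborel. poly p x * exp (- b * x\<^sup>2))"

lemma pg_deriv: "(pg p has_real_derivative pg (D p) x) (at x)"
  unfolding pg_def D_def
  by (auto intro!: derivative_eq_intros simp: algebra_simps)

lemma C_k_pg: "C_k k (pg p)"
  by (rule C_k_family[of "range pg"]) (use pg_deriv in blast)+

lemma isCont_pg: "isCont (pg p) x"
  using pg_deriv DERIV_isCont by blast

lemma pg_measurable [measurable]: "pg p \<in> borel_measurable borel"
  by (intro borel_measurable_continuous_onI) (simp add: continuous_on_eq_continuous_at isCont_pg)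

lemma pg_bound:
  obtains C where "\<And>x. \<bar>pg p x\<bar> \<le> C * exp (- (b / 4) * x\<^sup>2)" "C \<ge> 0"
  unfolding pg_def using poly_gauss_bound[of "b / 4" "b / 2" p] b_pos by auto

lemma pg_simps:
  "pg (p + q) x = pg p x + pg q x" "pg (p - q) x = pg p x - pg q x" "pg (- p) x = - pg p x"
  "pg (smult c p) x = c * pg p x" "pg (p * q) x = poly p x * pg q x" "pg 0 x = 0"
  by (simp_all add: pg_def algebra_simps)

lemma pg_mult_pg: "pg p x * pg q x = poly (p * q) x * exp (- b * x\<^sup>2)"
  by (simp add: pg_def algebra_simps flip: exp_add)

lemma integrable_pg_mult: "integrable lborel (\<lambda>x. pg p x * pg q x)"
  unfolding pg_mult_pg by (rule integrable_poly_gauss[OF b_pos])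

lemma integral_pg_mult: "(LINT x|lborel. pg p x * pg q x) = I (p * q)"
  unfolding pg_mult_pg I_def ..

lemma I_add: "I (p + q) = I p + I q" and I_diff: "I (p - q) = I p - I q"
  and I_smult: "I (smult c p) = c * I p" and I_0: "I 0 = 0"
  using integrable_poly_gauss[OF b_pos]
  by (simp_all add: I_def distrib_right left_diff_distrib mult.assoc)

lemma I_sum: "I (\<Sum>k\<in>A. f k) = (\<Sum>k\<in>A. I (f k))"
  by (induction A rule: infinite_finite_induct) (simp_all add: I_add I_0)

lemma poly_gauss_deriv:
  "((\<lambda>x. poly p x * exp (- b * x\<^sup>2)) has_real_derivative
     poly (pderiv p - [:0, 2 * b:] * p) x * exp (- b * x\<^sup>2)) (at x)"
  by (auto intro!: derivative_eq_intros simp: algebra_simps)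

lemma I_deriv: "I (pderiv p - [:0, 2 * b:] * p) = 0"
  unfolding I_def
proof (rule integral_derivative_line(1)[OF poly_gauss_deriv])
  show "((\<lambda>x. poly p x * exp (- b * x\<^sup>2)) \<longlongrightarrow> 0) at_top" "((\<lambda>x. poly p x * exp (- b * x\<^sup>2)) \<longlongrightarrow> 0) at_bot"
    by (rule poly_gauss_tendsto_0[OF b_pos])+
qed (intro continuous_intros integrable_poly_gauss b_pos)+

text \<open>The sum \<open>D p * q + p * D q\<close> is the polynomial factor of the derivative of p
  q exp(-b x^2), whose integral vanishes.\<close>

lemma I_by_parts: "I (D p * q) = - I (p * D q)"
proof -
  have "D p * q + p * D q = pderiv (p * q) - [:0, 2 * b:] * (p * q)"
    by (simp add: D_def pderiv_mult algebra_simps flip: smult_add_left)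
  then show ?thesis using I_deriv[of "p * q"] I_add[of "D p * q" "p * D q"] by simp
qed

lemma I_square_pos: "p \<noteq> 0 \<Longrightarrow> I (p * p) > 0"
proof -
  assume p: "p \<noteq> 0"
  have nn: "AE x in lborel. 0 \<le> poly (p * p) x * exp (- b * x\<^sup>2)" by simp
  have "I (p * p) \<noteq> 0"
  proof
    assume "I (p * p) = 0"
    then have "AE x in lborel. poly (p * p) x * exp (- b * x\<^sup>2) = 0"
      using integral_nonneg_eq_0_iff_AE[OF integrable_poly_gauss[OF b_pos] nn] by (simp add: I_def)
    then have "AE x in lborel. x \<in> {x. poly p x = 0}" by eventually_elim simp
    moreover have "AE x in lborel. x \<notin> {x. poly p x = 0}"
      by (intro AE_not_in finite_imp_null_set_lborel poly_roots_finite p)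
    ultimately have "AE x in (lborel :: real measure). False" by eventually_elim simp
    then show False by (simp add: eventually_False ae_filter_eq_bot_iff)
  qed
  moreover have "I (p * p) \<ge> 0" unfolding I_def by (rule integral_nonneg_AE[OF nn])
  ultimately show ?thesis by simp
qed

lemma I_square_nonneg: "I (p * p) \<ge> 0"
  using I_square_pos[of p] by (cases "p = 0") (simp_all add: I_0)

text \<open>Rodrigues recursion: \<open>hp (Suc j)\<close> times exp(-b x^2) is minus the derivative
  of \<open>hp j\<close> times exp(-b x^2). For b = 1 these are the physicists' Hermite
  polynomials.\<close>

primrec hp :: "nat \<Rightarrow> real poly" where
  "hp 0 = 1"
| "hp (Suc j) = [:0, 2 * b:] * hp j - pderiv (hp j)"

text \<open>The lowering relation. Differentiating the recursion and inserting the induction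
  hypothesis reproduces the recursion one index lower, plus one more copy of 2b. It serves for
  Hermite's equation in \<open>L_hp\<close> and for the monomials in
  \<open>hermite_total\<close>.\<close>

lemma pderiv_hp: "pderiv (hp (Suc j)) = smult (2 * b * real (Suc j)) (hp j)"
proof (induction j)
  case 0
  show ?case by (simp add: pderiv_mult pderiv_pCons)
next
  case (Suc j)
  have "pderiv (hp (Suc (Suc j))) = smult (2 * b) (hp (Suc j)) + [:0, 2 * b:] * pderiv (hp (Suc j)) - pderiv (pderiv (hp (Suc j)))"
    by (intro poly_eq_poly_eq_iff[THEN iffD1] ext)
       (simp add: pderiv_diff pderiv_add pderiv_mult pderiv_smult pderiv_pCons algebra_simps)
  also have "\<dots> = smult (2 * b) (hp (Suc j)) + smult (2 * b * real (Suc j)) ([:0, 2 * b:] * hp j - pderiv (hp j))"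
    unfolding Suc pderiv_smult by (simp add: smult_diff_right)
  also have "\<dots> = smult (2 * b * real (Suc (Suc j))) (hp (Suc j))"
    by (intro poly_eq_poly_eq_iff[THEN iffD1] ext) (simp add: algebra_simps)
  finally show ?case .
qed

definition energy :: "nat \<Rightarrow> real" where "energy j = b * (real j + 1 / 2)"

lemma energy_ge: "energy j \<ge> b / 2"
  using b_pos by (simp add: energy_def)

lemma energy_pos: "energy j > 0"
  using energy_ge[of j] b_pos by simp

lemma energy_inj: "energy j = energy k \<longleftrightarrow> j = k"
  using b_pos by (simp add: energy_def)

definition L :: "real poly \<Rightarrow> real poly" where
  "L p = smult (- 1 / 2) (D (D p)) + smult (1 / 2) ([:0, 0, b\<^sup>2:] * p)"

lemma L_hp: "L (hp j) = smult (energy j) (hp j)"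
proof -
  \<comment> \<open>Conjugation by the Gaussian removes the quadratic potential and leaves the
    ground state energy b/2 and a first-order term; Hermite's equation gives b j for the
    rest.\<close>
  have L: "L p = smult (b / 2) p + smult (1 / 2) ([:0, 2 * b:] * pderiv p - pderiv (pderiv p))" for p
    by (intro poly_eq_poly_eq_iff[THEN iffD1] ext)
       (simp add: L_def D_def pderiv_diff pderiv_add pderiv_mult pderiv_smult pderiv_pCons algebra_simps power2_eq_square)
  have "[:0, 2 * b:] * pderiv (hp j) - pderiv (pderiv (hp j)) = smult (2 * b * real j) (hp j)"
  proof (cases j)
    case (Suc i)
    have "[:0, 2 * b:] * pderiv (hp j) - pderiv (pderiv (hp j))
        = smult (2 * b * real j) ([:0, 2 * b:] * hp i - pderiv (hp i))"
      unfolding Suc pderiv_hp pderiv_smult by (simp add: smult_diff_right)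
    then show ?thesis by (simp add: Suc)
  qed simp
  then show ?thesis
    unfolding L energy_def by (intro poly_eq_poly_eq_iff[THEN iffD1] ext) (simp add: algebra_simps)
qed

lemma I_L: "I (L p * q) = I (p * L q)"
proof -
  have "I (D (D p) * q) = I (p * D (D q))"
    using I_by_parts[of "D p" q] I_by_parts[of p "D q"] by simp
  moreover have "L p * q = smult (- 1 / 2) (D (D p) * q) + smult (1 / 2) ([:0, 0, b\<^sup>2:] * (p * q))"
    by (simp add: L_def algebra_simps)
  moreover have "p * L q = smult (- 1 / 2) (p * D (D q)) + smult (1 / 2) ([:0, 0, b\<^sup>2:] * (p * q))"
    by (simp add: L_def algebra_simps)
  ultimately show ?thesis by (simp only: I_add I_smult)
qed

text \<open>By symmetry of \<open>L\<close> the product is multiplied by two different eigenvalues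
  with the same result.\<close>

lemma I_hp_orth: "j \<noteq> k \<Longrightarrow> I (hp j * hp k) = 0"
  using I_L[of "hp j" "hp k"] energy_inj[of j k] by (simp add: L_hp I_smult)

lemma hp_nonzero: "hp j \<noteq> 0"
proof (induction j)
  case (Suc j)
  show ?case
  proof
    assume "hp (Suc j) = 0"
    then show False using pderiv_hp[of j] Suc b_pos by simp
  qed
qed simp

definition nhp :: "nat \<Rightarrow> real poly" where
  "nhp j = smult (1 / sqrt (I (hp j * hp j))) (hp j)"

definition herm :: "nat \<Rightarrow> real \<Rightarrow> real" where
  "herm j = pg (nhp j)"

lemma I_nhp: "I (nhp j * nhp k) = (if j = k then 1 else 0)"
  using I_square_pos[OF hp_nonzero, of j] I_hp_orth[of j k]
  by (cases "j = k") (simp_all add: nhp_def I_smult flip: real_sqrt_mult)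

lemma herm_orthonormal: "(LINT x|lborel. herm j x * herm k x) = (if j = k then 1 else 0)"
  unfolding herm_def integral_pg_mult by (rule I_nhp)

lemma L_nhp: "L (nhp j) = smult (energy j) (nhp j)"
proof -
  have "L (smult c p) = smult c (L p)" for c p
    by (intro poly_eq_poly_eq_iff[THEN iffD1] ext)
       (simp add: L_def D_def pderiv_diff pderiv_smult pderiv_pCons algebra_simps)
  then show ?thesis by (simp add: nhp_def L_hp mult.commute)
qed

text \<open>The polynomial p with coefficients \<open>herm j x / energy j\<close> is a truncated
  Green's function of H with pole at x: both \<open>pg p x\<close> and the form <p, L p> equal the
  sum S. The one-dimensional Sobolev inequality bounds S^2 = p(x)^2 by ||p'||^2 + ||p||^2 <= (2 +
  2/b) S, and one factor S cancels. Hence the bound is uniform in x and N.\<close>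

lemma herm_sum_bound: "(\<Sum>j<N. (herm j x)\<^sup>2 / energy j) \<le> 2 + 2 / b"
proof -
  define a where "a j = herm j x / energy j" for j
  define p where "p = (\<Sum>j<N. smult (a j) (nhp j))"
  define S where "S = (\<Sum>j<N. (herm j x)\<^sup>2 / energy j)"
  have pg_sum: "pg (\<Sum>j\<in>A. q j) y = (\<Sum>j\<in>A. pg (q j) y)" for q :: "nat \<Rightarrow> real poly" and A y
    by (induction A rule: infinite_finite_induct) (simp_all add: pg_simps)
  have px: "pg p x = S"
    unfolding p_def pg_sum S_def
    by (simp add: pg_simps a_def power2_eq_square flip: herm_def)
  have II: "I ((\<Sum>j<N. smult (c j) (nhp j)) * (\<Sum>j<N. smult (d j) (nhp j))) = (\<Sum>j<N. c j * d j)" for c d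
    by (simp add: sum_product I_sum I_smult I_nhp if_distrib[of "\<lambda>x. _ * x"] mult.commute cong: if_cong)
  have Lsum: "L p = (\<Sum>j<N. smult (energy j * a j) (nhp j))"
  proof -
    have add: "L (q + r) = L q + L r" for q r
      by (intro poly_eq_poly_eq_iff[THEN iffD1] ext)
         (simp add: L_def D_def pderiv_diff pderiv_add pderiv_smult pderiv_pCons algebra_simps)
    have sm: "L (smult c q) = smult c (L q)" for c q
      by (intro poly_eq_poly_eq_iff[THEN iffD1] ext)
         (simp add: L_def D_def pderiv_diff pderiv_smult pderiv_pCons algebra_simps)
    have "L 0 = 0" using sm[of 0 0] by simp
    then have "L (\<Sum>j<M. smult (a j) (nhp j)) = (\<Sum>j<M. smult (energy j * a j) (nhp j))" for M
      by (induction M) (simp_all add: add sm L_nhp mult.commute)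
    then show ?thesis by (simp add: p_def)
  qed
  have Ipp: "I (p * p) = (\<Sum>j<N. a j * a j)" unfolding p_def by (rule II)
  have IpL: "I (p * L p) = S"
  proof -
    have "I (p * L p) = (\<Sum>j<N. a j * (energy j * a j))" unfolding Lsum unfolding p_def by (rule II)
    also have "\<dots> = S" unfolding S_def
      by (rule sum.cong) (use energy_pos in \<open>auto simp: a_def power2_eq_square less_imp_neq[THEN not_sym]\<close>)
    finally show ?thesis .
  qed
  \<comment> \<open>The potential part of <p, L p> is nonnegative, so twice the form dominates the
    kinetic term.\<close>
  have "I (D p * D p) = - I (p * D (D p))" by (rule I_by_parts)
  also have "\<dots> \<le> 2 * I (p * L p)"
  proof -
    have "0 \<le> I (([:0, b:] * p) * ([:0, b:] * p))"
      by (rule I_square_nonneg)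
    also have "([:0, b:] * p) * ([:0, b:] * p) = p * ([:0, 0, b\<^sup>2:] * p)"
      by (intro poly_eq_poly_eq_iff[THEN iffD1] ext) (simp add: algebra_simps power2_eq_square)
    also have "p * ([:0, 0, b\<^sup>2:] * p) = smult 2 (p * L p) + p * D (D p)"
      by (intro poly_eq_poly_eq_iff[THEN iffD1] ext) (simp add: L_def algebra_simps)
    finally show ?thesis by (simp add: I_add I_smult)
  qed
  finally have DD: "I (D p * D p) \<le> 2 * S" unfolding IpL .
  \<comment> \<open>The factor 2/b comes from the lower bound b/2 of the energies.\<close>
  have pp: "I (p * p) \<le> 2 / b * S"
    unfolding Ipp S_def sum_distrib_left
  proof (rule sum_mono)
    fix j
    have "1 \<le> 2 / b * energy j" using energy_ge[of j] b_pos by (simp add: field_simps)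
    then have "a j * a j * 1 \<le> a j * a j * (2 / b * energy j)" by (intro mult_left_mono) auto
    also have "\<dots> = 2 / b * ((herm j x)\<^sup>2 / energy j)"
      using energy_pos[of j] by (simp add: a_def power2_eq_square mult_ac)
    finally show "a j * a j \<le> 2 / b * ((herm j x)\<^sup>2 / energy j)" by simp
  qed
  have "\<bar>pg p x * pg p x\<bar> \<le> (LINT y|lborel. \<bar>pg (D p) y * pg p y + pg (D p) y * pg p y\<bar>)"
  proof (rule integral_derivative_line(2)[where F = "\<lambda>y. pg p y * pg p y"])
    show "((\<lambda>y. pg p y * pg p y) has_real_derivative pg (D p) y * pg p y + pg (D p) y * pg p y) (at y)" for y
      using DERIV_mult[OF pg_deriv pg_deriv, of p p y] by simp
    show "((\<lambda>y. pg p y * pg p y) \<longlongrightarrow> 0) at_top" "((\<lambda>y. pg p y * pg p y) \<longlongrightarrow> 0) at_bot"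
      unfolding pg_mult_pg by (rule poly_gauss_tendsto_0[OF b_pos])+
  qed (intro continuous_intros isCont_pg Bochner_Integration.integrable_add integrable_pg_mult)+
  also have "\<dots> \<le> (LINT y|lborel. pg (D p) y * pg (D p) y + pg p y * pg p y)"
  proof (rule integral_mono)
    show "\<bar>pg (D p) y * pg p y + pg (D p) y * pg p y\<bar> \<le> pg (D p) y * pg (D p) y + pg p y * pg p y" for y
      using sum_squares_bound[of "pg (D p) y" "pg p y"] sum_squares_bound[of "- pg (D p) y" "pg p y"]
      by (simp add: power2_eq_square abs_le_iff mult_ac)
  qed (intro integrable_abs Bochner_Integration.integrable_add integrable_pg_mult)+
  also have "\<dots> = I (D p * D p) + I (p * p)"
    by (simp add: integrable_pg_mult integral_pg_mult)
  finally have "\<bar>S * S\<bar> \<le> I (D p * D p) + I (p * p)" unfolding px .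
  then have SS: "S * S \<le> (2 + 2 / b) * S" using DD pp unfolding distrib_right by linarith
  have "S \<ge> 0" unfolding S_def by (intro sum_nonneg) (simp add: energy_pos less_imp_le)
  then consider "S = 0" | "S > 0" by linarith
  then show ?thesis unfolding S_def[symmetric]
  proof cases
    case 1
    then show "S \<le> 2 + 2 / b" using b_pos by simp
  next
    case 2
    then show "S \<le> 2 + 2 / b" using mult_right_le_imp_le[OF SS] by simp
  qed
qed

end

section \<open>Totality of the Hermite functions\<close>

lemma norm_exp_partial_sum_le:
  fixes z :: complex
  shows "norm (\<Sum>m<N. z ^ m /\<^sub>R fact m) \<le> exp (norm z)"
proof -
  have "norm (\<Sum>m<N. z ^ m /\<^sub>R fact m) \<le> (\<Sum>m<N. norm z ^ m /\<^sub>R fact m)"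
    by (rule sum_norm_le) (simp add: norm_power divide_inverse mult.commute)
  also have "\<dots> \<le> exp (norm z)"
    unfolding exp_def by (rule sum_le_suminf) (use summable_exp[of "norm z"] in \<open>auto simp: mult.commute\<close>)
  finally show ?thesis .
qed

text \<open>Integrability against every exponential provides the majorant exp(|t||x|)|w(x)| for the
  partial sums of the Taylor series of exp(itx), so the series may be integrated term by term, and
  each term is a multiple of a moment.\<close>

lemma moment_fourier_zero:
  fixes w :: "real \<Rightarrow> real"
  assumes [measurable]: "w \<in> borel_measurable borel"
    and ex: "\<And>c. integrable lborel (\<lambda>x. exp (c * \<bar>x\<bar>) * w x)"
    and mom: "\<And>m. (LINT x|lborel. x ^ m * w x) = 0"
  shows "(LINT x|lborel. iexp (t * x) * complex_of_real (w x)) = 0"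
proof -
  let ?s = "\<lambda>N x. (\<Sum>m<N. (\<i> * of_real (t * x)) ^ m /\<^sub>R fact m) * complex_of_real (w x)"
  have int: "integrable lborel (\<lambda>x. x ^ m * w x)" for m
  proof -
    obtain C where C: "C \<ge> 0" "\<And>x::real. \<bar>x ^ m\<bar> \<le> C * exp (1 * \<bar>x\<bar>)"
      using poly_exp_abs_bound[of 1 "monom 1 m"] by (auto simp: poly_monom)
    have "norm (x ^ m * w x) \<le> norm (C * (exp (1 * \<bar>x\<bar>) * w x))" for x
      using mult_right_mono[OF C(2)[of x], of "\<bar>w x\<bar>"] C(1) by (simp add: abs_mult mult.assoc)
    then show ?thesis
      by (intro Bochner_Integration.integrable_bound[OF integrable_mult_right[OF ex[of 1]]] AE_I2) auto
  qed
  have "(\<lambda>N. LINT x|lborel. ?s N x) \<longlonglongrightarrow> (LINT x|lborel. iexp (t * x) * complex_of_real (w x))"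
  proof (rule integral_dominated_convergence)
    show "integrable lborel (\<lambda>x. norm (exp (\<bar>t\<bar> * \<bar>x\<bar>) * w x))" by (intro integrable_norm ex)
    show "AE x in lborel. (\<lambda>N. ?s N x) \<longlonglongrightarrow> iexp (t * x) * complex_of_real (w x)"
    proof (intro AE_I2 tendsto_mult tendsto_const)
      show "(\<lambda>N. \<Sum>m<N. (\<i> * of_real (t * x)) ^ m /\<^sub>R fact m) \<longlonglongrightarrow> iexp (t * x)" for x
        using exp_converges[of "\<i> * of_real (t * x)"] by (simp add: sums_def)
    qed
    show "AE x in lborel. norm (?s N x) \<le> norm (exp (\<bar>t\<bar> * \<bar>x\<bar>) * w x)" for N
    proof (rule AE_I2)
      show "norm (?s N x) \<le> norm (exp (\<bar>t\<bar> * \<bar>x\<bar>) * w x)" for x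
        using mult_right_mono[OF norm_exp_partial_sum_le[of "\<i> * of_real (t * x)" N], of "\<bar>w x\<bar>"]
        by (simp add: norm_mult abs_mult)
    qed
  qed measurable
  moreover have "(LINT x|lborel. ?s N x) = 0" for N
  proof -
    have "?s N x = (\<Sum>m<N. (\<i> * of_real t) ^ m /\<^sub>R fact m * complex_of_real (x ^ m * w x))" for x
      unfolding sum_distrib_right by (intro sum.cong refl) (simp add: power_mult_distrib mult_ac)
    then have "(LINT x|lborel. ?s N x)
        = (\<Sum>m<N. LINT x|lborel. (\<i> * of_real t) ^ m /\<^sub>R fact m * complex_of_real (x ^ m * w x))"
      by (simp only:) (intro Bochner_Integration.integral_sum integrable_mult_right integrable_of_real int)
    also have "\<dots> = (\<Sum>m<N. (\<i> * of_real t) ^ m /\<^sub>R fact m * complex_of_real (LINT x|lborel. x ^ m * w x))"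
      by (simp only: integral_mult_right_zero integral_complex_of_real)
    finally show ?thesis by (simp add: mom)
  qed
  ultimately show ?thesis by (simp add: LIMSEQ_const_iff)
qed

text \<open>The positive and negative part of \<open>w\<close> have the same mass and the same characteristic function.\<close>

lemma moment_determinacy:
  fixes w :: "real \<Rightarrow> real"
  assumes w[measurable]: "w \<in> borel_measurable borel"
    and ex: "\<And>c. integrable lborel (\<lambda>x. exp (c * \<bar>x\<bar>) * w x)"
    and mom: "\<And>m. (LINT x|lborel. x ^ m * w x) = 0"
  shows "AE x in lborel. w x = 0"
proof -
  have int_w: "integrable lborel w" using ex[of 0] by simp
  define p n where "p x = max 0 (w x)" and "n x = max 0 (- w x)" for x
  have [measurable]: "p \<in> borel_measurable borel" "n \<in> borel_measurable borel"
    unfolding p_def n_def by measurable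
  have int: "integrable lborel p" "integrable lborel n"
    unfolding p_def n_def using int_w by auto
  have wpn: "w x = p x - n x" and p0: "p x \<ge> 0" and n0: "n x \<ge> 0" for x
    by (auto simp: p_def n_def)
  define m where "m = (LINT x|lborel. p x)"
  have "(LINT x|lborel. p x - n x) = 0" using mom[of 0] wpn by simp
  then have m_n: "m = (LINT x|lborel. n x)" using int by (simp add: m_def)
  have m0: "m \<ge> 0" unfolding m_def using p0 by simp
  show ?thesis
  proof (cases "m = 0")
    case True
    have "AE x in lborel. p x = 0" "AE x in lborel. n x = 0"
      using integral_nonneg_eq_0_iff_AE[OF int(1)] integral_nonneg_eq_0_iff_AE[OF int(2)] True m_n p0 n0
      by (auto simp: m_def)
    then show ?thesis by eventually_elim (simp add: wpn)
  next
    case False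
    then have m: "m > 0" using m0 by simp
    \<comment> \<open>Division by the common mass \<open>m\<close> turns both parts into probability
      measures, to which the uniqueness theorem for characteristic functions applies; this is why m
      = 0 is treated apart.\<close>
    define M where "M f = density lborel (\<lambda>x. ennreal (f x / m))" for f :: "real \<Rightarrow> real"
    have rd: "real_distribution (M f)"
      if [measurable]: "f \<in> borel_measurable borel" and f: "integrable lborel f" "\<And>x. f x \<ge> 0" "(LINT x|lborel. f x) = m" for f
    proof -
      have "emeasure (M f) (space (M f)) = (\<integral>\<^sup>+ x. ennreal (f x / m) \<partial>lborel)"
        by (simp add: M_def emeasure_density)
      also have "\<dots> = ennreal (LINT x|lborel. f x / m)"
        using f m by (intro nn_integral_eq_integral) auto
      also have "\<dots> = 1" using f m by simp
      finally have "prob_space (M f)" by (rule prob_spaceI)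
      then show ?thesis
        by (intro real_distribution.intro real_distribution_axioms.intro) (simp_all add: M_def)
    qed
    have char: "char (M f) t = (LINT x|lborel. iexp (t * x) * complex_of_real (f x)) / of_real m"
      if [measurable]: "f \<in> borel_measurable borel" and "\<And>x. f x \<ge> 0" for f t
    proof -
      have "char (M f) t = (LINT x|lborel. (f x / m) *\<^sub>R iexp (t * x))"
        unfolding char_def M_def using that m by (intro integral_density) auto
      also have "\<dots> = (LINT x|lborel. iexp (t * x) * complex_of_real (f x) / of_real m)"
        by (simp add: scaleR_conv_of_real mult_ac)
      finally show ?thesis by simp
    qed
    have "char (M p) = char (M n)"
    proof
      fix t
      have i: "integrable lborel (\<lambda>x. iexp (t * x) * complex_of_real (f x))"
        if f[measurable]: "f \<in> borel_measurable borel" and "integrable lborel f" for f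
        by (rule Bochner_Integration.integrable_bound[OF that(2)]) (auto simp: norm_mult)
      have "(LINT x|lborel. iexp (t * x) * complex_of_real (p x)) - (LINT x|lborel. iexp (t * x) * complex_of_real (n x))
          = (LINT x|lborel. iexp (t * x) * complex_of_real (w x))"
        by (subst Bochner_Integration.integral_diff[symmetric])
           (use int in \<open>simp_all add: i wpn right_diff_distrib del: of_real_mult\<close>)
      also have "\<dots> = 0" by (rule moment_fourier_zero[OF w ex mom])
      finally show "char (M p) t = char (M n) t" using p0 n0 by (simp add: char)
    qed
    then have "M p = M n"
      by (intro Levy_uniqueness rd) (use int p0 n0 m_def m_n in auto)
    then have "AE x in lborel. ennreal (p x / m) = ennreal (n x / m)"
      unfolding M_def by (intro sigma_finite_measure.density_unique[OF sigma_finite_lborel]) auto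
    then show ?thesis
      by eventually_elim (use p0 n0 m in \<open>simp add: wpn divide_right_mono\<close>)
  qed
qed

section \<open>Functions integrable against Gaussians\<close>

text \<open>Wide enough for square integrable and bounded functions, and stable under restriction to
  almost every line and under partial integration, while integrals against Hermite and test
  functions still exist. All rates a > 0 occur because the Gaussian decay of a multiplier may be
  arbitrarily slow.\<close>

definition gauss_integrable :: "('a::euclidean_space \<Rightarrow> complex) \<Rightarrow> bool" where
  "gauss_integrable u \<longleftrightarrow> u \<in> borel_measurable borel \<and>
     (\<forall>a>0. integrable lborel (\<lambda>z. exp (- a * (norm z)\<^sup>2) *\<^sub>R u z))"

lemma gauss_integrable_measurable: "gauss_integrable u \<Longrightarrow> u \<in> borel_measurable borel"
  by (simp add: gauss_integrable_def)

lemma gauss_integrable_mult: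
  assumes u: "gauss_integrable u" and [measurable]: "f \<in> borel_measurable borel"
    and le: "\<And>z. \<bar>f z\<bar> \<le> C * exp (- a * (norm z)\<^sup>2)" and a: "a > 0"
  shows "integrable lborel (\<lambda>z. f z *\<^sub>R u z)"
proof (rule Bochner_Integration.integrable_bound)
  show "integrable lborel (\<lambda>z. C *\<^sub>R (exp (- a * (norm z)\<^sup>2) *\<^sub>R u z))"
    using u a by (intro integrable_scaleR_right) (simp add: gauss_integrable_def)
  have [measurable]: "u \<in> borel_measurable borel" using u by (rule gauss_integrable_measurable)
  show "(\<lambda>z. f z *\<^sub>R u z) \<in> borel_measurable lborel" by measurable
  show "AE z in lborel. norm (f z *\<^sub>R u z) \<le> norm (C *\<^sub>R exp (- a * (norm z)\<^sup>2) *\<^sub>R u z)"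
  proof (rule AE_I2)
    fix z
    have "\<bar>f z\<bar> \<le> \<bar>C\<bar> * exp (- a * (norm z)\<^sup>2)"
      by (rule order_trans[OF le]) (intro mult_right_mono, auto)
    then show "norm (f z *\<^sub>R u z) \<le> norm (C *\<^sub>R exp (- a * (norm z)\<^sup>2) *\<^sub>R u z)"
      using mult_right_mono[of _ _ "norm (u z)"] by (simp add: mult.assoc)
  qed
qed

lemma gauss_integrable_test:
  assumes "gauss_integrable u" "test_function f"
  shows "integrable lborel (\<lambda>z. f z *\<^sub>R u z)"
proof -
  obtain C where "\<And>z. \<bar>f z\<bar> \<le> C * exp (- 1 * (norm z)\<^sup>2)"
    using test_function_gauss_bound[OF assms(2), of 1] by auto
  then show ?thesis
    using gauss_integrable_mult[OF assms(1) test_function_measurable[OF assms(2)], of C 1] by simp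
qed

lemma gauss_integrable_cmult: "gauss_integrable u \<Longrightarrow> gauss_integrable (\<lambda>z. c * u z)"
  unfolding gauss_integrable_def by (auto simp flip: mult_scaleR_right)

lemma gauss_integrable_diff: "gauss_integrable u \<Longrightarrow> gauss_integrable v \<Longrightarrow> gauss_integrable (\<lambda>z. u z - v z)"
  by (auto simp: gauss_integrable_def scaleR_diff_right)

lemma integrable_gauss_plane:
  assumes "a > 0"
  shows "integrable lborel (\<lambda>z::real \<times> real. exp (- a * (norm z)\<^sup>2))"
proof -
  have eq: "exp (- a * (norm z)\<^sup>2) = (case z of (x, y) \<Rightarrow> exp (- a * x\<^sup>2) * exp (- a * y\<^sup>2))" for z :: "real \<times> real"
    by (cases z) (simp add: norm_Pair algebra_simps flip: exp_add)
  have "integrable (lborel \<Otimes>\<^sub>M lborel) (\<lambda>z::real \<times> real. case z of (x, y) \<Rightarrow> exp (- a * x\<^sup>2) * exp (- a * y\<^sup>2))"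
    by (rule lborel_pair.Fubini_integrable) (use integrable_gauss_real[OF assms] in simp_all)
  then show ?thesis unfolding eq lborel_prod .
qed

lemma gauss_integrable_sq:
  assumes g: "\<And>a. a > 0 \<Longrightarrow> integrable lborel (\<lambda>z::'a::euclidean_space. exp (- a * (norm z)\<^sup>2))"
    and u: "sq_integrable (u :: 'a \<Rightarrow> complex)"
  shows "gauss_integrable u"
  unfolding gauss_integrable_def
proof (intro conjI allI impI)
  show [measurable]: "u \<in> borel_measurable borel" using u by (simp add: sq_integrable_def)
  fix a :: real assume "a > 0"
  show "integrable lborel (\<lambda>z. exp (- a * (norm z)\<^sup>2) *\<^sub>R u z)"
  proof (rule Bochner_Integration.integrable_bound)
    show "integrable lborel (\<lambda>z. exp (- (2 * a) * (norm z)\<^sup>2) + (norm (u z))\<^sup>2)"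
      using u \<open>a > 0\<close> by (intro Bochner_Integration.integrable_add g) (auto simp: sq_integrable_def)
    show "AE z in lborel. norm (exp (- a * (norm z)\<^sup>2) *\<^sub>R u z) \<le> norm (exp (- (2 * a) * (norm z)\<^sup>2) + (norm (u z))\<^sup>2)"
    proof (rule AE_I2)
      fix z
      have "2 * exp (- a * (norm z)\<^sup>2) * norm (u z) \<le> (exp (- a * (norm z)\<^sup>2))\<^sup>2 + (norm (u z))\<^sup>2"
        by (rule sum_squares_bound)
      also have "(exp (- a * (norm z)\<^sup>2))\<^sup>2 = exp (- (2 * a) * (norm z)\<^sup>2)"
        by (simp add: power2_eq_square flip: exp_add)
      finally have "exp (- a * (norm z)\<^sup>2) * norm (u z) \<le> exp (- (2 * a) * (norm z)\<^sup>2) + (norm (u z))\<^sup>2"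
        using mult_nonneg_nonneg[OF exp_ge_zero norm_ge_zero, of "- a * (norm z)\<^sup>2" "u z"] by linarith
      then show "norm (exp (- a * (norm z)\<^sup>2) *\<^sub>R u z) \<le> norm (exp (- (2 * a) * (norm z)\<^sup>2) + (norm (u z))\<^sup>2)"
        by simp
    qed
  qed measurable
qed

lemma gauss_integrable_bounded:
  assumes g: "\<And>a. a > 0 \<Longrightarrow> integrable lborel (\<lambda>z::'a::euclidean_space. exp (- a * (norm z)\<^sup>2))"
    and [measurable]: "(u :: 'a \<Rightarrow> complex) \<in> borel_measurable borel" and le: "AE z in lborel. norm (u z) \<le> B"
  shows "gauss_integrable u"
  unfolding gauss_integrable_def
proof (intro conjI allI impI)
  fix a :: real assume "a > 0"
  show "integrable lborel (\<lambda>z. exp (- a * (norm z)\<^sup>2) *\<^sub>R u z)"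
    by (rule Bochner_Integration.integrable_bound[OF integrable_mult_right[OF g[OF \<open>a > 0\<close>], of B]])
       (use le in \<open>auto elim!: eventually_mono simp: abs_mult mult.commute intro: mult_left_mono order_trans[OF _ abs_ge_self]\<close>)
qed measurable

lemma integrable_gauss_line: "a > 0 \<Longrightarrow> integrable lborel (\<lambda>x::real. exp (- a * (norm x)\<^sup>2))"
  using integrable_gauss_real[of a] by simp

lemmas gauss_integrable_sq_line = gauss_integrable_sq[OF integrable_gauss_line]
lemmas gauss_integrable_sq_plane = gauss_integrable_sq[OF integrable_gauss_plane]
lemmas gauss_integrable_bounded_plane = gauss_integrable_bounded[OF integrable_gauss_plane]

section \<open>Totality on the line and passage from test functions to Hermite functions\<close>

context oscillator
begin

lemma pg_bound_ex: "\<exists>C\<ge>0. \<forall>x. \<bar>pg p x\<bar> \<le> C * exp (- (b / 4) * x\<^sup>2)"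
  by (rule pg_bound[of p]) auto

lemma integrable_pg_gauss: "gauss_integrable u \<Longrightarrow> integrable lborel (\<lambda>x. pg p x *\<^sub>R u x)"
proof -
  assume u: "gauss_integrable u"
  obtain C where "\<And>x. \<bar>pg p x\<bar> \<le> C * exp (- (b / 4) * x\<^sup>2)" "C \<ge> 0" using pg_bound_ex[of p] by blast
  then show ?thesis
    using b_pos by (intro gauss_integrable_mult[OF u, of _ C "b / 4"]) auto
qed

text \<open>By the recursion x \<open>hp j\<close> is 1/(2b) times the sum of
  \<open>hp (Suc j)\<close> and the derivative of \<open>hp j\<close>, which is a multiple of the
  previous polynomial; so vanishing against all Hermite functions spreads to all monomials times the
  Gaussian. Since u exp(-b x^2/2) is integrable against every exponential,
  \<open>moment_determinacy\<close> applies to its real and imaginary parts.\<close>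

lemma hermite_total:
  assumes u: "gauss_integrable u" and zero: "\<And>j. (LINT x|lborel. herm j x *\<^sub>R u x) = 0"
  shows "AE x in lborel. u x = 0"
proof -
  define J where "J p = (LINT x|lborel. pg p x *\<^sub>R u x)" for p
  have J_add: "J (p + q) = J p + J q" for p q
    by (simp add: J_def pg_simps scaleR_add_left integrable_pg_gauss[OF u])
  have J_smult: "J (smult c p) = c *\<^sub>R J p" for c p
    by (simp add: J_def pg_simps flip: scaleR_scaleR)
  have J0: "J (hp j) = 0" for j
  proof -
    have "J (nhp j) = 0" using zero[of j] by (simp add: J_def herm_def)
    then show ?thesis
      using I_square_pos[OF hp_nonzero[of j]] by (simp add: nhp_def J_smult)
  qed
  have J_mon: "J (monom 1 m * hp j) = 0" for m j
  proof (induction m arbitrary: j)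
    case 0
    show ?case using J0 by simp
  next
    case (Suc m)
    have "monom 1 (Suc m) * hp j = smult (1 / (2 * b)) (monom 1 m * hp (Suc j) + monom 1 m * pderiv (hp j))"
      using b_pos by (intro poly_eq_poly_eq_iff[THEN iffD1] ext) (simp add: poly_monom algebra_simps)
    moreover have "J (monom 1 m * pderiv (hp j)) = 0"
      using Suc J_smult[of 0 0] by (cases j) (simp_all add: pderiv_hp J_smult del: hp.simps(2))
    ultimately show ?case using Suc[of "Suc j"] by (simp add: J_smult J_add del: hp.simps(2))
  qed
  have J_mon0: "J (monom 1 m) = 0" for m using J_mon[of m 0] by simp
  have [measurable]: "u \<in> borel_measurable borel" using u by (rule gauss_integrable_measurable)
  define w where "w g x = exp (- (b / 2) * x\<^sup>2) * g (u x)" for g :: "complex \<Rightarrow> real" and x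
  have "AE x in lborel. w g x = 0" if g: "g = Re \<or> g = Im" for g
  proof (rule moment_determinacy)
    have bl: "bounded_linear g" using g bounded_linear_Re bounded_linear_Im by auto
    have gs: "g (r *\<^sub>R z) = r * g z" for r z using g by auto
    have [measurable]: "g \<in> borel_measurable borel" using g by auto
    show "w g \<in> borel_measurable borel" unfolding w_def by measurable
    have w_pg: "x ^ m * w g x = g (pg (monom 1 m) x *\<^sub>R u x)" for m x
      by (simp add: w_def gs pg_def poly_monom)
    show "(LINT x|lborel. x ^ m * w g x) = 0" for m
      unfolding w_pg using integral_bounded_linear[OF bl integrable_pg_gauss[OF u], of "monom 1 m"] J_mon0[of m] g
      by (auto simp: J_def)
    show "integrable lborel (\<lambda>x. exp (c * \<bar>x\<bar>) * w g x)" for c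
    proof -
      have "integrable lborel (\<lambda>x. g ((exp (c * \<bar>x\<bar>) * exp (- (b / 2) * x\<^sup>2)) *\<^sub>R u x))"
      proof (intro integrable_bounded_linear[OF bl] gauss_integrable_mult[OF u])
        fix x :: real
        \<comment> \<open>Completing the square: half of the Gaussian rate b/2 pays for exp(c|x|),
          the other half b/4 remains as the majorant.\<close>
        have "0 \<le> (b / 2 * \<bar>x\<bar> - c)\<^sup>2 / b" using b_pos by simp
        also have "\<dots> = (b / 4) * x\<^sup>2 - c * \<bar>x\<bar> + c\<^sup>2 / b"
          using b_pos by (simp add: power2_eq_square field_simps)
        finally have "c * \<bar>x\<bar> + - (b / 2) * x\<^sup>2 \<le> c\<^sup>2 / b + - (b / 4) * x\<^sup>2" by simp
        then have "exp (c * \<bar>x\<bar> + - (b / 2) * x\<^sup>2) \<le> exp (c\<^sup>2 / b + - (b / 4) * x\<^sup>2)" by simp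
        then show "\<bar>exp (c * \<bar>x\<bar>) * exp (- (b / 2) * x\<^sup>2)\<bar> \<le> exp (c\<^sup>2 / b) * exp (- (b / 4) * (norm x)\<^sup>2)"
          unfolding exp_add by (simp add: abs_mult)
      qed (use b_pos in auto)
      then show ?thesis by (simp add: gs w_def mult.assoc)
    qed
  qed
  then have "AE x in lborel. w Re x = 0" "AE x in lborel. w Im x = 0" by auto
  then show ?thesis by eventually_elim (simp add: w_def complex_eq_iff)
qed

text \<open>The cut-off is a bump stretched by 1/\<open>\<epsilon> n\<close>: each derivative that
  falls on it brings a factor \<open>\<epsilon> n\<close> tending to 0, so second derivatives
  converge pointwise too. All majorants are Gaussians of the fixed rate b/4, uniform in n, ready for
  dominated convergence.\<close>

lemma cutoff:
  "\<exists>F :: nat \<Rightarrow> real \<Rightarrow> real. (\<forall>n. test_function (F n)) \<and>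
    (\<forall>x. (\<lambda>n. F n x) \<longlonglongrightarrow> pg p x) \<and> (\<forall>x. (\<lambda>n. deriv (deriv (F n)) x) \<longlonglongrightarrow> pg (D (D p)) x) \<and>
    (\<forall>q. \<exists>C. \<forall>n x. \<bar>poly q x * F n x\<bar> \<le> C * exp (- (b / 4) * x\<^sup>2)) \<and>
    (\<exists>C. \<forall>n x. \<bar>deriv (deriv (F n)) x\<bar> \<le> C * exp (- (b / 4) * x\<^sup>2))"
proof -
  obtain \<eta> :: "real \<Rightarrow> real" where \<eta>: "test_function \<eta>" "\<eta> 0 = 1" by (rule test_function_bump)
  note \<eta>' = test_function_deriv(1)[OF \<eta>(1)]
  note \<eta>'' = test_function_deriv(1)[OF \<eta>']
  obtain K where K: "\<And>x. \<bar>\<eta> x\<bar> \<le> K" using test_function_bounded[OF \<eta>(1)] by metis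
  obtain K' where K': "\<And>x. \<bar>deriv \<eta> x\<bar> \<le> K'" using test_function_bounded[OF \<eta>'] by metis
  obtain K'' where K'': "\<And>x. \<bar>deriv (deriv \<eta>) x\<bar> \<le> K''" using test_function_bounded[OF \<eta>''] by metis
  have Ks: "K \<ge> 0" "K' \<ge> 0" "K'' \<ge> 0" using K[of 0] K'[of 0] K''[of 0] by linarith+
  define \<epsilon> where "\<epsilon> n = inverse (real (Suc n))" for n
  have \<epsilon>: "\<epsilon> n > 0" "\<epsilon> n \<le> 1" for n by (auto simp: \<epsilon>_def field_simps)
  have \<epsilon>_lim: "\<epsilon> \<longlonglongrightarrow> 0" unfolding \<epsilon>_def by (rule LIMSEQ_inverse_real_of_nat)
  define F where "F n x = pg p x * \<eta> (\<epsilon> n * x)" for n x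
  have comp: "((\<lambda>x. g (\<epsilon> n * x)) has_real_derivative \<epsilon> n * deriv g (\<epsilon> n * x)) (at x)"
    if "test_function g" for g n x
    using DERIV_chain2[where g = "\<lambda>x. \<epsilon> n * x", OF test_function_deriv(2)[OF that] DERIV_cmult_Id]
    by (simp add: mult.commute)
  have F': "deriv (F n) = (\<lambda>x. pg (D p) x * \<eta> (\<epsilon> n * x) + \<epsilon> n * (pg p x * deriv \<eta> (\<epsilon> n * x)))" for n
    unfolding F_def
    by (intro ext DERIV_imp_deriv DERIV_cong[OF DERIV_mult[OF pg_deriv comp[OF \<eta>(1)]]]) (simp add: mult_ac)
  have F'': "deriv (deriv (F n)) = (\<lambda>x. pg (D (D p)) x * \<eta> (\<epsilon> n * x) + 2 * \<epsilon> n * (pg (D p) x * deriv \<eta> (\<epsilon> n * x))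
      + (\<epsilon> n)\<^sup>2 * (pg p x * deriv (deriv \<eta>) (\<epsilon> n * x)))" for n
    unfolding F'
    by (intro ext DERIV_imp_deriv DERIV_cong[OF DERIV_add[OF DERIV_mult[OF pg_deriv comp[OF \<eta>(1)]]
          DERIV_cmult[OF DERIV_mult[OF pg_deriv comp[OF \<eta>']]]]]) (simp add: power2_eq_square algebra_simps)
  have lim: "(\<lambda>n. g (\<epsilon> n * x)) \<longlonglongrightarrow> g 0" if "test_function g" for g x
  proof -
    have "isCont g 0" using test_function_continuous[OF that] by (simp add: continuous_on_eq_continuous_at)
    moreover have "(\<lambda>n. \<epsilon> n * x) \<longlonglongrightarrow> 0" using tendsto_mult_right[OF \<epsilon>_lim, of x] by simp
    ultimately show ?thesis by (rule isCont_tendsto_compose)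
  qed
  show ?thesis
  proof (intro exI[of _ F] conjI allI)
    show "test_function (F n)" for n
      unfolding F_def using test_function_affine[OF \<eta>(1), of "\<epsilon> n" 0] \<epsilon>(1)[of n]
      by (intro test_function_mult_smooth C_k_pg) simp
    show "(\<lambda>n. F n x) \<longlonglongrightarrow> pg p x" for x
      unfolding F_def using tendsto_mult[OF tendsto_const lim[OF \<eta>(1)], of "pg p x" x] \<eta>(2) by simp
    have "(\<lambda>n. deriv (deriv (F n)) x) \<longlonglongrightarrow> pg (D (D p)) x * \<eta> 0 + 2 * 0 * (pg (D p) x * deriv \<eta> 0)
        + 0\<^sup>2 * (pg p x * deriv (deriv \<eta>) 0)" for x
      unfolding F'' by (intro tendsto_intros lim \<eta> \<eta>' \<eta>'' \<epsilon>_lim)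
    then show "(\<lambda>n. deriv (deriv (F n)) x) \<longlonglongrightarrow> pg (D (D p)) x" for x using \<eta>(2) by simp
    show "\<exists>C. \<forall>n x. \<bar>poly q x * F n x\<bar> \<le> C * exp (- (b / 4) * x\<^sup>2)" for q
    proof -
      obtain C where C: "\<And>x. \<bar>pg (q * p) x\<bar> \<le> C * exp (- (b / 4) * x\<^sup>2)" "C \<ge> 0" using pg_bound_ex[of "q * p"] by blast
      have "\<bar>poly q x * F n x\<bar> \<le> (C * exp (- (b / 4) * x\<^sup>2)) * K" for n x
      proof -
        have "\<bar>poly q x * F n x\<bar> = \<bar>pg (q * p) x\<bar> * \<bar>\<eta> (\<epsilon> n * x)\<bar>" by (simp add: F_def pg_simps abs_mult)
        also have "\<dots> \<le> (C * exp (- (b / 4) * x\<^sup>2)) * K" by (intro mult_mono C K) (use C Ks in auto)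
        finally show ?thesis .
      qed
      then show ?thesis by (intro exI[of _ "C * K"]) (simp add: mult_ac)
    qed
    obtain C0 where C0: "\<And>x. \<bar>pg p x\<bar> \<le> C0 * exp (- (b / 4) * x\<^sup>2)" "C0 \<ge> 0" using pg_bound_ex[of p] by blast
    obtain C1 where C1: "\<And>x. \<bar>pg (D p) x\<bar> \<le> C1 * exp (- (b / 4) * x\<^sup>2)" "C1 \<ge> 0" using pg_bound_ex[of "D p"] by blast
    obtain C2 where C2: "\<And>x. \<bar>pg (D (D p)) x\<bar> \<le> C2 * exp (- (b / 4) * x\<^sup>2)" "C2 \<ge> 0" using pg_bound_ex[of "D (D p)"] by blast
    have "\<bar>deriv (deriv (F n)) x\<bar> \<le> (C2 * K + 2 * (C1 * K') + C0 * K'') * exp (- (b / 4) * x\<^sup>2)" for n x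
    proof -
      let ?e = "exp (- (b / 4) * x\<^sup>2)"
      have 1: "\<bar>pg (D (D p)) x * \<eta> (\<epsilon> n * x)\<bar> \<le> (C2 * ?e) * K"
        unfolding abs_mult by (intro mult_mono C2 K) (use C2 in auto)
      have 2: "\<bar>pg (D p) x * deriv \<eta> (\<epsilon> n * x)\<bar> \<le> (C1 * ?e) * K'"
        unfolding abs_mult by (intro mult_mono C1 K') (use C1 in auto)
      have 3: "\<bar>pg p x * deriv (deriv \<eta>) (\<epsilon> n * x)\<bar> \<le> (C0 * ?e) * K''"
        unfolding abs_mult by (intro mult_mono C0 K'') (use C0 in auto)
      have le1: "\<bar>e * r\<bar> \<le> B" if "\<bar>r\<bar> \<le> B" "0 \<le> e" "e \<le> 1" for e r B :: real
        using that mult_mono[of e 1 "\<bar>r\<bar>" B] by (simp add: abs_mult)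
      have "\<bar>\<epsilon> n * (pg (D p) x * deriv \<eta> (\<epsilon> n * x))\<bar> \<le> (C1 * ?e) * K'"
        by (rule le1[OF 2]) (use \<epsilon>[of n] in auto)
      moreover have "\<bar>(\<epsilon> n)\<^sup>2 * (pg p x * deriv (deriv \<eta>) (\<epsilon> n * x))\<bar> \<le> (C0 * ?e) * K''"
        by (rule le1[OF 3]) (use \<epsilon>[of n] in \<open>auto simp: power_le_one\<close>)
      ultimately show ?thesis unfolding F'' using 1 by (simp add: algebra_simps abs_le_iff)
    qed
    then show "\<exists>C. \<forall>n x. \<bar>deriv (deriv (F n)) x\<bar> \<le> C * exp (- (b / 4) * x\<^sup>2)" by blast
  qed
qed

text \<open>The coefficients \<open>c\<close> and \<open>q\<close> are general so that one limit
  argument serves two equations: c = 0, q = 1 for the fundamental lemma, and c = -1/2 with the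
  quadratic potential for the oscillator.\<close>

lemma weak_equation_extend:
  assumes u: "gauss_integrable u" and v: "gauss_integrable v"
    and eq: "\<And>f. test_function f \<Longrightarrow>
      (LINT x|lborel. (c * deriv (deriv f) x + poly q x * f x) *\<^sub>R u x) = (LINT x|lborel. f x *\<^sub>R v x)"
  shows "(LINT x|lborel. (c * pg (D (D p)) x + poly q x * pg p x) *\<^sub>R u x) = (LINT x|lborel. pg p x *\<^sub>R v x)"
proof -
  obtain F where F': "\<forall>n. test_function (F n)"
    "\<forall>x. (\<lambda>n. F n x) \<longlonglongrightarrow> pg p x" "\<forall>x. (\<lambda>n. deriv (deriv (F n)) x) \<longlonglongrightarrow> pg (D (D p)) x"
    "\<forall>q. \<exists>C. \<forall>n x. \<bar>poly q x * F n x\<bar> \<le> C * exp (- (b / 4) * x\<^sup>2)"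
    "\<exists>C. \<forall>n x. \<bar>deriv (deriv (F n)) x\<bar> \<le> C * exp (- (b / 4) * x\<^sup>2)"
    by (rule exE[OF cutoff[of p]]) (elim conjE, rule that)
  note F = F'[rule_format] F'(5)
  have [measurable]: "u \<in> borel_measurable borel" "v \<in> borel_measurable borel"
    using u v by (auto intro: gauss_integrable_measurable)
  have [measurable]: "F n \<in> borel_measurable borel" "deriv (deriv (F n)) \<in> borel_measurable borel" for n
    by (intro test_function_measurable test_function_deriv F)+
  have poly_meas[measurable]: "poly q \<in> borel_measurable borel" for q :: "real poly"
    by (intro borel_measurable_continuous_onI continuous_intros)
  have conv: "(\<lambda>n. LINT x|lborel. G n x *\<^sub>R w x) \<longlonglongrightarrow> (LINT x|lborel. g x *\<^sub>R w x)"
    if w: "gauss_integrable w" and [measurable]: "\<And>n. G n \<in> borel_measurable borel" "g \<in> borel_measurable borel"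
      and lim: "\<And>x. (\<lambda>n. G n x) \<longlonglongrightarrow> g x" and bd: "\<exists>C. \<forall>n x. \<bar>G n x\<bar> \<le> C * exp (- (b / 4) * x\<^sup>2)" for w G g
  proof -
    obtain C where C: "\<And>n x. \<bar>G n x\<bar> \<le> C * exp (- (b / 4) * x\<^sup>2)" using bd by blast
    have C0: "C \<ge> 0" using C[of 0 0] by simp
    have [measurable]: "w \<in> borel_measurable borel" using w by (rule gauss_integrable_measurable)
    show ?thesis
    proof (rule integral_dominated_convergence)
      show "integrable lborel (\<lambda>x. norm ((C * exp (- (b / 4) * x\<^sup>2)) *\<^sub>R w x))"
        using b_pos C0 by (intro integrable_norm gauss_integrable_mult[OF w, of _ C "b / 4"]) auto
      show "AE x in lborel. norm (G n x *\<^sub>R w x) \<le> norm ((C * exp (- (b / 4) * x\<^sup>2)) *\<^sub>R w x)" for n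
        using C C0 by (intro AE_I2) (auto intro!: mult_right_mono simp: abs_mult)
    qed (auto intro!: tendsto_scaleR lim)
  qed
  have "(\<lambda>n. LINT x|lborel. (c * deriv (deriv (F n)) x + poly q x * F n x) *\<^sub>R u x) \<longlonglongrightarrow>
      (LINT x|lborel. (c * pg (D (D p)) x + poly q x * pg p x) *\<^sub>R u x)"
  proof (rule conv[OF u])
    obtain C1 where C1: "\<And>n x. \<bar>deriv (deriv (F n)) x\<bar> \<le> C1 * exp (- (b / 4) * x\<^sup>2)" using F(5) by blast
    obtain C2 where C2: "\<And>n x. \<bar>poly q x * F n x\<bar> \<le> C2 * exp (- (b / 4) * x\<^sup>2)" using F(4)[of q] by blast
    have "\<bar>c * deriv (deriv (F n)) x + poly q x * F n x\<bar> \<le> (\<bar>c\<bar> * C1 + C2) * exp (- (b / 4) * x\<^sup>2)" for n x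
    proof -
      have "\<bar>c * deriv (deriv (F n)) x\<bar> \<le> \<bar>c\<bar> * (C1 * exp (- (b / 4) * x\<^sup>2))"
        unfolding abs_mult by (intro mult_left_mono C1) simp
      then show ?thesis
        using C2[of x n] abs_triangle_ineq[of "c * deriv (deriv (F n)) x" "poly q x * F n x"]
        by (simp add: distrib_right mult.assoc)
    qed
    then show "\<exists>C. \<forall>n x. \<bar>c * deriv (deriv (F n)) x + poly q x * F n x\<bar> \<le> C * exp (- (b / 4) * x\<^sup>2)" by blast
  qed (auto intro!: tendsto_intros F)
  moreover have "(\<lambda>n. LINT x|lborel. F n x *\<^sub>R v x) \<longlonglongrightarrow> (LINT x|lborel. pg p x *\<^sub>R v x)"
    by (rule conv[OF v]) (use F(2) F(4)[of 1] in auto)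
  ultimately show ?thesis
    unfolding eq[OF F(1)] by (rule LIMSEQ_unique)
qed

text \<open>Vanishing on test functions extends to Hermite functions, which are total in this class;
  the extension is used with v = 0.\<close>

lemma fundamental_lemma_line:
  fixes u :: "real \<Rightarrow> complex"
  assumes u: "gauss_integrable u" and eq: "\<And>f. test_function f \<Longrightarrow> (LINT x|lborel. f x *\<^sub>R u x) = 0"
  shows "AE x in lborel. u x = 0"
proof (rule hermite_total[OF u])
  have "gauss_integrable (\<lambda>x. 0 * u x)" by (rule gauss_integrable_cmult[OF u])
  then have z: "gauss_integrable (\<lambda>x::real. 0)" by simp
  show "(LINT x|lborel. herm j x *\<^sub>R u x) = 0" for j
    using weak_equation_extend[OF u z, of 0 1 "nhp j"] eq by (simp add: herm_def)
qed

text \<open>The domain of H is described through compactly supported functions only. Here the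
  equation is tested on \<open>herm j\<close>, on which H acts as the number
  \<open>energy j\<close>.\<close>

lemma weak_oscillator_line:
  assumes u: "gauss_integrable u" and v: "gauss_integrable v"
    and eq: "\<And>f. test_function f \<Longrightarrow>
      (LINT x|lborel. (- (1/2) * deriv (deriv f) x + (1/2) * b\<^sup>2 * x\<^sup>2 * f x) *\<^sub>R u x) = (LINT x|lborel. f x *\<^sub>R v x)"
  shows "(LINT x|lborel. herm j x *\<^sub>R v x) = energy j *\<^sub>R (LINT x|lborel. herm j x *\<^sub>R u x)"
proof -
  have "(LINT x|lborel. pg (nhp j) x *\<^sub>R v x)
      = (LINT x|lborel. (- (1/2) * pg (D (D (nhp j))) x + poly [:0, 0, b\<^sup>2 / 2:] x * pg (nhp j) x) *\<^sub>R u x)"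
    using eq by (intro weak_equation_extend[OF u v, symmetric]) (simp add: power2_eq_square mult_ac)
  also have "\<dots> = (LINT x|lborel. (energy j * pg (nhp j) x) *\<^sub>R u x)"
  proof -
    have "- (1/2) * pg (D (D (nhp j))) x + poly [:0, 0, b\<^sup>2 / 2:] x * pg (nhp j) x = pg (L (nhp j)) x" for x
      by (simp add: L_def pg_def algebra_simps)
    then show ?thesis by (simp add: L_nhp pg_simps)
  qed
  also have "\<dots> = energy j *\<^sub>R (LINT x|lborel. pg (nhp j) x *\<^sub>R u x)"
    by (simp flip: scaleR_scaleR)
  finally show ?thesis by (simp add: herm_def)
qed

end

section \<open>Partial Hermite coefficients on the plane\<close>

text \<open>The multipliers for \<open>gauss_integrable\<close>. Hermite functions, test functions
  and products of such functions in separate variables all belong to it, so one Fubini lemma covers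
  every pairing that occurs.\<close>

definition gauss_bounded :: "('a::euclidean_space \<Rightarrow> real) \<Rightarrow> bool" where
  "gauss_bounded f \<longleftrightarrow> f \<in> borel_measurable borel \<and> (\<exists>C a. a > 0 \<and> (\<forall>z. \<bar>f z\<bar> \<le> C * exp (- a * (norm z)\<^sup>2)))"

lemma gauss_bounded_measurable: "gauss_bounded f \<Longrightarrow> f \<in> borel_measurable borel"
  by (simp add: gauss_bounded_def)

lemma gauss_boundedE:
  assumes "gauss_bounded f"
  obtains C a where "a > 0" "C \<ge> 0" "\<forall>z. \<bar>f z\<bar> \<le> C * exp (- a * (norm z)\<^sup>2)"
proof -
  obtain C a where Ca: "a > 0" "\<forall>z. \<bar>f z\<bar> \<le> C * exp (- a * (norm z)\<^sup>2)"
    using assms unfolding gauss_bounded_def by blast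
  moreover have "C \<ge> 0" using Ca(2)[rule_format, of 0] by simp
  ultimately show ?thesis by (intro that)
qed

lemma integrable_gauss_bounded:
  "gauss_integrable u \<Longrightarrow> gauss_bounded f \<Longrightarrow> integrable lborel (\<lambda>z. f z *\<^sub>R u z)"
  unfolding gauss_bounded_def by (blast intro: gauss_integrable_mult)

lemma gauss_bounded_test: "test_function f \<Longrightarrow> gauss_bounded f"
proof -
  assume f: "test_function f"
  obtain C where "\<And>z. \<bar>f z\<bar> \<le> C * exp (- 1 * (norm z)\<^sup>2)"
    using test_function_gauss_bound[OF f, of 1] by auto
  then show ?thesis
    unfolding gauss_bounded_def by (intro conjI exI[of _ C] exI[of _ 1] allI test_function_measurable f) auto
qed

lemma gauss_bounded_cmult: "gauss_bounded f \<Longrightarrow> gauss_bounded (\<lambda>z. c * f z)"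
proof -
  assume f: "gauss_bounded f"
  obtain C a where Ca: "a > 0" "C \<ge> 0" "\<forall>z. \<bar>f z\<bar> \<le> C * exp (- a * (norm z)\<^sup>2)"
    by (rule gauss_boundedE[OF f])
  have "\<bar>c * f z\<bar> \<le> (\<bar>c\<bar> * C) * exp (- a * (norm z)\<^sup>2)" for z
    using mult_left_mono[OF Ca(3)[rule_format, of z], of "\<bar>c\<bar>"] by (simp add: abs_mult mult.assoc)
  then have "\<exists>C a. a > 0 \<and> (\<forall>z. \<bar>c * f z\<bar> \<le> C * exp (- a * (norm z)\<^sup>2))"
    using Ca(1) by blast
  then show ?thesis using gauss_bounded_measurable[OF f] unfolding gauss_bounded_def by simp
qed

lemma gauss_bounded_add:
  assumes "gauss_bounded f" "gauss_bounded g"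
  shows "gauss_bounded (\<lambda>z. f z + g z)"
proof -
  obtain C a where f: "a > 0" "C \<ge> 0" "\<forall>z. \<bar>f z\<bar> \<le> C * exp (- a * (norm z)\<^sup>2)"
    by (rule gauss_boundedE[OF assms(1)])
  obtain C' a' where g: "a' > 0" "C' \<ge> 0" "\<forall>z. \<bar>g z\<bar> \<le> C' * exp (- a' * (norm z)\<^sup>2)"
    by (rule gauss_boundedE[OF assms(2)])
  have "\<bar>f z + g z\<bar> \<le> (C + C') * exp (- min a a' * (norm z)\<^sup>2)" for z
  proof -
    have "C * exp (- a * (norm z)\<^sup>2) \<le> C * exp (- min a a' * (norm z)\<^sup>2)"
      using f by (intro mult_left_mono) (auto intro: mult_right_mono)
    moreover have "C' * exp (- a' * (norm z)\<^sup>2) \<le> C' * exp (- min a a' * (norm z)\<^sup>2)"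
      using g by (intro mult_left_mono) (auto intro: mult_right_mono)
    ultimately show ?thesis
      using f(3)[rule_format, of z] g(3)[rule_format, of z] unfolding distrib_right by linarith
  qed
  moreover have "min a a' > 0" using f g by simp
  ultimately show ?thesis
    using assms[THEN gauss_bounded_measurable] unfolding gauss_bounded_def
    by (intro conjI exI[of _ "C + C'"] exI[of _ "min a a'"]) auto
qed

lemma gauss_bounded_tensor:
  assumes "gauss_bounded f" "gauss_bounded g"
  shows "gauss_bounded (\<lambda>z::real \<times> real. f (fst z) * g (snd z))"
proof -
  have [measurable]: "f \<in> borel_measurable borel" "g \<in> borel_measurable borel"
    using assms by (auto intro: gauss_bounded_measurable)
  have m: "(\<lambda>z::real \<times> real. f (fst z) * g (snd z)) \<in> borel_measurable borel"
    by (subst borel_prod[symmetric]) measurable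
  obtain C a where f: "a > 0" "C \<ge> 0" "\<forall>z. \<bar>f z\<bar> \<le> C * exp (- a * (norm z)\<^sup>2)"
    by (rule gauss_boundedE[OF assms(1)])
  obtain C' a' where g: "a' > 0" "C' \<ge> 0" "\<forall>z. \<bar>g z\<bar> \<le> C' * exp (- a' * (norm z)\<^sup>2)"
    by (rule gauss_boundedE[OF assms(2)])
  have "\<bar>f (fst z) * g (snd z)\<bar> \<le> (C * C') * exp (- min a a' * (norm z)\<^sup>2)" for z
  proof -
    have "\<bar>f (fst z) * g (snd z)\<bar> \<le> (C * exp (- a * (norm (fst z))\<^sup>2)) * (C' * exp (- a' * (norm (snd z))\<^sup>2))"
      unfolding abs_mult using f g by (intro mult_mono) auto
    also have "\<dots> \<le> (C * exp (- min a a' * (norm (fst z))\<^sup>2)) * (C' * exp (- min a a' * (norm (snd z))\<^sup>2))"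
      using f g by (intro mult_mono) (auto intro: mult_right_mono)
    also have "\<dots> = (C * C') * exp (- min a a' * (norm z)\<^sup>2)"
      by (cases z) (simp add: norm_Pair algebra_simps flip: exp_add)
    finally show ?thesis .
  qed
  moreover have "min a a' > 0" using f g by simp
  ultimately show ?thesis using m unfolding gauss_bounded_def by blast
qed

section \<open>Sections, Fubini and null sets in the plane\<close>

text \<open>Fubini yields one exceptional null set for each rate. The countably many rates 1/(n+1)
  suffice, since exp(-a x^2) is below exp(-x^2/(n+1)) once 1/(n+1) < a, and on a section the y-part
  of the Gaussian is a constant.\<close>

lemma gauss_integrable_section:
  assumes v: "gauss_integrable (v :: real \<times> real \<Rightarrow> complex)"
  shows "AE y in lborel. gauss_integrable (\<lambda>x. v (x, y))"
proof -
  have v_meas: "v \<in> borel_measurable borel" by (rule gauss_integrable_measurable[OF v])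
  then have vm[measurable]: "v \<in> borel_measurable (borel \<Otimes>\<^sub>M borel)" by (simp add: borel_prod)
  let ?a = "\<lambda>n. inverse (real (Suc n))"
  have "AE y in lborel. integrable lborel (\<lambda>x. exp (- ?a n * (norm (x, y))\<^sup>2) *\<^sub>R v (x, y))" for n
  proof (rule lborel_pair.AE_integrable_snd)
    show "integrable (lborel \<Otimes>\<^sub>M lborel) (\<lambda>(x, y). exp (- ?a n * (norm (x, y))\<^sup>2) *\<^sub>R v (x, y))"
      using v unfolding gauss_integrable_def lborel_prod by (simp add: case_prod_unfold)
  qed
  then have "AE y in lborel. \<forall>n. integrable lborel (\<lambda>x. exp (- ?a n * (norm (x, y))\<^sup>2) *\<^sub>R v (x, y))"
    by (simp add: AE_all_countable)
  then show ?thesis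
  proof eventually_elim
    case (elim y)
    have m: "(\<lambda>x. v (x, y)) \<in> borel_measurable borel" by measurable
    have "integrable lborel (\<lambda>x. exp (- a * (norm x)\<^sup>2) *\<^sub>R v (x, y))" if a: "a > 0" for a
    proof -
      obtain n where n: "?a n < a" using reals_Archimedean[OF a] by blast
      have i: "integrable lborel (\<lambda>x. exp (?a n * y\<^sup>2) *\<^sub>R (exp (- ?a n * (norm (x, y))\<^sup>2) *\<^sub>R v (x, y)))"
        using elim by (intro integrable_scaleR_right) blast
      have eq: "exp (?a n * y\<^sup>2) * exp (- ?a n * (norm (x, y))\<^sup>2) = exp (- ?a n * x\<^sup>2)" for x
        by (simp add: norm_Pair algebra_simps flip: exp_add)
      show ?thesis
      proof (rule Bochner_Integration.integrable_bound[OF i])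
        show "AE x in lborel. norm (exp (- a * (norm x)\<^sup>2) *\<^sub>R v (x, y)) \<le>
            norm (exp (?a n * y\<^sup>2) *\<^sub>R (exp (- ?a n * (norm (x, y))\<^sup>2) *\<^sub>R v (x, y)))"
          unfolding scaleR_scaleR eq using n
          by (intro AE_I2) (auto intro!: mult_right_mono)
      qed (use m in measurable)
    qed
    then show ?case unfolding gauss_integrable_def using m by blast
  qed
qed

lemma integrable_tensor:
  assumes v: "gauss_integrable (v :: real \<times> real \<Rightarrow> complex)" and f: "gauss_bounded f" and g: "gauss_bounded g"
  shows "integrable (lborel \<Otimes>\<^sub>M lborel) (\<lambda>z. (f (fst z) * g (snd z)) *\<^sub>R v z)"
  unfolding lborel_prod by (intro integrable_gauss_bounded v gauss_bounded_tensor f g)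

lemma gauss_bounded_gauss: "a > 0 \<Longrightarrow> gauss_bounded (\<lambda>x::real. exp (- a * (norm x)\<^sup>2))"
  unfolding gauss_bounded_def by (intro conjI exI[of _ 1] exI[of _ a]) auto

text \<open>Named after the remaining variable: x is integrated out here, y in the mirror lemma
  \<open>partial_integral_fst\<close>. Both compare with the same integral over the plane, which is
  how a Hermite coefficient in x is interchanged with a test function in y.\<close>

lemma partial_integral_snd:
  assumes v: "gauss_integrable (v :: real \<times> real \<Rightarrow> complex)" and f: "gauss_bounded f"
  shows "gauss_integrable (\<lambda>y. LINT x|lborel. f x *\<^sub>R v (x, y))"
    and "gauss_bounded g \<Longrightarrow> (LINT y|lborel. g y *\<^sub>R (LINT x|lborel. f x *\<^sub>R v (x, y)))
      = (LINT z|lborel. (f (fst z) * g (snd z)) *\<^sub>R v z)"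
proof -
  have [measurable]: "v \<in> borel_measurable (borel \<Otimes>\<^sub>M borel)"
    using gauss_integrable_measurable[OF v] by (simp add: borel_prod)
  have [measurable]: "f \<in> borel_measurable borel" by (rule gauss_bounded_measurable[OF f])
  have eq: "g y *\<^sub>R (LINT x|lborel. f x *\<^sub>R v (x, y)) = (LINT x|lborel. (f x * g y) *\<^sub>R v (x, y))" for g :: "real \<Rightarrow> real" and y
    by (simp add: mult.commute flip: integral_scaleR_right)
  have int: "integrable (lborel \<Otimes>\<^sub>M lborel) (\<lambda>(x, y). (f x * g y) *\<^sub>R v (x, y))" if "gauss_bounded g" for g
    using integrable_tensor[OF v f that] by (simp add: case_prod_unfold)
  show "gauss_integrable (\<lambda>y. LINT x|lborel. f x *\<^sub>R v (x, y))"
    unfolding gauss_integrable_def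
  proof (intro conjI allI impI)
    show "(\<lambda>y. LINT x|lborel. f x *\<^sub>R v (x, y)) \<in> borel_measurable borel"
      by measurable
    show "integrable lborel (\<lambda>y. exp (- a * (norm y)\<^sup>2) *\<^sub>R (LINT x|lborel. f x *\<^sub>R v (x, y)))" if "a > 0" for a
      unfolding eq[of "\<lambda>y. exp (- a * (norm y)\<^sup>2)"]
      by (rule lborel_pair.integrable_snd[OF int[OF gauss_bounded_gauss[OF that]]])
  qed
  assume g: "gauss_bounded g"
  show "(LINT y|lborel. g y *\<^sub>R (LINT x|lborel. f x *\<^sub>R v (x, y))) = (LINT z|lborel. (f (fst z) * g (snd z)) *\<^sub>R v z)"
    unfolding eq using lborel_pair.integral_snd[OF int[OF g]] by (simp add: case_prod_unfold lborel_prod)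
qed

lemma partial_integral_fst:
  assumes v: "gauss_integrable (v :: real \<times> real \<Rightarrow> complex)" and g: "gauss_bounded g"
  shows "gauss_integrable (\<lambda>x. LINT y|lborel. g y *\<^sub>R v (x, y))"
    and "gauss_bounded f \<Longrightarrow> (LINT x|lborel. f x *\<^sub>R (LINT y|lborel. g y *\<^sub>R v (x, y)))
      = (LINT z|lborel. (f (fst z) * g (snd z)) *\<^sub>R v z)"
proof -
  have [measurable]: "v \<in> borel_measurable (borel \<Otimes>\<^sub>M borel)"
    using gauss_integrable_measurable[OF v] by (simp add: borel_prod)
  have [measurable]: "g \<in> borel_measurable borel" by (rule gauss_bounded_measurable[OF g])
  have eq: "f x *\<^sub>R (LINT y|lborel. g y *\<^sub>R v (x, y)) = (LINT y|lborel. (f x * g y) *\<^sub>R v (x, y))" for f :: "real \<Rightarrow> real" and x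
    by (simp flip: integral_scaleR_right)
  have int: "integrable (lborel \<Otimes>\<^sub>M lborel) (\<lambda>z. (f (fst z) * g (snd z)) *\<^sub>R v z)" if "gauss_bounded f" for f
    using integrable_tensor[OF v that g] .
  show "gauss_integrable (\<lambda>x. LINT y|lborel. g y *\<^sub>R v (x, y))"
    unfolding gauss_integrable_def
  proof (intro conjI allI impI)
    show "(\<lambda>x. LINT y|lborel. g y *\<^sub>R v (x, y)) \<in> borel_measurable borel"
      by measurable
    show "integrable lborel (\<lambda>x. exp (- a * (norm x)\<^sup>2) *\<^sub>R (LINT y|lborel. g y *\<^sub>R v (x, y)))" if "a > 0" for a
      unfolding eq[of "\<lambda>y. exp (- a * (norm y)\<^sup>2)"]
      using lborel_pair.integrable_fst'[OF int[OF gauss_bounded_gauss[OF that]]] by simp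
  qed
  assume f: "gauss_bounded f"
  show "(LINT x|lborel. f x *\<^sub>R (LINT y|lborel. g y *\<^sub>R v (x, y))) = (LINT z|lborel. (f (fst z) * g (snd z)) *\<^sub>R v z)"
    unfolding eq using lborel_pair.integral_fst'[OF int[OF f]] by (simp add: lborel_prod)
qed

lemma AE_planeI:
  assumes m: "{z. Q z} \<in> sets borel" and ae: "AE y in lborel. AE x in lborel. Q (x, y)"
  shows "AE z::real \<times> real in lborel. Q z"
proof -
  have s: "{z \<in> space (lborel \<Otimes>\<^sub>M lborel). Q (fst z, snd z)} \<in> sets (lborel \<Otimes>\<^sub>M lborel)"
    unfolding lborel_prod using m by simp
  have "AE x in lborel. AE y in lborel. Q (x, y)"
    using s ae by (subst lborel_pair.AE_commute) simp_all
  then have "AE z in lborel \<Otimes>\<^sub>M lborel. Q z"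
    by (intro lborel_pair.AE_pair_measure) (use s in auto)
  then show ?thesis unfolding lborel_prod .
qed

lemma AE_plane_section:
  assumes "AE z::real \<times> real in lborel. Q z"
  shows "AE y in lborel. AE x in lborel. Q (x, y)"
proof -
  obtain N where N0: "{z \<in> space lborel. \<not> Q z} \<subseteq> N" "emeasure lborel N = 0" "N \<in> sets lborel"
    using assms by (rule AE_E)
  then have N: "N \<in> null_sets lborel" "{z. \<not> Q z} \<subseteq> N" by auto
  have "AE z in lborel. z \<notin> N" using N(1) by (rule AE_not_in)
  then have "AE z in lborel \<Otimes>\<^sub>M lborel. z \<notin> N" unfolding lborel_prod .
  then have "AE x in lborel. AE y in lborel. (x, y) \<notin> N" by (rule lborel_pair.AE_pair)
  moreover have "{z \<in> space (lborel \<Otimes>\<^sub>M lborel). (fst z, snd z) \<notin> N} \<in> sets (lborel \<Otimes>\<^sub>M lborel)"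
    unfolding lborel_prod using N0(3) by (simp add: Compl_eq[symmetric])
  ultimately have "AE y in lborel. AE x in lborel. (x, y) \<notin> N"
    by (subst (asm) lborel_pair.AE_commute) simp_all
  then show ?thesis
    by (elim eventually_mono) (use N(2) in auto)
qed

lemma AE_snd:
  assumes "AE y in lborel. Q y"
  shows "AE z::real \<times> real in lborel. Q (snd z)"
proof -
  obtain N where N0: "{z \<in> space lborel. \<not> Q z} \<subseteq> N" "emeasure lborel N = 0" "N \<in> sets lborel"
    using assms by (rule AE_E)
  then have N: "N \<in> null_sets lborel" "{z. \<not> Q z} \<subseteq> N" by auto
  have "emeasure (lborel \<Otimes>\<^sub>M lborel) ((UNIV :: real set) \<times> N) = 0"
    using N(1) by (subst lborel.emeasure_pair_measure_Times) auto
  then have "(UNIV :: real set) \<times> N \<in> null_sets lborel"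
    using N(1) by (auto simp: lborel_prod[symmetric] null_sets_def)
  then have "AE z in lborel. z \<notin> (UNIV :: real set) \<times> N" by (rule AE_not_in)
  then show ?thesis by eventually_elim (use N(2) in auto)
qed

text \<open>The inner product of \<open>L2\<close> is only the real part of the sesquilinear one, so
  it is applied to the moduli, where nothing is lost.\<close>

lemma Cauchy_Schwarz_integral:
  fixes f g :: "'a::euclidean_space \<Rightarrow> complex"
  assumes f: "sq_integrable f" and g: "sq_integrable g"
  shows "integrable lborel (\<lambda>z. f z * g z)"
    and "(norm (LINT z|lborel. f z * g z))\<^sup>2 \<le> (LINT z|lborel. (norm (f z))\<^sup>2) * (LINT z|lborel. (norm (g z))\<^sup>2)"
proof -
  have [measurable]: "f \<in> borel_measurable borel" "g \<in> borel_measurable borel"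
    using f g by (auto simp: sq_integrable_def)
  let ?f = "\<lambda>z. complex_of_real (norm (f z))" and ?g = "\<lambda>z. complex_of_real (norm (g z))"
  have sf: "sq_integrable ?f" and sg: "sq_integrable ?g" using f g by (auto simp: sq_integrable_def)
  have "integrable lborel (\<lambda>z. ?f z \<bullet> ?g z)" by (rule sq_integrable_inner[OF sf sg])
  then have i: "integrable lborel (\<lambda>z. norm (f z) * norm (g z))" by (simp add: inner_complex_def)
  then show "integrable lborel (\<lambda>z. f z * g z)"
    by (rule Bochner_Integration.integrable_bound) (auto simp: norm_mult)
  have "norm (LINT z|lborel. f z * g z) \<le> (LINT z|lborel. norm (f z * g z))" by (rule integral_norm_bound)
  also have "\<dots> = to_L2 ?f \<bullet> to_L2 ?g"
    by (subst inner_L2_cong[OF rep_to_L2[OF sf] rep_to_L2[OF sg]]) (auto simp: inner_complex_def norm_mult)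
  also have "\<dots> \<le> norm (to_L2 ?f) * norm (to_L2 ?g)" by (rule norm_cauchy_schwarz)
  finally have "(norm (LINT z|lborel. f z * g z))\<^sup>2 \<le> (norm (to_L2 ?f) * norm (to_L2 ?g))\<^sup>2"
    by (intro power_mono) auto
  then show "(norm (LINT z|lborel. f z * g z))\<^sup>2 \<le> (LINT z|lborel. (norm (f z))\<^sup>2) * (LINT z|lborel. (norm (g z))\<^sup>2)"
    by (simp add: power_mult_distrib norm_to_L2[OF sf] norm_to_L2[OF sg])
qed

lemma sq_integrable_section:
  assumes v: "sq_integrable (v :: real \<times> real \<Rightarrow> complex)"
  shows "AE y in lborel. sq_integrable (\<lambda>x. v (x, y))"
    and "integrable lborel (\<lambda>y. LINT x|lborel. (norm (v (x, y)))\<^sup>2)"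
proof -
  have i: "integrable (lborel \<Otimes>\<^sub>M lborel) (\<lambda>(x, y). (norm (v (x, y)))\<^sup>2)"
    using v unfolding lborel_prod by (simp add: case_prod_unfold sq_integrable_def)
  have [measurable]: "v \<in> borel_measurable (borel \<Otimes>\<^sub>M borel)"
    using v by (simp add: borel_prod sq_integrable_def)
  show "AE y in lborel. sq_integrable (\<lambda>x. v (x, y))"
    using lborel_pair.AE_integrable_snd[OF i] by eventually_elim (simp add: sq_integrable_def)
  show "integrable lborel (\<lambda>y. LINT x|lborel. (norm (v (x, y)))\<^sup>2)"
    by (rule lborel_pair.integrable_snd[OF i])
qed

lemma sq_integrable_tensor:
  assumes h: "h \<in> borel_measurable borel" "integrable lborel (\<lambda>x. (h x)\<^sup>2)" and c: "sq_integrable c"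
  shows "sq_integrable (\<lambda>z::real \<times> real. h (fst z) *\<^sub>R c (snd z))"
    and "(LINT z::real \<times> real|lborel. (norm (h (fst z) *\<^sub>R c (snd z)))\<^sup>2) = (LINT x|lborel. (h x)\<^sup>2) * (LINT y|lborel. (norm (c y))\<^sup>2)"
proof -
  have [measurable]: "h \<in> borel_measurable borel" "c \<in> borel_measurable borel"
    using h c by (auto simp: sq_integrable_def)
  have ic: "integrable lborel (\<lambda>y. (norm (c y))\<^sup>2)" using c by (simp add: sq_integrable_def)
  have m: "(\<lambda>z::real \<times> real. h (fst z) *\<^sub>R c (snd z)) \<in> borel_measurable borel"
    by (subst borel_prod[symmetric]) measurable
  have i: "integrable (lborel \<Otimes>\<^sub>M lborel) (\<lambda>z. (norm (h (fst z) *\<^sub>R c (snd z)))\<^sup>2)"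
    by (rule lborel_pair.Fubini_integrable) (use h ic in \<open>simp_all add: power_mult_distrib\<close>)
  show "sq_integrable (\<lambda>z::real \<times> real. h (fst z) *\<^sub>R c (snd z))"
    using i m by (simp add: lborel_prod sq_integrable_def)
  show "(LINT z::real \<times> real|lborel. (norm (h (fst z) *\<^sub>R c (snd z)))\<^sup>2) = (LINT x|lborel. (h x)\<^sup>2) * (LINT y|lborel. (norm (c y))\<^sup>2)"
    using lborel_pair.integral_fst'[OF i] by (simp add: power_mult_distrib lborel_prod)
qed

lemma sq_integrable_gauss_bounded_line:
  assumes "gauss_bounded (f :: real \<Rightarrow> real)"
  shows "sq_integrable (\<lambda>x. complex_of_real (f x))"
proof -
  obtain C a where f: "a > 0" "C \<ge> 0" "\<forall>z. \<bar>f z\<bar> \<le> C * exp (- a * (norm z)\<^sup>2)"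
    by (rule gauss_boundedE[OF assms])
  have [measurable]: "f \<in> borel_measurable borel" by (rule gauss_bounded_measurable[OF assms])
  have "integrable lborel (\<lambda>x. (f x)\<^sup>2)"
  proof (rule Bochner_Integration.integrable_bound)
    show "integrable lborel (\<lambda>x::real. C\<^sup>2 * exp (- (2 * a) * (norm x)\<^sup>2))"
      using f(1) integrable_gauss_line[of "2 * a"] by simp
    have "(f x)\<^sup>2 \<le> (C * exp (- a * (norm x)\<^sup>2))\<^sup>2" for x
      using f(3) by (metis abs_ge_zero power2_abs power_mono)
    moreover have "(C * exp (- a * (norm x)\<^sup>2))\<^sup>2 = C\<^sup>2 * exp (- (2 * a) * (norm x)\<^sup>2)" for x :: real
      by (simp add: power2_eq_square flip: exp_add)
    ultimately show "AE x in lborel. norm ((f x)\<^sup>2) \<le> norm (C\<^sup>2 * exp (- (2 * a) * (norm x)\<^sup>2))"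
      by simp
  qed measurable
  then show ?thesis by (simp add: sq_integrable_def)
qed

lemma sq_integrable_test_plane:
  assumes "test_function (f :: real \<times> real \<Rightarrow> real)"
  shows "sq_integrable (\<lambda>z. complex_of_real (f z))"
proof -
  have [measurable]: "f \<in> borel_measurable borel" by (rule test_function_measurable[OF assms])
  have "test_function (\<lambda>z. f z * f z)"
    using assms by (intro test_function_mult_smooth) (auto simp: test_function_def)
  then obtain C where C: "\<And>z. \<bar>f z * f z\<bar> \<le> C * exp (- 1 * (norm z)\<^sup>2)" "C \<ge> 0"
    using test_function_gauss_bound[of "\<lambda>z. f z * f z" 1] by auto
  have "integrable lborel (\<lambda>z. f z * f z)"
    by (rule Bochner_Integration.integrable_bound[OF integrable_mult_right[OF integrable_gauss_plane[of 1], of C]])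
       (use C in auto)
  then show ?thesis by (simp add: sq_integrable_def power2_eq_square)
qed

section \<open>Hermite projections on the plane\<close>

context oscillator
begin

lemma gauss_bounded_herm: "gauss_bounded (herm k)"
proof -
  obtain C where "C \<ge> 0" "\<forall>x. \<bar>pg (nhp k) x\<bar> \<le> C * exp (- (b / 4) * x\<^sup>2)" using pg_bound_ex by blast
  then show ?thesis
    unfolding gauss_bounded_def herm_def using b_pos by (intro conjI exI[of _ C] exI[of _ "b / 4"]) auto
qed

lemma herm_measurable [measurable]: "herm k \<in> borel_measurable borel"
  by (simp add: herm_def)

lemma herm_sq: "integrable lborel (\<lambda>x. (herm k x)\<^sup>2)" "(LINT x|lborel. (herm k x)\<^sup>2) = 1"
  using integrable_pg_mult[of "nhp k" "nhp k"] herm_orthonormal[of k k]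
  unfolding herm_def power2_eq_square by simp_all

definition hcoef :: "nat \<Rightarrow> (real \<times> real \<Rightarrow> complex) \<Rightarrow> real \<Rightarrow> complex" where
  "hcoef k v y = (LINT x|lborel. herm k x *\<^sub>R v (x, y))"

definition tensor_herm :: "nat \<Rightarrow> (real \<Rightarrow> complex) \<Rightarrow> real \<times> real \<Rightarrow> complex" where
  "tensor_herm k c z = herm k (fst z) *\<^sub>R c (snd z)"

definition proj :: "nat \<Rightarrow> (real \<times> real) L2 \<Rightarrow> (real \<times> real) L2" where
  "proj k u = to_L2 (tensor_herm k (hcoef k (rep_L2 u)))"

text \<open>The null set obtained by removing f depends on g, and there are uncountably many g.
  Pairing with \<open>herm j\<close> in x before removing g leaves one null set for each of the
  countably many j; \<open>hermite_total\<close> then concludes on almost every horizontal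
  line.\<close>

lemma fundamental_lemma_plane:
  assumes v: "gauss_integrable (v :: real \<times> real \<Rightarrow> complex)"
    and eq: "\<And>f g. test_function f \<Longrightarrow> test_function g \<Longrightarrow> (LINT z|lborel. (f (fst z) * g (snd z)) *\<^sub>R v z) = 0"
  shows "AE z in lborel. v z = 0"
proof -
  have 1: "AE x in lborel. (LINT y|lborel. g y *\<^sub>R v (x, y)) = 0" if g: "test_function g" for g
    by (rule fundamental_lemma_line)
       (simp_all add: partial_integral_fst v g gauss_bounded_test eq)
  have 2: "AE y in lborel. hcoef j v y = 0" for j
  proof (rule fundamental_lemma_line)
    show "gauss_integrable (hcoef j v)"
      unfolding hcoef_def by (rule partial_integral_snd(1)[OF v gauss_bounded_herm])
    fix g :: "real \<Rightarrow> real" assume g: "test_function g"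
    have "(LINT y|lborel. g y *\<^sub>R hcoef j v y) = (LINT x|lborel. herm j x *\<^sub>R (LINT y|lborel. g y *\<^sub>R v (x, y)))"
      unfolding hcoef_def
      by (simp add: partial_integral_fst partial_integral_snd v g gauss_bounded_test gauss_bounded_herm)
    also have "\<dots> = 0"
      by (rule integral_eq_zero_AE) (use 1[OF g] in \<open>auto elim!: eventually_mono\<close>)
    finally show "(LINT y|lborel. g y *\<^sub>R hcoef j v y) = 0" .
  qed
  have "AE y in lborel. \<forall>j. hcoef j v y = 0" using 2 by (simp add: AE_all_countable)
  then have "AE y in lborel. AE x in lborel. v (x, y) = 0"
    using gauss_integrable_section[OF v]
  proof eventually_elim
    case (elim y)
    then show ?case by (intro hermite_total) (simp_all add: hcoef_def)
  qed
  moreover have "{z. v z = 0} \<in> sets borel"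
    using gauss_integrable_measurable[OF v] by measurable
  ultimately show ?thesis by (intro AE_planeI)
qed

end

section \<open>The oscillator on the plane\<close>

lemma gauss_integrable_rep: "gauss_integrable (rep_L2 (u :: (real \<times> real) L2))"
  by (rule gauss_integrable_sq_plane) simp_all

context oscillator
begin

lemma sq_integrable_herm: "sq_integrable (\<lambda>x. complex_of_real (herm k x))"
  by (rule sq_integrable_gauss_bounded_line[OF gauss_bounded_herm])

lemma herm_section_integrable:
  fixes v :: "real \<times> real \<Rightarrow> complex"
  assumes v: "sq_integrable v"
  shows "AE y in lborel. integrable lborel (\<lambda>x. herm k x *\<^sub>R v (x, y))"
  using sq_integrable_section(1)[OF v]
proof eventually_elim
  case (elim y)
  show ?case
    using Cauchy_Schwarz_integral(1)[OF sq_integrable_herm elim, of k] by (simp add: scaleR_conv_of_real)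
qed

lemma hcoef_le:
  fixes v :: "real \<times> real \<Rightarrow> complex"
  assumes v: "sq_integrable v"
  shows "AE y in lborel. (norm (hcoef k v y))\<^sup>2 \<le> (LINT x|lborel. (norm (v (x, y)))\<^sup>2)"
  using sq_integrable_section(1)[OF v]
proof eventually_elim
  case (elim y)
  show ?case
    using Cauchy_Schwarz_integral(2)[OF sq_integrable_herm elim, of k]
    by (simp add: hcoef_def scaleR_conv_of_real herm_sq)
qed

lemma hcoef_measurable:
  assumes "v \<in> borel_measurable borel"
  shows "hcoef k v \<in> borel_measurable borel"
proof -
  have [measurable]: "v \<in> borel_measurable (borel \<Otimes>\<^sub>M borel)" using assms by (simp add: borel_prod)
  show ?thesis unfolding hcoef_def by measurable
qed

lemma sq_integrable_hcoef:
  assumes v: "sq_integrable v"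
  shows "sq_integrable (hcoef k v)"
proof -
  have [measurable]: "hcoef k v \<in> borel_measurable borel"
    using v by (intro hcoef_measurable) (simp add: sq_integrable_def)
  have "integrable lborel (\<lambda>y. (norm (hcoef k v y))\<^sup>2)"
    by (rule Bochner_Integration.integrable_bound[OF sq_integrable_section(2)[OF v]])
       (use hcoef_le[OF v, of k] in \<open>auto elim!: eventually_mono intro: order_trans[OF _ abs_ge_self]\<close>)
  then show ?thesis by (simp add: sq_integrable_def)
qed

lemma hcoef_cong:
  assumes "u \<in> borel_measurable borel" "v \<in> borel_measurable borel" and eq: "AE z in lborel. u z = v z"
  shows "AE y in lborel. hcoef k u y = hcoef k v y"
  using AE_plane_section[OF eq]
proof eventually_elim
  case (elim y)
  have [measurable]: "u \<in> borel_measurable (borel \<Otimes>\<^sub>M borel)" "v \<in> borel_measurable (borel \<Otimes>\<^sub>M borel)"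
    using assms by (simp_all add: borel_prod)
  show ?case unfolding hcoef_def
    by (rule integral_cong_AE) (use elim in \<open>auto elim!: eventually_mono\<close>)
qed

lemma hcoef_add:
  assumes "sq_integrable u" "sq_integrable v"
  shows "AE y in lborel. hcoef k (\<lambda>z. u z + v z) y = hcoef k u y + hcoef k v y"
  using herm_section_integrable[OF assms(1), of k] herm_section_integrable[OF assms(2), of k]
  by eventually_elim (simp add: hcoef_def scaleR_add_right)

lemma hcoef_cmult: "hcoef k (\<lambda>z. c * v z) y = c * hcoef k v y"
  by (simp add: hcoef_def flip: mult_scaleR_right)

lemma hcoef_tensor: "hcoef j (tensor_herm k c) y = (if j = k then c y else 0)"
proof -
  have "integrable lborel (\<lambda>x. herm j x * herm k x)"
    unfolding herm_def by (rule integrable_pg_mult)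
  then have "hcoef j (tensor_herm k c) y = (LINT x|lborel. herm j x * herm k x) *\<^sub>R c y"
    by (simp add: hcoef_def tensor_herm_def)
  then show ?thesis by (simp add: herm_orthonormal)
qed

lemma sq_integrable_tensor_herm: "sq_integrable c \<Longrightarrow> sq_integrable (tensor_herm k c)"
  unfolding tensor_herm_def by (rule sq_integrable_tensor) (auto simp: herm_sq)

lemma integral_tensor_herm_inner:
  assumes c: "sq_integrable c" and v: "sq_integrable v"
  shows "(LINT z|lborel. tensor_herm k c z \<bullet> v z) = (LINT y|lborel. c y \<bullet> hcoef k v y)"
proof -
  have i: "integrable (lborel \<Otimes>\<^sub>M lborel) (\<lambda>(x, y). tensor_herm k c (x, y) \<bullet> v (x, y))"
    using sq_integrable_inner[OF sq_integrable_tensor_herm[OF c] v, of k]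
    unfolding lborel_prod by (simp add: case_prod_unfold)
  have [measurable]: "v \<in> borel_measurable (borel \<Otimes>\<^sub>M borel)" "c \<in> borel_measurable borel"
    "hcoef k v \<in> borel_measurable borel"
    using c v by (auto simp: borel_prod sq_integrable_def intro: hcoef_measurable)
  have "(LINT z|lborel. tensor_herm k c z \<bullet> v z)
      = (LINT y|lborel. LINT x|lborel. tensor_herm k c (x, y) \<bullet> v (x, y))"
    unfolding lborel_pair.integral_snd[OF i] lborel_prod by (simp add: case_prod_unfold)
  also have "\<dots> = (LINT y|lborel. c y \<bullet> hcoef k v y)"
  proof (rule integral_cong_AE)
    show "AE y in lborel. (LINT x|lborel. tensor_herm k c (x, y) \<bullet> v (x, y)) = c y \<bullet> hcoef k v y"
      using herm_section_integrable[OF v, of k]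
    proof eventually_elim
      case (elim y)
      have "tensor_herm k c (x, y) \<bullet> v (x, y) = c y \<bullet> (herm k x *\<^sub>R v (x, y))" for x
        by (simp add: tensor_herm_def)
      then show ?case unfolding hcoef_def using elim by (simp only: integral_inner_right)
    qed
  qed (simp_all add: tensor_herm_def)
  finally show ?thesis .
qed

lemma rep_proj: "AE z in lborel. rep_L2 (proj k u) z = tensor_herm k (hcoef k (rep_L2 u)) z"
  unfolding proj_def by (intro rep_to_L2 sq_integrable_tensor_herm sq_integrable_hcoef) simp

lemma proj_inner: "proj k u \<bullet> v = (LINT y|lborel. hcoef k (rep_L2 u) y \<bullet> hcoef k (rep_L2 v) y)"
proof -
  have s: "sq_integrable (tensor_herm k (hcoef k (rep_L2 u)))"
    by (intro sq_integrable_tensor_herm sq_integrable_hcoef) simp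
  have "proj k u \<bullet> v = (LINT z|lborel. tensor_herm k (hcoef k (rep_L2 u)) z \<bullet> rep_L2 v z)"
    unfolding proj_def by (rule inner_to_L2[OF s])
  then show ?thesis
    by (simp add: integral_tensor_herm_inner sq_integrable_hcoef)
qed

lemma hcoef_proj: "AE y in lborel. hcoef j (rep_L2 (proj k u)) y = (if j = k then hcoef k (rep_L2 u) y else 0)"
proof -
  have s: "sq_integrable (tensor_herm k (hcoef k (rep_L2 u)))"
    by (intro sq_integrable_tensor_herm sq_integrable_hcoef) simp
  have "AE y in lborel. hcoef j (rep_L2 (proj k u)) y = hcoef j (tensor_herm k (hcoef k (rep_L2 u))) y"
    by (rule hcoef_cong[OF _ _ rep_proj]) (use s in \<open>auto simp: sq_integrable_def\<close>)
  then show ?thesis by (simp add: hcoef_tensor)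
qed

lemma proj_eqI:
  assumes "AE y in lborel. hcoef k (rep_L2 u) y = c y"
  shows "AE z in lborel. rep_L2 (proj k u) z = tensor_herm k c z"
  using rep_proj[of k u] AE_snd[OF assms] by eventually_elim (simp add: tensor_herm_def)

lemma proj_eq_iff: "proj k u = proj k w \<longleftrightarrow> (AE y in lborel. hcoef k (rep_L2 u) y = hcoef k (rep_L2 w) y)"
proof
  assume E: "proj k u = proj k w"
  show "AE y in lborel. hcoef k (rep_L2 u) y = hcoef k (rep_L2 w) y"
    using hcoef_proj[of k k u] hcoef_proj[of k k w] unfolding E by eventually_elim simp
next
  assume eq: "AE y in lborel. hcoef k (rep_L2 u) y = hcoef k (rep_L2 w) y"
  show "proj k u = proj k w"
  proof (rule L2_eqI)
    show "AE z in lborel. rep_L2 (proj k u) z = rep_L2 (proj k w) z"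
      using proj_eqI[OF eq] rep_proj[of k w] by eventually_elim simp
  qed
qed

lemma norm_proj: "(norm (proj k u))\<^sup>2 = (LINT y|lborel. (norm (hcoef k (rep_L2 u) y))\<^sup>2)"
proof -
  have "(norm (proj k u))\<^sup>2 = (LINT y|lborel. hcoef k (rep_L2 u) y \<bullet> hcoef k (rep_L2 (proj k u)) y)"
    unfolding power2_norm_eq_inner by (rule proj_inner)
  also have "\<dots> = (LINT y|lborel. (norm (hcoef k (rep_L2 u) y))\<^sup>2)"
  proof (rule integral_cong_AE)
    have [measurable]: "hcoef k (rep_L2 w) \<in> borel_measurable borel" for w
      by (rule hcoef_measurable) simp
    show "(\<lambda>y. hcoef k (rep_L2 u) y \<bullet> hcoef k (rep_L2 (proj k u)) y) \<in> borel_measurable lborel"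
      "(\<lambda>y. (norm (hcoef k (rep_L2 u) y))\<^sup>2) \<in> borel_measurable lborel"
      by measurable
  qed (use hcoef_proj[of k k u] in \<open>auto elim!: eventually_mono simp: power2_norm_eq_inner\<close>)
  finally show ?thesis .
qed

lemma hcoef_scaleC: "AE y in lborel. hcoef k (rep_L2 (c *\<^sub>C u)) y = c * hcoef k (rep_L2 u) y"
  using hcoef_cong[OF _ _ rep_scaleC[of c u], of k] by (simp add: hcoef_cmult)

lemma hcoef_plus: "AE y in lborel. hcoef k (rep_L2 (u + v)) y = hcoef k (rep_L2 u) y + hcoef k (rep_L2 v) y"
proof -
  have "AE y in lborel. hcoef k (rep_L2 (u + v)) y = hcoef k (\<lambda>z. rep_L2 u z + rep_L2 v z) y"
    by (rule hcoef_cong[OF _ _ rep_add]) measurable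
  moreover have "AE y in lborel. hcoef k (\<lambda>z. rep_L2 u z + rep_L2 v z) y = hcoef k (rep_L2 u) y + hcoef k (rep_L2 v) y"
    by (rule hcoef_add) simp_all
  ultimately show ?thesis by eventually_elim simp
qed

text \<open>Self-adjointness is the symmetry of \<open>proj_inner\<close> in its two arguments. For
  totality, a vanishing projection kills one coefficient function a.e.; countably many modes share a
  null set of y, and \<open>hermite_total\<close> applies on the remaining lines.\<close>

sublocale plane: spectral_family proj energy
proof
  fix u v :: "(real \<times> real) L2" and j k :: nat and c :: complex
  show "proj k (u + v) = proj k u + proj k v"
  proof (rule L2_eqI)
    show "AE z in lborel. rep_L2 (proj k (u + v)) z = rep_L2 (proj k u + proj k v) z"
      using proj_eqI[OF hcoef_plus[of k u v]] rep_add[of "proj k u" "proj k v"] rep_proj[of k u] rep_proj[of k v]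
      by eventually_elim (simp add: tensor_herm_def scaleR_add_right)
  qed
  show "proj k (c *\<^sub>C u) = c *\<^sub>C proj k u"
  proof (rule L2_eqI)
    show "AE z in lborel. rep_L2 (proj k (c *\<^sub>C u)) z = rep_L2 (c *\<^sub>C proj k u) z"
      using proj_eqI[OF hcoef_scaleC[of k c u]] rep_scaleC[of c "proj k u"] rep_proj[of k u]
      by eventually_elim (simp add: tensor_herm_def)
  qed
  show "proj k u \<bullet> v = u \<bullet> proj k v"
    by (simp add: proj_inner inner_commute[of u])
       (simp add: inner_commute)
  show "proj j (proj k u) = (if j = k then proj k u else 0)"
  proof (rule L2_eqI)
    show "AE z in lborel. rep_L2 (proj j (proj k u)) z = rep_L2 (if j = k then proj k u else 0) z"
      using proj_eqI[OF hcoef_proj[of j k u]] rep_proj[of k u] rep_zero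
      by eventually_elim (auto simp: tensor_herm_def)
  qed
next
  fix u :: "(real \<times> real) L2" assume z: "\<And>k. proj k u = 0"
  have "AE y in lborel. hcoef k (rep_L2 u) y = 0" for k
  proof -
    have "(LINT y|lborel. (norm (hcoef k (rep_L2 u) y))\<^sup>2) = 0" using norm_proj[of k u] z by simp
    moreover have i: "integrable lborel (\<lambda>y. (norm (hcoef k (rep_L2 u) y))\<^sup>2)"
      using sq_integrable_hcoef[OF sq_integrable_rep, of k u] by (simp add: sq_integrable_def)
    ultimately have "AE y in lborel. (norm (hcoef k (rep_L2 u) y))\<^sup>2 = 0"
      using integral_nonneg_eq_0_iff_AE[OF i] by simp
    then show ?thesis by eventually_elim simp
  qed
  then have "AE y in lborel. \<forall>k. hcoef k (rep_L2 u) y = 0" by (simp add: AE_all_countable)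
  then have "AE y in lborel. AE x in lborel. rep_L2 u (x, y) = 0"
    using gauss_integrable_section[OF gauss_integrable_rep[of u]]
  proof eventually_elim
    case (elim y)
    then show ?case by (intro hermite_total) (simp_all add: hcoef_def)
  qed
  then have "AE z in lborel. rep_L2 u z = 0"
    by (intro AE_planeI) measurable
  then show "u = 0"
  proof (intro L2_eqI)
    assume "AE z in lborel. rep_L2 u z = 0"
    then show "AE z in lborel. rep_L2 u z = rep_L2 0 z"
      using rep_zero by eventually_elim simp
  qed
qed

section \<open>Agreement of the distributional and the spectral domain of H\<close>

text \<open>Integration against g(y) turns the equation on the plane into a weak oscillator equation
  in x for \<open>ug\<close> and \<open>vg\<close>, which relates their Hermite coefficients. The
  arbitrary g is then removed by the fundamental lemma in y.\<close>

lemma H_plane_imp_proj: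
  assumes H: "H_plane b u v"
  shows "proj k v = energy k *\<^sub>R proj k u"
proof -
  let ?u = "rep_L2 u" and ?v = "rep_L2 v"
  note gi = gauss_integrable_rep
  have sec: "(LINT y|lborel. g y *\<^sub>R hcoef k ?v y) = (LINT y|lborel. g y *\<^sub>R (energy k *\<^sub>R hcoef k ?u y))"
    if g: "test_function g" for g
  proof -
    note gg = gauss_bounded_test[OF g]
    define ug where "ug x = (LINT y|lborel. g y *\<^sub>R ?u (x, y))" for x
    define vg where "vg x = (LINT y|lborel. g y *\<^sub>R ?v (x, y))" for x
    have "(LINT x|lborel. herm k x *\<^sub>R vg x) = energy k *\<^sub>R (LINT x|lborel. herm k x *\<^sub>R ug x)"
    proof (rule weak_oscillator_line)
      show "gauss_integrable ug" "gauss_integrable vg"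
        unfolding ug_def vg_def by (rule partial_integral_fst(1)[OF gi gg])+
      fix f :: "real \<Rightarrow> real" assume f: "test_function f"
      note f' = test_function_deriv(1)[OF f]
      note f'' = test_function_deriv(1)[OF f']
      define \<phi> where "\<phi> x = - (1/2) * deriv (deriv f) x + (1/2) * b\<^sup>2 * x\<^sup>2 * f x" for x
      have \<phi>: "gauss_bounded \<phi>"
      proof -
        have "C_k m (\<lambda>x::real. x)" for m
        proof (cases m)
          case (Suc i)
          show ?thesis unfolding Suc by (rule C_k_realI[where f' = "\<lambda>_. 1"]) (auto intro: C_k_const)
        qed auto
        then have "test_function (\<lambda>x. (x * x) * f x)"
          by (intro test_function_mult_smooth f C_k_mult)
        then have "gauss_bounded (\<lambda>x. - (1/2) * deriv (deriv f) x + (1/2) * b\<^sup>2 * ((x * x) * f x))"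
          by (intro gauss_bounded_add gauss_bounded_cmult gauss_bounded_test f'')
        then show ?thesis by (simp add: \<phi>_def[abs_def] power2_eq_square mult.assoc)
      qed
      have Hf: "- (1/2) * dir_deriv (1, 0) (dir_deriv (1, 0) (\<lambda>z. f (fst z) * g (snd z))) z
          + (1/2) * b\<^sup>2 * (z \<bullet> (1, 0))\<^sup>2 * (f (fst z) * g (snd z)) = \<phi> (fst z) * g (snd z)" for z
        unfolding dir_deriv_tensor(1)[OF f] dir_deriv_tensor(1)[OF f']
        by (cases z) (simp add: \<phi>_def algebra_simps)
      have "(LINT x|lborel. \<phi> x *\<^sub>R ug x) = (LINT z|lborel. (\<phi> (fst z) * g (snd z)) *\<^sub>R ?u z)"
        unfolding ug_def by (rule partial_integral_fst(2)[OF gi gg \<phi>])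
      also have "\<dots> = (LINT z|lborel. (f (fst z) * g (snd z)) *\<^sub>R ?v z)"
        using H[unfolded harm_osc_def, rule_format, OF test_function_tensor[OF f g]] unfolding Hf .
      also have "\<dots> = (LINT x|lborel. f x *\<^sub>R vg x)"
        unfolding vg_def by (rule partial_integral_fst(2)[OF gi gg gauss_bounded_test[OF f], symmetric])
      finally show "(LINT x|lborel. (- (1/2) * deriv (deriv f) x + (1/2) * b\<^sup>2 * x\<^sup>2 * f x) *\<^sub>R ug x)
          = (LINT x|lborel. f x *\<^sub>R vg x)" unfolding \<phi>_def .
    qed
    then have "(LINT y|lborel. g y *\<^sub>R hcoef k ?v y) = energy k *\<^sub>R (LINT y|lborel. g y *\<^sub>R hcoef k ?u y)"
      unfolding ug_def vg_def hcoef_def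
      by (simp add: partial_integral_fst(2) partial_integral_snd(2) gi gg gauss_bounded_herm)
    also have "\<dots> = (LINT y|lborel. g y *\<^sub>R (energy k *\<^sub>R hcoef k ?u y))"
      unfolding integral_scaleR_right[symmetric] by (simp add: mult.commute)
    finally show ?thesis .
  qed
  have gh: "gauss_integrable (hcoef k (rep_L2 w))" for w
    by (rule gauss_integrable_sq_line) (auto intro: sq_integrable_hcoef)
  have ge: "gauss_integrable (\<lambda>y. energy k *\<^sub>R hcoef k ?u y)"
    unfolding scaleR_conv_of_real by (rule gauss_integrable_cmult[OF gh])
  have "AE y in lborel. hcoef k ?v y - energy k *\<^sub>R hcoef k ?u y = 0"
  proof (rule fundamental_lemma_line)
    show "gauss_integrable (\<lambda>y. hcoef k ?v y - energy k *\<^sub>R hcoef k ?u y)"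
      by (rule gauss_integrable_diff[OF gh ge])
    show "(LINT y|lborel. g y *\<^sub>R (hcoef k ?v y - energy k *\<^sub>R hcoef k ?u y)) = 0" if g: "test_function g" for g
      unfolding scaleR_diff_right
      by (subst Bochner_Integration.integral_diff[OF gauss_integrable_test[OF gh g] gauss_integrable_test[OF ge g]])
         (simp only: sec[OF g] diff_self)
  qed
  then have "proj k v = proj k (of_real (energy k) *\<^sub>C u)"
    unfolding proj_eq_iff using hcoef_scaleC[of k "of_real (energy k)" u]
    by eventually_elim (simp add: scaleR_conv_of_real)
  then show ?thesis by (simp add: plane.P_scaleC scaleR_eq_scaleC)
qed

lemma integrable_pg: "integrable lborel (pg p)"
  unfolding pg_def using b_pos by (intro integrable_poly_gauss) simp

lemma pg_mult_bounded_tendsto: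
  assumes "\<And>x. \<bar>g x\<bar> \<le> C"
  shows "((\<lambda>x. pg p x * g x) \<longlongrightarrow> 0) at_top" "((\<lambda>x. pg p x * g x) \<longlongrightarrow> 0) at_bot"
proof -
  have "((\<lambda>x. norm (pg p x) * C) \<longlongrightarrow> 0) at_top" "((\<lambda>x. norm (pg p x) * C) \<longlongrightarrow> 0) at_bot"
    unfolding pg_def using b_pos by (intro tendsto_mult_left_zero tendsto_norm_zero poly_gauss_tendsto_0; simp)+
  moreover have le: "\<forall>x. norm (pg p x * g x) \<le> norm (pg p x) * C"
    using assms by (auto simp: abs_mult intro: mult_left_mono)
  ultimately show "((\<lambda>x. pg p x * g x) \<longlongrightarrow> 0) at_top" "((\<lambda>x. pg p x * g x) \<longlongrightarrow> 0) at_bot"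
    using Lim_null_comparison[OF always_eventually[OF le]] by auto
qed

lemma integrable_pg_mult_bounded:
  assumes "\<And>x. \<bar>g x\<bar> \<le> C" and [measurable]: "g \<in> borel_measurable borel"
  shows "integrable lborel (\<lambda>x. pg p x * g x)"
proof (rule Bochner_Integration.integrable_bound)
  show "integrable lborel (\<lambda>x. C * pg p x)" by (intro integrable_mult_right integrable_pg)
  have "\<bar>pg p x\<bar> * \<bar>g x\<bar> \<le> \<bar>C\<bar> * \<bar>pg p x\<bar>" for x
    using mult_left_mono[of "\<bar>g x\<bar>" "\<bar>C\<bar>" "\<bar>pg p x\<bar>"] assms(1)[of x] by (simp add: mult.commute)
  then show "AE x in lborel. norm (pg p x * g x) \<le> norm (C * pg p x)" by (simp add: abs_mult)
qed measurable

text \<open>Green's identity on a horizontal line: h f'' - h'' f is the derivative of h f' - h' f,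
  which vanishes at infinity because f and its derivatives are bounded and h decays like a
  Gaussian.\<close>

lemma herm_oscillator_by_parts:
  fixes f :: "real \<times> real \<Rightarrow> real"
  assumes f: "test_function f"
  defines "f2 \<equiv> dir_deriv (1, 0) (dir_deriv (1, 0) f)"
  shows "(LINT x|lborel. herm k x * (- (1/2) * f2 (x, y) + (1/2) * b\<^sup>2 * x\<^sup>2 * f (x, y)))
    = energy k * (LINT x|lborel. herm k x * f (x, y))"
proof -
  let ?n = "nhp k"
  define f1 where "f1 = dir_deriv (1, 0) f"
  have e: "(1, 0) \<in> (Basis :: (real \<times> real) set)" by (simp add: Basis_plane)
  have f1: "test_function f1" unfolding f1_def by (rule test_function_dir_deriv[OF f e])
  have f2: "test_function f2" unfolding f2_def using test_function_dir_deriv[OF f1 e] by (simp add: f1_def)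
  have d: "((\<lambda>x. g (x, y)) has_real_derivative dir_deriv (1, 0) g (x, y)) (at x)" if "test_function g" for g :: "real \<times> real \<Rightarrow> real" and x
    using test_function_has_dir_deriv[OF that e, of "(x, y)"] has_derivative_shift[of "\<lambda>x. g (x, y)" x] by simp
  have cont: "isCont (\<lambda>x. g (x, y)) x" if "test_function g" for g :: "real \<times> real \<Rightarrow> real" and x
    using d[OF that] DERIV_isCont by blast
  have bd: "\<exists>C. \<forall>x. \<bar>g (x, y)\<bar> \<le> C" if "test_function g" for g :: "real \<times> real \<Rightarrow> real"
    using test_function_bounded[OF that] by metis
  have meas: "(\<lambda>x. g (x, y)) \<in> borel_measurable borel" if "test_function g" for g :: "real \<times> real \<Rightarrow> real"
    by (intro borel_measurable_continuous_onI) (simp add: continuous_on_eq_continuous_at cont[OF that])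
  have int: "integrable lborel (\<lambda>x. pg p x * g (x, y))" if tg: "test_function g" for g :: "real \<times> real \<Rightarrow> real" and p
  proof -
    obtain C where "\<forall>x. \<bar>g (x, y)\<bar> \<le> C" using bd[OF tg] ..
    then show ?thesis by (intro integrable_pg_mult_bounded[of _ C] meas tg) blast
  qed
  have lim: "((\<lambda>x. pg p x * g (x, y)) \<longlongrightarrow> 0) at_top" "((\<lambda>x. pg p x * g (x, y)) \<longlongrightarrow> 0) at_bot" if tg: "test_function g" for g :: "real \<times> real \<Rightarrow> real" and p
  proof -
    obtain C where C: "\<forall>x. \<bar>g (x, y)\<bar> \<le> C" using bd[OF tg] ..
    show "((\<lambda>x. pg p x * g (x, y)) \<longlongrightarrow> 0) at_top" "((\<lambda>x. pg p x * g (x, y)) \<longlongrightarrow> 0) at_bot"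
      using pg_mult_bounded_tendsto[of "\<lambda>x. g (x, y)" C p] C by auto
  qed
  have "(LINT x|lborel. pg ?n x * f2 (x, y) - pg (D (D ?n)) x * f (x, y)) = 0"
  proof (rule integral_derivative_line(1))
    show "((\<lambda>x. pg ?n x * f1 (x, y) - pg (D ?n) x * f (x, y)) has_real_derivative
        pg ?n x * f2 (x, y) - pg (D (D ?n)) x * f (x, y)) (at x)" for x
      using DERIV_diff[OF DERIV_mult[OF pg_deriv[of ?n x] d[OF f1]] DERIV_mult[OF pg_deriv[of "D ?n" x] d[OF f]]]
      by (simp add: f1_def f2_def algebra_simps)
    show "isCont (\<lambda>x. pg ?n x * f2 (x, y) - pg (D (D ?n)) x * f (x, y)) x" for x
      by (intro continuous_intros isCont_pg cont f f2)
    show "integrable lborel (\<lambda>x. pg ?n x * f2 (x, y) - pg (D (D ?n)) x * f (x, y))"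
      by (intro Bochner_Integration.integrable_diff int f f2)
    show "((\<lambda>x. pg ?n x * f1 (x, y) - pg (D ?n) x * f (x, y)) \<longlongrightarrow> 0) at_top"
      using tendsto_diff[OF lim(1)[OF f1] lim(1)[OF f]] by simp
    show "((\<lambda>x. pg ?n x * f1 (x, y) - pg (D ?n) x * f (x, y)) \<longlongrightarrow> 0) at_bot"
      using tendsto_diff[OF lim(2)[OF f1] lim(2)[OF f]] by simp
  qed
  then have parts: "(LINT x|lborel. pg ?n x * f2 (x, y)) = (LINT x|lborel. pg (D (D ?n)) x * f (x, y))"
    by (simp add: int f f2)
  have "herm k x * (- (1/2) * f2 (x, y) + (1/2) * b\<^sup>2 * x\<^sup>2 * f (x, y))
      = - (1/2) * (pg ?n x * f2 (x, y)) + pg (smult (1/2) ([:0, 0, b\<^sup>2:] * ?n)) x * f (x, y)" for x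
    by (simp add: herm_def pg_def algebra_simps power2_eq_square)
  then have "(LINT x|lborel. herm k x * (- (1/2) * f2 (x, y) + (1/2) * b\<^sup>2 * x\<^sup>2 * f (x, y)))
      = - (1/2) * (LINT x|lborel. pg (D (D ?n)) x * f (x, y)) + (LINT x|lborel. pg (smult (1/2) ([:0, 0, b\<^sup>2:] * ?n)) x * f (x, y))"
    using parts by (simp only:) (subst Bochner_Integration.integral_add; (intro integrable_mult_right int f f2)?; simp)
  also have "\<dots> = (LINT x|lborel. - (1/2) * (pg (D (D ?n)) x * f (x, y)) + pg (smult (1/2) ([:0, 0, b\<^sup>2:] * ?n)) x * f (x, y))"
    by (subst Bochner_Integration.integral_add) (auto intro!: integrable_mult_right int f simp del: mult_pCons_left)
  also have "\<dots> = (LINT x|lborel. energy k * (herm k x * f (x, y)))"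
  proof (rule Bochner_Integration.integral_cong[OF refl])
    fix x
    have "- (1/2) * pg (D (D ?n)) x + pg (smult (1/2) ([:0, 0, b\<^sup>2:] * ?n)) x = pg (L ?n) x"
      by (simp add: L_def pg_def algebra_simps)
    also have "\<dots> = energy k * herm k x" by (simp add: L_nhp pg_simps herm_def)
    finally show "- (1/2) * (pg (D (D ?n)) x * f (x, y)) + pg (smult (1/2) ([:0, 0, b\<^sup>2:] * ?n)) x * f (x, y)
        = energy k * (herm k x * f (x, y))"
      unfolding mult.assoc[symmetric] distrib_right[symmetric] by simp
  qed
  finally show ?thesis by simp
qed

lemma hcoef_of_real: "hcoef k (\<lambda>z. complex_of_real (g z)) y = complex_of_real (LINT x|lborel. herm k x * g (x, y))"
  by (simp add: hcoef_def scaleR_conv_of_real flip: of_real_mult)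

text \<open>A test function f on the plane need not be a product, so f and Hf are expanded in modes:
  their coefficients differ by the factor \<open>energy k\<close>, and Parseval's identity moves
  this factor onto u, where it produces v.\<close>

lemma proj_imp_H_plane:
  assumes P: "\<And>k. proj k v = energy k *\<^sub>R proj k u"
  shows "H_plane b u v"
  unfolding harm_osc_def
proof (intro allI impI)
  fix f :: "real \<times> real \<Rightarrow> real" assume f: "test_function f"
  define Hf where "Hf z = - (1/2) * dir_deriv (1, 0) (dir_deriv (1, 0) f) z + (1/2) * b\<^sup>2 * (z \<bullet> (1, 0))\<^sup>2 * f z" for z
  have e: "(1, 0) \<in> (Basis :: (real \<times> real) set)" by (simp add: Basis_plane)
  have "C_k m (\<lambda>x::real. x)" for m
  proof (cases m)
    case (Suc i)
    show ?thesis unfolding Suc by (rule C_k_realI[where f' = "\<lambda>_. 1"]) (auto intro: C_k_const)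
  qed auto
  then have x2: "test_function (\<lambda>z::real \<times> real. (fst z * fst z) * f z)"
    by (intro test_function_mult_smooth f C_k_mult C_k_fst)
  have sf: "sq_integrable (\<lambda>z. complex_of_real (f z))" by (rule sq_integrable_test_plane[OF f])
  have sHf: "sq_integrable (\<lambda>z. complex_of_real (Hf z))"
  proof -
    have "sq_integrable (\<lambda>z. complex_of_real (- (1/2)) * complex_of_real (dir_deriv (1, 0) (dir_deriv (1, 0) f) z)
        + complex_of_real ((1/2) * b\<^sup>2) * complex_of_real ((fst z * fst z) * f z))"
      by (intro sq_integrable_add sq_integrable_mult sq_integrable_test_plane x2 test_function_dir_deriv f e)
    then show ?thesis unfolding Hf_def by (simp add: inner_prod_def power2_eq_square mult_ac)
  qed
  have hc: "hcoef k (\<lambda>z. complex_of_real (Hf z)) y = energy k *\<^sub>R hcoef k (\<lambda>z. complex_of_real (f z)) y" for k y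
    unfolding hcoef_of_real Hf_def using herm_oscillator_by_parts[OF f, of k y]
    by (simp add: scaleR_conv_of_real)
  define X Y where "X = to_L2 (\<lambda>z. complex_of_real (Hf z))" and "Y = to_L2 (\<lambda>z. complex_of_real (f z))"
  have PX: "proj k X = energy k *\<^sub>R proj k Y" for k
  proof -
    have mf: "(\<lambda>z. complex_of_real (f z)) \<in> borel_measurable borel" "(\<lambda>z. complex_of_real (Hf z)) \<in> borel_measurable borel"
      using sf sHf by (auto simp: sq_integrable_def)
    have "proj k X = proj k (of_real (energy k) *\<^sub>C Y)"
      unfolding proj_eq_iff
      using hcoef_scaleC[of k "of_real (energy k)" Y] hcoef_cong[OF measurable_rep mf(1) rep_to_L2[OF sf], of k]
        hcoef_cong[OF measurable_rep mf(2) rep_to_L2[OF sHf], of k]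
      by eventually_elim (simp add: hc scaleR_conv_of_real X_def Y_def)
    then show ?thesis by (simp add: plane.P_scaleC scaleR_eq_scaleC)
  qed
  \<comment> \<open>The inner product is real valued; only with all complex multiples c does it
    determine the complex integral.\<close>
  have inner_eq: "(c *\<^sub>C X) \<bullet> u = (c *\<^sub>C Y) \<bullet> v" for c
  proof -
    have "proj k (c *\<^sub>C X) \<bullet> proj k u = proj k (c *\<^sub>C Y) \<bullet> proj k v" for k
      by (simp add: plane.P_scaleC PX P scaleC_scaleR)
    then show ?thesis
      using plane.inner_sums[of "c *\<^sub>C X" u] plane.inner_sums[of "c *\<^sub>C Y" v] by (simp add: sums_iff)
  qed
  have expand: "(c *\<^sub>C to_L2 (\<lambda>z. complex_of_real (g z))) \<bullet> w = c \<bullet> (LINT z|lborel. g z *\<^sub>R rep_L2 w z)"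
    if g: "sq_integrable (\<lambda>z. complex_of_real (g z))" for c w and g :: "real \<times> real \<Rightarrow> real"
  proof -
    have i: "integrable lborel (\<lambda>z. g z *\<^sub>R rep_L2 w z)"
      using Cauchy_Schwarz_integral(1)[OF g sq_integrable_rep[of w]] by (simp add: scaleR_conv_of_real)
    have m: "(\<lambda>z. complex_of_real (g z)) \<in> borel_measurable borel" using g by (simp add: sq_integrable_def)
    have "(c *\<^sub>C to_L2 (\<lambda>z. complex_of_real (g z))) \<bullet> w = (LINT z|lborel. (c * complex_of_real (g z)) \<bullet> rep_L2 w z)"
    proof (rule inner_L2_cong)
      show "AE z in lborel. rep_L2 (c *\<^sub>C to_L2 (\<lambda>z. complex_of_real (g z))) z = c * complex_of_real (g z)"
        using rep_scaleC[of c "to_L2 (\<lambda>z. complex_of_real (g z))"] rep_to_L2[OF g] by eventually_elim simp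
    qed (use m in auto)
    also have "\<dots> = (LINT z|lborel. c \<bullet> (g z *\<^sub>R rep_L2 w z))"
      by (simp add: inner_complex_def algebra_simps)
    also have "\<dots> = c \<bullet> (LINT z|lborel. g z *\<^sub>R rep_L2 w z)" using i by (intro integral_inner_right) simp
    finally show ?thesis .
  qed
  have "c \<bullet> (LINT z|lborel. Hf z *\<^sub>R rep_L2 u z) = c \<bullet> (LINT z|lborel. f z *\<^sub>R rep_L2 v z)" for c
    using inner_eq[of c] expand[OF sHf, of c u] expand[OF sf, of c v] by (simp add: X_def Y_def)
  then have "(LINT z|lborel. Hf z *\<^sub>R rep_L2 u z) = (LINT z|lborel. f z *\<^sub>R rep_L2 v z)"
    by (metis vector_eq_ldot)
  then show "(LINT z|lborel. (- (1/2) * dir_deriv (1, 0) (dir_deriv (1, 0) f) z + (1/2) * b\<^sup>2 * (z \<bullet> (1, 0))\<^sup>2 * f z) *\<^sub>R rep_L2 u z)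
      = (LINT z|lborel. f z *\<^sub>R rep_L2 v z)" unfolding Hf_def .
qed

theorem H_plane_iff: "H_plane b u v \<longleftrightarrow> (\<forall>k. proj k v = energy k *\<^sub>R proj k u)"
  using H_plane_imp_proj proj_imp_H_plane by blast

theorem exp_group_H_plane: "exp_group (H_plane b) = plane.U"
  by (rule plane.exp_group_eq) (rule H_plane_iff)

end

section \<open>Representation through a fundamental solution\<close>

lemma has_bochner_integral_exp_abs:
  assumes a: "a > 0"
  shows "has_bochner_integral lborel (\<lambda>x::real. exp (- a * \<bar>x\<bar>)) (2 / a)"
proof -
  have "has_bochner_integral lborel (\<lambda>x::real. exp (- x) * indicator {0..} x) 1"
    using nn_intergal_power_times_exp_Ici[of 0]
    by (intro has_bochner_integral_nn_integral) (auto simp: ennreal_mult' simp flip: ennreal_indicator)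
  then have "has_bochner_integral lborel (\<lambda>x. exp (- (0 + a * x)) * indicator {0..} (0 + a * x)) (1 /\<^sub>R \<bar>a\<bar>)"
    using a by (subst (asm) lborel_has_bochner_integral_real_affine_iff[where c = a and t = 0]) auto
  moreover have "exp (- (0 + a * x)) * indicator {0..} (0 + a * x) = indicator {0..} x *\<^sub>R exp (- a * \<bar>x\<bar>)" for x
    using a by (auto simp: indicator_def zero_le_mult_iff)
  ultimately have "has_bochner_integral lborel (\<lambda>x. indicator {0..} x *\<^sub>R exp (- a * \<bar>x\<bar>)) (1 / a)"
    using a by (simp add: inverse_eq_divide)
  then have "has_bochner_integral lborel (\<lambda>x. exp (- a * \<bar>x\<bar>)) (2 *\<^sub>R (1 / a))"
    by (rule has_bochner_integral_even_function) simp
  then show ?thesis by simp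
qed

text \<open>The decaying fundamental solution of \<kappa>^2 - d^2/ds^2 on the line. The parameter is
  kept so that it can be matched to the energy of a mode.\<close>

definition ekernel :: "real \<Rightarrow> real \<Rightarrow> real" where
  "ekernel \<kappa> s = exp (- \<kappa> * \<bar>s\<bar>) / (2 * \<kappa>)"

lemma ekernel_measurable [measurable]: "ekernel \<kappa> \<in> borel_measurable borel"
  unfolding ekernel_def by measurable

lemma ekernel_nonneg: "\<kappa> > 0 \<Longrightarrow> ekernel \<kappa> s \<ge> 0"
  by (simp add: ekernel_def)

lemma integrable_ekernel: "\<kappa> > 0 \<Longrightarrow> integrable lborel (ekernel \<kappa>)"
  using has_bochner_integral_exp_abs[of \<kappa>] by (auto simp: ekernel_def[abs_def] has_bochner_integral_iff)

lemma ekernel_sq: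
  assumes "\<kappa> > 0"
  shows "integrable lborel (\<lambda>s. (ekernel \<kappa> s)\<^sup>2)" "(LINT s|lborel. (ekernel \<kappa> s)\<^sup>2) = 1 / (4 * \<kappa> ^ 3)"
proof -
  have eq: "(ekernel \<kappa> s)\<^sup>2 = exp (- (2 * \<kappa>) * \<bar>s\<bar>) / (4 * \<kappa>\<^sup>2)" for s
    unfolding ekernel_def power_divide by (simp add: power2_eq_square flip: exp_add)
  have "has_bochner_integral lborel (\<lambda>s. (ekernel \<kappa> s)\<^sup>2) (2 / (2 * \<kappa>) / (4 * \<kappa>\<^sup>2))"
    unfolding eq using assms by (intro has_bochner_integral_divide_zero has_bochner_integral_exp_abs) simp
  then show "integrable lborel (\<lambda>s. (ekernel \<kappa> s)\<^sup>2)" "(LINT s|lborel. (ekernel \<kappa> s)\<^sup>2) = 1 / (4 * \<kappa> ^ 3)"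
    using assms by (simp_all add: has_bochner_integral_iff power2_eq_square power3_eq_cube)
qed

text \<open>On each half-line the integrand has an explicit primitive, an exponential times a
  combination of g and g'. The two boundary values at 0 add up to \<open>g 0\<close>, the terms in
  g' cancelling.\<close>

lemma ekernel_fundamental:
  assumes k: "\<kappa> > 0" and g: "test_function g"
  shows "(LINT w|lborel. ekernel \<kappa> w * (\<kappa>\<^sup>2 * g w - deriv (deriv g) w)) = g 0"
proof -
  note g' = test_function_deriv[OF g]
  note g'' = test_function_deriv[OF g'(1)]
  have [measurable]: "g \<in> borel_measurable borel" "deriv (deriv g) \<in> borel_measurable borel"
    by (intro test_function_measurable g g'')+
  have cont: "isCont h x" if "test_function h" for h :: "real \<Rightarrow> real" and x
    using test_function_continuous[OF that] by (simp add: continuous_on_eq_continuous_at)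
  obtain R0 where R0: "\<And>w. g w \<noteq> 0 \<Longrightarrow> norm w \<le> R0" using test_function_bounded[OF g] by metis
  obtain R1 where R1: "\<And>w. deriv g w \<noteq> 0 \<Longrightarrow> norm w \<le> R1" using test_function_bounded[OF g'(1)] by metis
  obtain R2 where R2: "\<And>w. deriv (deriv g) w \<noteq> 0 \<Longrightarrow> norm w \<le> R2" using test_function_bounded[OF g''(1)] by metis
  \<comment> \<open>From |w| = R on, g and its first two derivatives vanish, so the outer boundary
    terms drop out.\<close>
  define R where "R = \<bar>R0\<bar> + \<bar>R1\<bar> + \<bar>R2\<bar> + 1"
  have Rp: "R > 0" by (simp add: R_def)
  have z: "g w = 0" "deriv g w = 0" "deriv (deriv g) w = 0" if "\<bar>w\<bar> \<ge> R" for w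
    using R0[of w] R1[of w] R2[of w] that by (force simp: R_def)+
  let ?q = "\<lambda>w. \<kappa>\<^sup>2 * g w - deriv (deriv g) w"
  have "has_bochner_integral lborel (\<lambda>w. (exp (- \<kappa> * w) / (2 * \<kappa>) * ?q w) * indicator {0..R} w)
      (- exp (- \<kappa> * R) * (\<kappa> * g R + deriv g R) / (2 * \<kappa>) - - exp (- \<kappa> * 0) * (\<kappa> * g 0 + deriv g 0) / (2 * \<kappa>))"
    using Rp k
    by (intro has_bochner_integral_FTC_Icc_real)
       (auto intro!: derivative_eq_intros g'(2) g''(2) continuous_intros cont[OF g] cont[OF g''(1)] simp: field_simps power2_eq_square)
  moreover have "- exp (- \<kappa> * R) * (\<kappa> * g R + deriv g R) / (2 * \<kappa>) - - exp (- \<kappa> * 0) * (\<kappa> * g 0 + deriv g 0) / (2 * \<kappa>)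
      = (\<kappa> * g 0 + deriv g 0) / (2 * \<kappa>)" using z[of R] Rp k by (simp add: field_simps)
  ultimately have 1: "has_bochner_integral lborel (\<lambda>w. (exp (- \<kappa> * w) / (2 * \<kappa>) * ?q w) * indicator {0..R} w)
      ((\<kappa> * g 0 + deriv g 0) / (2 * \<kappa>))"
    by (simp only:)
  have "has_bochner_integral lborel (\<lambda>w. (exp (\<kappa> * w) / (2 * \<kappa>) * ?q w) * indicator {-R..0} w)
      (exp (\<kappa> * 0) * (\<kappa> * g 0 - deriv g 0) / (2 * \<kappa>) - exp (\<kappa> * (-R)) * (\<kappa> * g (-R) - deriv g (-R)) / (2 * \<kappa>))"
    using Rp k
    by (intro has_bochner_integral_FTC_Icc_real)
       (auto intro!: derivative_eq_intros g'(2) g''(2) continuous_intros cont[OF g] cont[OF g''(1)] simp: field_simps power2_eq_square)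
  moreover have "exp (\<kappa> * 0) * (\<kappa> * g 0 - deriv g 0) / (2 * \<kappa>) - exp (\<kappa> * (-R)) * (\<kappa> * g (-R) - deriv g (-R)) / (2 * \<kappa>)
      = (\<kappa> * g 0 - deriv g 0) / (2 * \<kappa>)" using z[of "-R"] Rp k by (simp add: field_simps)
  ultimately have 2: "has_bochner_integral lborel (\<lambda>w. (exp (\<kappa> * w) / (2 * \<kappa>) * ?q w) * indicator {-R..0} w)
      ((\<kappa> * g 0 - deriv g 0) / (2 * \<kappa>))"
    by (simp only:)
  have "(LINT w|lborel. ekernel \<kappa> w * ?q w) = (LINT w|lborel. (exp (- \<kappa> * w) / (2 * \<kappa>) * ?q w) * indicator {0..R} w
      + (exp (\<kappa> * w) / (2 * \<kappa>) * ?q w) * indicator {-R..0} w)"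
  proof (rule integral_cong_AE)
    show "AE w in lborel. ekernel \<kappa> w * ?q w = (exp (- \<kappa> * w) / (2 * \<kappa>) * ?q w) * indicator {0..R} w
      + (exp (\<kappa> * w) / (2 * \<kappa>) * ?q w) * indicator {-R..0} w"
      using AE_lborel_singleton[of 0]
    proof eventually_elim
      case (elim w)
      consider "0 < w" "w \<le> R" | "w < 0" "- R \<le> w" | "\<bar>w\<bar> \<ge> R" using elim by linarith
      then show ?case
      proof cases
        case 3
        then show ?thesis using z[of w] by simp
      qed (simp_all add: ekernel_def)
    qed
  qed measurable
  also have "\<dots> = (\<kappa> * g 0 + deriv g 0) / (2 * \<kappa>) + (\<kappa> * g 0 - deriv g 0) / (2 * \<kappa>)"
    using has_bochner_integral_integral_eq[OF has_bochner_integral_add[OF 1 2]] .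
  also have "\<dots> = g 0" using k by (simp add: field_simps)
  finally show ?thesis .
qed

lemma integral_translate:
  fixes f :: "'a::euclidean_space \<Rightarrow> 'b::{banach, second_countable_topology}"
  assumes [measurable]: "f \<in> borel_measurable borel"
  shows "(LINT z|lborel. f (w + z)) = (LINT z|lborel. f z)" "integrable lborel f \<Longrightarrow> integrable lborel (\<lambda>z. f (w + z))"
  using integral_distr[of "(+) w" lborel borel f] integrable_distr[of "(+) w" lborel borel f]
  by (simp_all add: lborel_distr_plus)

text \<open>Transposes a representation: if f is the convolution of K with q, and every translate of
  q pairs with c as the same translate of f pairs with r, then c acts on f like the average of r(z +
  w) with weight K(w). Weak solutions thereby turn into explicit integrals, with K the kernel on the
  line or on the plane.\<close>

lemma kernel_duality:
  fixes K q f :: "'a::euclidean_space \<Rightarrow> real" and c r :: "'a \<Rightarrow> complex"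
  assumes K: "integrable lborel K"
    and [measurable]: "q \<in> borel_measurable borel" "f \<in> borel_measurable borel" "c \<in> borel_measurable borel" "r \<in> borel_measurable borel"
    and rep: "\<And>z. integrable lborel (\<lambda>w. K w * q (z - w))" "\<And>z. f z = (LINT w|lborel. K w * q (z - w))"
    and eq: "\<And>w. (LINT z|lborel. q (z - w) *\<^sub>R c z) = (LINT z|lborel. f (z - w) *\<^sub>R r z)"
    and qc: "\<And>w. integrable lborel (\<lambda>z. q (z - w) *\<^sub>R c z)" "\<And>w. (LINT z|lborel. norm (q (z - w) *\<^sub>R c z)) \<le> B"
    and fr: "\<And>w. integrable lborel (\<lambda>z. f (z - w) *\<^sub>R r z)" "\<And>w. (LINT z|lborel. norm (f (z - w) *\<^sub>R r z)) \<le> B"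
  shows "(LINT z|lborel. f z *\<^sub>R c z) = (LINT z|lborel. f z *\<^sub>R (LINT w|lborel. K w *\<^sub>R r (z + w)))"
proof -
  have [measurable]: "K \<in> borel_measurable borel" using K by (auto dest: borel_measurable_integrable)
  \<comment> \<open>Integrability of \<open>K\<close> and the bound \<open>B\<close>, uniform in w,
    on the inner integrals give absolute convergence of the double integral.\<close>
  have int: "integrable (lborel \<Otimes>\<^sub>M lborel) (\<lambda>(w, z). K w *\<^sub>R G w z)"
    if [measurable]: "(\<lambda>(w, z). G w z) \<in> borel_measurable (borel \<Otimes>\<^sub>M borel)"
      and G: "\<And>w. integrable lborel (G w)" "\<And>w. (LINT z|lborel. norm (G w z)) \<le> B" for G :: "'a \<Rightarrow> 'a \<Rightarrow> complex"
  proof (rule lborel_pair.Fubini_integrable)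
    have [measurable]: "(\<lambda>w. LINT z|lborel. norm (G w z)) \<in> borel_measurable borel" by measurable
    have B0: "B \<ge> 0" using order_trans[OF _ G(2)[of 0]] by simp
    have "integrable lborel (\<lambda>w. \<bar>K w\<bar> * (LINT z|lborel. norm (G w z)))"
    proof (rule Bochner_Integration.integrable_bound[OF integrable_mult_left[OF integrable_abs[OF K], of B]])
      show "AE w in lborel. norm (\<bar>K w\<bar> * (LINT z|lborel. norm (G w z))) \<le> norm (\<bar>K w\<bar> * B)"
        using G(2) B0 by (intro AE_I2) (auto simp: abs_mult intro!: mult_left_mono)
    qed measurable
    then show "integrable lborel (\<lambda>x. LINT y|lborel. norm (case (x, y) of (w, z) \<Rightarrow> K w *\<^sub>R G w z))"
      by simp
    show "AE x in lborel. integrable lborel (\<lambda>y. case (x, y) of (w, z) \<Rightarrow> K w *\<^sub>R G w z)"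
      using G(1) by simp
  qed measurable
  have qd: "(\<lambda>(w, z). q (z - w) *\<^sub>R c z) \<in> borel_measurable (borel \<Otimes>\<^sub>M borel)" by measurable
  have fd: "(\<lambda>(w, z). f z *\<^sub>R r (z + w)) \<in> borel_measurable (borel \<Otimes>\<^sub>M borel)" by measurable
  have shift: "(LINT z|lborel. h (f (z - w) *\<^sub>R r z)) = (LINT z|lborel. h (f z *\<^sub>R r (z + w)))"
    if [measurable]: "h \<in> borel_measurable borel" for w and h :: "complex \<Rightarrow> 'c::{banach, second_countable_topology}"
    using integral_translate(1)[of "\<lambda>z. h (f (z - w) *\<^sub>R r z)" w] by (simp add: add.commute)
  have fr': "integrable lborel (\<lambda>z. f z *\<^sub>R r (z + w))" for w
    using integral_translate(2)[OF _ fr(1)[of w], of w] by (simp add: add.commute)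
  have fr'': "(LINT z|lborel. norm (f z *\<^sub>R r (z + w))) \<le> B" for w
    using fr(2)[of w] shift[of norm w] by simp
  have "(LINT z|lborel. f z *\<^sub>R c z) = (LINT z|lborel. LINT w|lborel. K w *\<^sub>R (q (z - w) *\<^sub>R c z))"
  proof (rule Bochner_Integration.integral_cong[OF refl])
    fix z
    have "(LINT w|lborel. (K w * q (z - w)) *\<^sub>R c z) = f z *\<^sub>R c z"
      unfolding rep(2) by (rule integral_scaleR_left) (rule rep(1))
    then show "f z *\<^sub>R c z = (LINT w|lborel. K w *\<^sub>R (q (z - w) *\<^sub>R c z))" by simp
  qed
  also have "\<dots> = (LINT w|lborel. LINT z|lborel. K w *\<^sub>R (q (z - w) *\<^sub>R c z))"
    by (rule lborel_pair.Fubini_integral[OF int[OF qd qc]])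
  also have "\<dots> = (LINT w|lborel. LINT z|lborel. K w *\<^sub>R (f z *\<^sub>R r (z + w)))"
    using eq shift[of "\<lambda>x. x"] by (simp del: scaleR_scaleR)
  also have "\<dots> = (LINT z|lborel. LINT w|lborel. K w *\<^sub>R (f z *\<^sub>R r (z + w)))"
    by (rule lborel_pair.Fubini_integral[OF int[OF fd fr' fr''], symmetric])
  also have "\<dots> = (LINT z|lborel. f z *\<^sub>R (LINT w|lborel. K w *\<^sub>R r (z + w)))"
    by (simp add: mult.commute flip: integral_scaleR_right)
  finally show ?thesis .
qed

lemma deriv_affine:
  fixes f :: "real \<Rightarrow> real"
  assumes f: "test_function f"
  shows "deriv (\<lambda>x. f (a * x + c)) = (\<lambda>x. a * deriv f (a * x + c))"
    and "deriv (deriv (\<lambda>x. f (a * x + c))) = (\<lambda>x. a\<^sup>2 * deriv (deriv f) (a * x + c))"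
proof -
  have lin: "((\<lambda>x. a * x + c) has_real_derivative a) (at x)" for x
    by (auto intro!: derivative_eq_intros)
  have d: "((\<lambda>x. g (a * x + c)) has_real_derivative a * deriv g (a * x + c)) (at x)" if "test_function g" for g x
    by (rule DERIV_cong[OF DERIV_chain2[where g = "\<lambda>x. a * x + c", OF test_function_deriv(2)[OF that] lin] mult.commute])
  show 1: "deriv (\<lambda>x. f (a * x + c)) = (\<lambda>x. a * deriv f (a * x + c))"
    by (intro ext DERIV_imp_deriv d f)
  have "deriv (\<lambda>x. a * deriv f (a * x + c)) x = a\<^sup>2 * deriv (deriv f) (a * x + c)" for x
    using DERIV_cmult[OF d[OF test_function_deriv(1)[OF f]], of a x]
    by (intro DERIV_imp_deriv) (simp add: power2_eq_square mult.assoc)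
  then show "deriv (deriv (\<lambda>x. f (a * x + c))) = (\<lambda>x. a\<^sup>2 * deriv (deriv f) (a * x + c))"
    unfolding 1 by blast
qed

lemma ekernel_representation:
  assumes k: "\<kappa> > 0" and f: "test_function f"
  shows "integrable lborel (\<lambda>w. ekernel \<kappa> w * (\<kappa>\<^sup>2 * f (z - w) - deriv (deriv f) (z - w)))"
    and "f z = (LINT w|lborel. ekernel \<kappa> w * (\<kappa>\<^sup>2 * f (z - w) - deriv (deriv f) (z - w)))"
proof -
  have g: "test_function (\<lambda>w. f (- 1 * w + z))" by (rule test_function_affine[OF f]) simp
  have eq: "\<kappa>\<^sup>2 * f (z - w) - deriv (deriv f) (z - w) = \<kappa>\<^sup>2 * f (- 1 * w + z) - deriv (deriv (\<lambda>w. f (- 1 * w + z))) w" for w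
    unfolding deriv_affine(2)[OF f] by simp
  show "f z = (LINT w|lborel. ekernel \<kappa> w * (\<kappa>\<^sup>2 * f (z - w) - deriv (deriv f) (z - w)))"
    using ekernel_fundamental[OF k g] unfolding eq by simp
  have i: "integrable lborel (\<lambda>w. ekernel \<kappa> w * h w)" if h: "test_function h" for h
  proof -
    obtain C R where C: "\<And>z. \<bar>h z\<bar> \<le> C" "\<And>z. h z \<noteq> 0 \<Longrightarrow> norm z \<le> R" "C \<ge> 0" "R \<ge> 0"
      by (rule test_function_bounded[OF h]) auto
    have [measurable]: "h \<in> borel_measurable borel" by (rule test_function_measurable[OF h])
    show ?thesis
      by (rule Bochner_Integration.integrable_bound[OF integrable_mult_left[OF integrable_ekernel[OF k], of C]])
         (use C in \<open>auto simp: abs_mult intro!: AE_I2 mult_left_mono\<close>)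
  qed
  have "integrable lborel (\<lambda>w. \<kappa>\<^sup>2 * (ekernel \<kappa> w * f (- 1 * w + z)) - ekernel \<kappa> w * deriv (deriv (\<lambda>w. f (- 1 * w + z))) w)"
    by (intro Bochner_Integration.integrable_diff integrable_mult_right i g test_function_deriv)
  then show "integrable lborel (\<lambda>w. ekernel \<kappa> w * (\<kappa>\<^sup>2 * f (z - w) - deriv (deriv f) (z - w)))"
    unfolding eq by (simp add: algebra_simps)
qed

text \<open>Bounds independent of the translation w, as \<open>kernel_duality\<close> demands: here
  for two square integrable factors, in \<open>bounded_product_bound\<close> for an integrable
  factor against a bounded one.\<close>

lemma sq_product_bound:
  fixes q :: "'a::euclidean_space \<Rightarrow> real" and c :: "'a \<Rightarrow> complex"
  assumes [measurable]: "q \<in> borel_measurable borel" and q: "integrable lborel (\<lambda>z. (q z)\<^sup>2)" and c: "sq_integrable c"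
  shows "integrable lborel (\<lambda>z. q (z - w) *\<^sub>R c z)"
    and "(LINT z|lborel. norm (q (z - w) *\<^sub>R c z)) \<le> (LINT z|lborel. (q z)\<^sup>2) + (LINT z|lborel. (norm (c z))\<^sup>2)"
proof -
  have [measurable]: "c \<in> borel_measurable borel" using c by (simp add: sq_integrable_def)
  have ic: "integrable lborel (\<lambda>z. (norm (c z))\<^sup>2)" using c by (simp add: sq_integrable_def)
  have iq: "integrable lborel (\<lambda>z. (q (z - w))\<^sup>2)" and eq: "(LINT z|lborel. (q (z - w))\<^sup>2) = (LINT z|lborel. (q z)\<^sup>2)"
    using integral_translate[of "\<lambda>z. (q z)\<^sup>2" "- w"] q by simp_all
  have le: "norm (q (z - w) *\<^sub>R c z) \<le> (q (z - w))\<^sup>2 + (norm (c z))\<^sup>2" for z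
    using sum_squares_bound[of "\<bar>q (z - w)\<bar>" "norm (c z)"]
      mult_nonneg_nonneg[OF abs_ge_zero norm_ge_zero, of "q (z - w)" "c z"]
    unfolding norm_scaleR power2_abs mult.assoc by linarith
  show i: "integrable lborel (\<lambda>z. q (z - w) *\<^sub>R c z)"
    by (rule Bochner_Integration.integrable_bound[OF Bochner_Integration.integrable_add[OF iq ic]])
       (use le in \<open>auto intro!: AE_I2 simp: abs_of_nonneg\<close>)
  have "(LINT z|lborel. norm (q (z - w) *\<^sub>R c z)) \<le> (LINT z|lborel. (q (z - w))\<^sup>2 + (norm (c z))\<^sup>2)"
    by (intro integral_mono integrable_norm i Bochner_Integration.integrable_add iq ic le)
  then show "(LINT z|lborel. norm (q (z - w) *\<^sub>R c z)) \<le> (LINT z|lborel. (q z)\<^sup>2) + (LINT z|lborel. (norm (c z))\<^sup>2)"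
    using iq ic eq by simp
qed

lemma bounded_product_bound:
  fixes q :: "'a::euclidean_space \<Rightarrow> real" and c :: "'a \<Rightarrow> complex"
  assumes q: "integrable lborel q" and [measurable]: "c \<in> borel_measurable borel" and c: "AE z in lborel. norm (c z) \<le> C"
  shows "integrable lborel (\<lambda>z. q (z - w) *\<^sub>R c z)"
    and "(LINT z|lborel. norm (q (z - w) *\<^sub>R c z)) \<le> C * (LINT z|lborel. \<bar>q z\<bar>)"
proof -
  have [measurable]: "q \<in> borel_measurable borel" using q by (auto dest: borel_measurable_integrable)
  have iq: "integrable lborel (\<lambda>z. \<bar>q (z - w)\<bar>)" and eq: "(LINT z|lborel. \<bar>q (z - w)\<bar>) = (LINT z|lborel. \<bar>q z\<bar>)"
    using integral_translate[of "\<lambda>z. \<bar>q z\<bar>" "- w"] q by simp_all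
  have le: "AE z in lborel. norm (q (z - w) *\<^sub>R c z) \<le> C * \<bar>q (z - w)\<bar>"
    using c by eventually_elim (simp add: mult.commute mult_right_mono)
  show i: "integrable lborel (\<lambda>z. q (z - w) *\<^sub>R c z)"
    by (rule Bochner_Integration.integrable_bound[OF integrable_mult_right[OF iq, of C]])
       (use le in \<open>auto elim!: eventually_mono intro: order_trans[OF _ abs_ge_self]\<close>)
  have "(LINT z|lborel. norm (q (z - w) *\<^sub>R c z)) \<le> (LINT z|lborel. C * \<bar>q (z - w)\<bar>)"
    by (intro integral_mono_AE integrable_norm i integrable_mult_right iq le)
  then show "(LINT z|lborel. norm (q (z - w) *\<^sub>R c z)) \<le> C * (LINT z|lborel. \<bar>q z\<bar>)"
    using eq by simp
qed

section \<open>Boundedness of the group orbit through the modes\<close>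

context oscillator
begin

text \<open>Here c is recovered as the kernel average of r = \<kappa>^2 c - d. The constants come
  from Cauchy-Schwarz, with 1/(4 \<kappa>^3) the squared L2 norm of the kernel, and from ||r||^2 <=
  2 \<kappa>^4 ||c||^2 + 2 ||d||^2. The parameter stays free because each mode calls for its own
  value.\<close>

lemma weak_second_derivative_bound:
  fixes c d :: "real \<Rightarrow> complex"
  assumes c: "sq_integrable c" and d: "sq_integrable d" and k: "\<kappa> > 0"
    and weak: "\<And>f. test_function f \<Longrightarrow> (LINT y|lborel. deriv (deriv f) y *\<^sub>R c y) = (LINT y|lborel. f y *\<^sub>R d y)"
  shows "AE y in lborel. (norm (c y))\<^sup>2 \<le> (\<kappa> * (LINT y|lborel. (norm (c y))\<^sup>2) + (LINT y|lborel. (norm (d y))\<^sup>2) / \<kappa> ^ 3) / 2"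
proof -
  define r where "r y = of_real (\<kappa>\<^sup>2) * c y + (- 1) * d y" for y
  have r: "sq_integrable r" unfolding r_def by (intro sq_integrable_add sq_integrable_mult c d)
  define e where "e y = (LINT w|lborel. ekernel \<kappa> w *\<^sub>R r (y + w))" for y
  have [measurable]: "c \<in> borel_measurable borel" "d \<in> borel_measurable borel" "r \<in> borel_measurable borel"
    using c d r by (auto simp: sq_integrable_def)
  have ir: "integrable lborel (\<lambda>y. (norm (r y))\<^sup>2)" and ic: "integrable lborel (\<lambda>y. (norm (c y))\<^sup>2)"
    and id: "integrable lborel (\<lambda>y. (norm (d y))\<^sup>2)"
    using r c d by (auto simp: sq_integrable_def)
  have [measurable]: "e \<in> borel_measurable borel" unfolding e_def by measurable
  have e_le: "(norm (e y))\<^sup>2 \<le> 1 / (4 * \<kappa> ^ 3) * (LINT y|lborel. (norm (r y))\<^sup>2)" for y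
  proof -
    have sr: "sq_integrable (\<lambda>w. r (y + w))"
      using integral_translate(2)[of "\<lambda>y. (norm (r y))\<^sup>2" y] ir by (simp add: sq_integrable_def)
    have sK: "sq_integrable (\<lambda>w. complex_of_real (ekernel \<kappa> w))"
      using ekernel_sq(1)[OF k] by (simp add: sq_integrable_def)
    show ?thesis
      using Cauchy_Schwarz_integral(2)[OF sK sr] integral_translate(1)[of "\<lambda>y. (norm (r y))\<^sup>2" y]
      by (simp add: e_def scaleR_conv_of_real ekernel_sq(2)[OF k])
  qed
  have dual: "(LINT z|lborel. f z *\<^sub>R c z) = (LINT z|lborel. f z *\<^sub>R e z)" if f: "test_function f" for f
  proof -
    note f'' = test_function_deriv(1)[OF test_function_deriv(1)[OF f]]
    define q where "q w = \<kappa>\<^sup>2 * f w - deriv (deriv f) w" for w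
    have [measurable]: "f \<in> borel_measurable borel" "deriv (deriv f) \<in> borel_measurable borel"
      by (intro test_function_measurable f f'')+
    have [measurable]: "q \<in> borel_measurable borel" unfolding q_def by measurable
    have "gauss_bounded (\<lambda>w. \<kappa>\<^sup>2 * f w + (- 1) * deriv (deriv f) w)"
      by (intro gauss_bounded_add gauss_bounded_cmult gauss_bounded_test f f'')
    then have "gauss_bounded q" by (simp add: q_def[abs_def])
    then have q2: "integrable lborel (\<lambda>w. (q w)\<^sup>2)"
      using sq_integrable_gauss_bounded_line by (fastforce simp: sq_integrable_def)
    have f2: "integrable lborel (\<lambda>w. (f w)\<^sup>2)"
      using sq_integrable_gauss_bounded_line[OF gauss_bounded_test[OF f]] by (simp add: sq_integrable_def)
    define B where "B = (LINT z|lborel. (q z)\<^sup>2) + (LINT z|lborel. (norm (c z))\<^sup>2)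
        + ((LINT z|lborel. (f z)\<^sup>2) + (LINT z|lborel. (norm (r z))\<^sup>2))"
    have nn: "(LINT z|lborel. (q z)\<^sup>2) + (LINT z|lborel. (norm (c z))\<^sup>2) \<le> B"
      "(LINT z|lborel. (f z)\<^sup>2) + (LINT z|lborel. (norm (r z))\<^sup>2) \<le> B"
      unfolding B_def by simp_all
    show ?thesis
      unfolding e_def
    proof (rule kernel_duality)
      show "integrable lborel (\<lambda>w. ekernel \<kappa> w * q (z - w))" "f z = (LINT w|lborel. ekernel \<kappa> w * q (z - w))" for z
        unfolding q_def by (rule ekernel_representation[OF k f])+
      show "(LINT z|lborel. q (z - w) *\<^sub>R c z) = (LINT z|lborel. f (z - w) *\<^sub>R r z)" for w
      proof -
        have t: "test_function (\<lambda>z. f (1 * z + - w))" by (rule test_function_affine[OF f]) simp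
        have t'': "deriv (deriv (\<lambda>z. f (1 * z + - w))) = (\<lambda>z. deriv (deriv f) (z - w))"
          unfolding deriv_affine(2)[OF f] by simp
        have i1: "integrable lborel (\<lambda>z. f (z - w) *\<^sub>R c z)" "integrable lborel (\<lambda>z. f (z - w) *\<^sub>R d z)"
          by (intro sq_product_bound(1) f2 c d; measurable)+
        have i2: "integrable lborel (\<lambda>z. deriv (deriv f) (z - w) *\<^sub>R c z)"
          using sq_integrable_gauss_bounded_line[OF gauss_bounded_test[OF f'']]
          by (intro sq_product_bound(1) c) (auto simp: sq_integrable_def)
        have "(LINT z|lborel. q (z - w) *\<^sub>R c z) = (LINT z|lborel. \<kappa>\<^sup>2 *\<^sub>R (f (z - w) *\<^sub>R c z) - deriv (deriv f) (z - w) *\<^sub>R c z)"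
          by (simp add: q_def scaleR_diff_left)
        also have "\<dots> = (LINT z|lborel. \<kappa>\<^sup>2 *\<^sub>R (f (z - w) *\<^sub>R c z)) - (LINT z|lborel. f (z - w) *\<^sub>R d z)"
          using weak[OF t] unfolding t''
          by (subst Bochner_Integration.integral_diff[OF integrable_scaleR_right[OF i1(1)] i2]) simp
        also have "\<dots> = (LINT z|lborel. \<kappa>\<^sup>2 *\<^sub>R (f (z - w) *\<^sub>R c z) - f (z - w) *\<^sub>R d z)"
          by (rule Bochner_Integration.integral_diff[OF integrable_scaleR_right[OF i1(1)] i1(2), symmetric])
        also have "\<dots> = (LINT z|lborel. f (z - w) *\<^sub>R r z)"
          by (simp add: r_def scaleR_conv_of_real algebra_simps)
        finally show ?thesis .
      qed
      show "(LINT z|lborel. norm (q (z - w) *\<^sub>R c z)) \<le> B" for w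
        by (rule order_trans[OF sq_product_bound(2)[OF _ q2 c] nn(1)]) measurable
      show "(LINT z|lborel. norm (f (z - w) *\<^sub>R r z)) \<le> B" for w
        by (rule order_trans[OF sq_product_bound(2)[OF _ f2 r] nn(2)]) measurable
    qed (auto intro!: integrable_ekernel k sq_product_bound(1) q2 f2 c r)
  qed
  have gc: "gauss_integrable c" by (rule gauss_integrable_sq_line) (auto intro: c)
  have ge: "gauss_integrable e"
  proof (rule gauss_integrable_bounded[OF integrable_gauss_line])
    show "AE y in lborel. norm (e y) \<le> sqrt (1 / (4 * \<kappa> ^ 3) * (LINT y|lborel. (norm (r y))\<^sup>2))"
      using e_le by (intro AE_I2) (simp add: real_le_rsqrt)
  qed auto
  have ce: "AE y in lborel. c y - e y = 0"
  proof (rule fundamental_lemma_line)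
    show "gauss_integrable (\<lambda>y. c y - e y)" by (rule gauss_integrable_diff[OF gc ge])
    show "(LINT y|lborel. f y *\<^sub>R (c y - e y)) = 0" if f: "test_function f" for f
      unfolding scaleR_diff_right
      by (subst Bochner_Integration.integral_diff[OF gauss_integrable_test[OF gc f] gauss_integrable_test[OF ge f]])
         (simp only: dual[OF f] diff_self)
  qed
  have "(LINT y|lborel. (norm (r y))\<^sup>2) \<le> 2 * \<kappa> ^ 4 * (LINT y|lborel. (norm (c y))\<^sup>2) + 2 * (LINT y|lborel. (norm (d y))\<^sup>2)"
  proof -
    have "(norm (r y))\<^sup>2 \<le> 2 * \<kappa> ^ 4 * (norm (c y))\<^sup>2 + 2 * (norm (d y))\<^sup>2" for y
    proof -
      have "norm (r y) \<le> \<kappa>\<^sup>2 * norm (c y) + norm (d y)"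
        using norm_triangle_ineq[of "of_real (\<kappa>\<^sup>2) * c y" "(- 1) * d y"] by (simp add: r_def norm_mult norm_power)
      then have "(norm (r y))\<^sup>2 \<le> (\<kappa>\<^sup>2 * norm (c y) + norm (d y))\<^sup>2" by (intro power_mono) auto
      also have "\<dots> \<le> 2 * (\<kappa>\<^sup>2 * norm (c y))\<^sup>2 + 2 * (norm (d y))\<^sup>2"
        using sum_squares_bound[of "\<kappa>\<^sup>2 * norm (c y)" "norm (d y)"] by (simp add: power2_sum)
      finally show ?thesis by (simp add: power_mult_distrib flip: power_mult)
    qed
    then have "(LINT y|lborel. (norm (r y))\<^sup>2) \<le> (LINT y|lborel. 2 * \<kappa> ^ 4 * (norm (c y))\<^sup>2 + 2 * (norm (d y))\<^sup>2)"
      by (intro integral_mono ir Bochner_Integration.integrable_add integrable_mult_right ic id)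
    then show ?thesis using ic id by simp
  qed
  then have "1 / (4 * \<kappa> ^ 3) * (LINT y|lborel. (norm (r y))\<^sup>2)
      \<le> 1 / (4 * \<kappa> ^ 3) * (2 * \<kappa> ^ 4 * (LINT y|lborel. (norm (c y))\<^sup>2) + 2 * (LINT y|lborel. (norm (d y))\<^sup>2))"
    using k by (intro mult_left_mono) auto
  also have "\<dots> = (\<kappa> * (LINT y|lborel. (norm (c y))\<^sup>2) + (LINT y|lborel. (norm (d y))\<^sup>2) / \<kappa> ^ 3) / 2"
    using k by (simp add: field_simps power3_eq_cube power4_eq_xxxx)
  finally have "(norm (e y))\<^sup>2 \<le> (\<kappa> * (LINT y|lborel. (norm (c y))\<^sup>2) + (LINT y|lborel. (norm (d y))\<^sup>2) / \<kappa> ^ 3) / 2" for y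
    using e_le[of y] by (rule order_trans[rotated])
  with ce show ?thesis by (auto elim!: eventually_mono)
qed

text \<open>The hypothesis is tested with f(x) g(y). Removing f first shows that two functions of x
  agree a.e.; only then is \<open>herm k\<close> inserted, which has no compact support.\<close>

lemma dyy_hcoef:
  assumes w: "dyy u w" and g: "test_function g"
  shows "(LINT y|lborel. deriv (deriv g) y *\<^sub>R hcoef k (rep_L2 u) y) = (LINT y|lborel. g y *\<^sub>R hcoef k (rep_L2 w) y)"
proof -
  note gi = gauss_integrable_rep
  note g' = test_function_deriv(1)[OF g]
  note gg = gauss_bounded_test[OF g]
  note gg'' = gauss_bounded_test[OF test_function_deriv(1)[OF g']]
  define U V where "U x = (LINT y|lborel. deriv (deriv g) y *\<^sub>R rep_L2 u (x, y))"
    and "V x = (LINT y|lborel. g y *\<^sub>R rep_L2 w (x, y))" for x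
  have gU: "gauss_integrable U" and gV: "gauss_integrable V"
    unfolding U_def V_def by (rule partial_integral_fst(1)[OF gi gg''] partial_integral_fst(1)[OF gi gg])+
  have UV: "(LINT x|lborel. f x *\<^sub>R U x) = (LINT x|lborel. f x *\<^sub>R V x)" if f: "test_function f" for f
  proof -
    have "(LINT z|lborel. foldr dir_deriv [(0, 1), (0, 1)] (\<lambda>z. f (fst z) * g (snd z)) z *\<^sub>R rep_L2 u z)
        = (- 1) ^ length [(0::real, 1::real), (0, 1)] *\<^sub>R (LINT z|lborel. (f (fst z) * g (snd z)) *\<^sub>R rep_L2 w z)"
      using w test_function_tensor[OF f g] unfolding dyy_def weak_deriv_def by blast
    then have "(LINT z|lborel. (f (fst z) * deriv (deriv g) (snd z)) *\<^sub>R rep_L2 u z)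
        = (LINT z|lborel. (f (fst z) * g (snd z)) *\<^sub>R rep_L2 w z)"
      by (simp add: dir_deriv_tensor(2)[OF g] dir_deriv_tensor(2)[OF g'])
    then show ?thesis
      unfolding U_def V_def
        partial_integral_fst(2)[OF gi gg'' gauss_bounded_test[OF f]] partial_integral_fst(2)[OF gi gg gauss_bounded_test[OF f]] .
  qed
  have "AE x in lborel. U x - V x = 0"
  proof (rule fundamental_lemma_line)
    show "gauss_integrable (\<lambda>x. U x - V x)" by (rule gauss_integrable_diff[OF gU gV])
    show "(LINT x|lborel. f x *\<^sub>R (U x - V x)) = 0" if f: "test_function f" for f
      unfolding scaleR_diff_right
      by (subst Bochner_Integration.integral_diff[OF gauss_integrable_test[OF gU f] gauss_integrable_test[OF gV f]])
         (simp only: UV[OF f] diff_self)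
  qed
  then have "(LINT x|lborel. herm k x *\<^sub>R U x) = (LINT x|lborel. herm k x *\<^sub>R V x)"
    using gauss_integrable_measurable[OF gU] gauss_integrable_measurable[OF gV]
    by (intro integral_cong_AE) (auto elim!: eventually_mono)
  then show ?thesis
    unfolding U_def V_def hcoef_def
    by (simp only: partial_integral_fst(2)[OF gi gg'' gauss_bounded_herm] partial_integral_fst(2)[OF gi gg gauss_bounded_herm]
        partial_integral_snd(2)[OF gi gauss_bounded_herm gg''] partial_integral_snd(2)[OF gi gauss_bounded_herm gg])
qed

text \<open>
  The weights \<open>energy k\<close> are distributed by Cauchy--Schwarz: \<open>\<Sum>\<^sub>k herm k x\<^sup>2 / energy k\<close> is
  bounded, and \<open>\<Sum>\<^sub>k energy k * \<bar>hcoef k u y\<bar>\<^sup>2\<close> is controlled by choosing the free parameter of the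
  one-dimensional estimate in the \<open>k\<close>-th mode equal to \<open>energy k\<close>. Only the moduli of the
  coefficients enter, so the bound is uniform in \<open>\<theta>\<close>.
\<close>

lemma U_bounded:
  assumes v: "H_plane b u v" and w: "dyy u w"
  shows "AE z in lborel. norm (rep_L2 (plane.U \<theta> u) z) \<le> sqrt ((1 + 1 / b) * ((norm v)\<^sup>2 + 4 / b\<^sup>2 * (norm w)\<^sup>2))"
proof -
  define S where "S = ((norm v)\<^sup>2 + 4 / b\<^sup>2 * (norm w)\<^sup>2) / 2"
  let ?c = "\<lambda>k. hcoef k (rep_L2 u)"
  have mode: "AE y in lborel. energy k * (norm (?c k y))\<^sup>2 \<le> ((norm (proj k v))\<^sup>2 + 4 / b\<^sup>2 * (norm (proj k w))\<^sup>2) / 2" for k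
  proof -
    have e: "energy k > 0" by (rule energy_pos)
    have "AE y in lborel. (norm (?c k y))\<^sup>2 \<le> (energy k * (norm (proj k u))\<^sup>2 + (norm (proj k w))\<^sup>2 / energy k ^ 3) / 2"
      unfolding norm_proj
      by (rule weak_second_derivative_bound[OF _ _ e dyy_hcoef[OF w]]) (auto intro: sq_integrable_hcoef)
    then show ?thesis
    proof eventually_elim
      case (elim y)
      have "energy k * (norm (?c k y))\<^sup>2 \<le> energy k * ((energy k * (norm (proj k u))\<^sup>2 + (norm (proj k w))\<^sup>2 / energy k ^ 3) / 2)"
        using elim e by (intro mult_left_mono) auto
      also have "\<dots> = ((energy k * norm (proj k u))\<^sup>2 + (norm (proj k w))\<^sup>2 / (energy k)\<^sup>2) / 2"
        using e by (simp add: field_simps power2_eq_square power3_eq_cube)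
      also have "energy k * norm (proj k u) = norm (proj k v)"
        using v e unfolding H_plane_iff by simp
      \<comment> \<open>The factor 4/b^2 comes from \<open>energy k\<close> being at least
        b/2.\<close>
      also have "(norm (proj k w))\<^sup>2 / (energy k)\<^sup>2 \<le> 4 / b\<^sup>2 * (norm (proj k w))\<^sup>2"
      proof -
        have "(b / 2)\<^sup>2 \<le> (energy k)\<^sup>2" using energy_ge[of k] b_pos by (intro power_mono) auto
        then have "(norm (proj k w))\<^sup>2 / (energy k)\<^sup>2 \<le> (norm (proj k w))\<^sup>2 / (b / 2)\<^sup>2"
          using b_pos by (intro divide_left_mono mult_pos_pos) (auto intro: zero_less_power e)
        then show ?thesis by (simp add: power_divide field_simps)
      qed
      finally show ?case by simp
    qed
  qed
  define X where "X N = (\<Sum>k<N. cis (- (energy k * \<theta>)) *\<^sub>C proj k u)" for N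
  have "X \<longlonglongrightarrow> plane.U \<theta> u"
    using summable_sums[OF plane.summable_mult_P[of "\<lambda>k. cis (- (energy k * \<theta>))" u]]
    unfolding X_def plane.U_def plane.mult_def sums_def by simp
  then show ?thesis
  \<comment> \<open>A bound that holds a.e. for every partial sum is inherited by the limit,
    although the expansion is only known to converge in norm.\<close>
  proof (rule AE_norm_le_closed)
    fix N
    have "AE y in lborel. \<forall>k. energy k * (norm (?c k y))\<^sup>2 \<le> ((norm (proj k v))\<^sup>2 + 4 / b\<^sup>2 * (norm (proj k w))\<^sup>2) / 2"
      using mode by (simp add: AE_all_countable)
    then have "AE y in lborel. (\<Sum>k<N. energy k * (norm (?c k y))\<^sup>2) \<le> S"
    proof eventually_elim
      case (elim y)
      have "(\<Sum>k<N. energy k * (norm (?c k y))\<^sup>2) \<le> (\<Sum>k<N. ((norm (proj k v))\<^sup>2 + 4 / b\<^sup>2 * (norm (proj k w))\<^sup>2) / 2)"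
        using elim by (intro sum_mono) blast
      also have "\<dots> = ((\<Sum>k<N. (norm (proj k v))\<^sup>2) + 4 / b\<^sup>2 * (\<Sum>k<N. (norm (proj k w))\<^sup>2)) / 2"
        by (simp only: sum_divide_distrib[symmetric] sum.distrib sum_distrib_left)
      also have "\<dots> \<le> S"
        unfolding S_def using b_pos
        by (intro divide_right_mono add_mono mult_left_mono plane.bessel) auto
      finally show ?case .
    qed
    then have A: "AE z::real \<times> real in lborel. (\<Sum>k<N. energy k * (norm (?c k (snd z)))\<^sup>2) \<le> S" by (rule AE_snd)
    have "AE z in lborel. \<forall>k. rep_L2 (cis (- (energy k * \<theta>)) *\<^sub>C proj k u) z = cis (- (energy k * \<theta>)) * tensor_herm k (?c k) z"
      unfolding AE_all_countable
    proof
      fix k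
      show "AE z in lborel. rep_L2 (cis (- (energy k * \<theta>)) *\<^sub>C proj k u) z = cis (- (energy k * \<theta>)) * tensor_herm k (?c k) z"
        using rep_scaleC[of "cis (- (energy k * \<theta>))" "proj k u"] rep_proj[of k u] by eventually_elim simp
    qed
    then show "AE z in lborel. norm (rep_L2 (X N) z) \<le> sqrt ((1 + 1 / b) * ((norm v)\<^sup>2 + 4 / b\<^sup>2 * (norm w)\<^sup>2))"
      using A rep_sum[of "\<lambda>k. cis (- (energy k * \<theta>)) *\<^sub>C proj k u" N]
    proof eventually_elim
      case (elim z)
      have "norm (rep_L2 (X N) z) \<le> (\<Sum>k<N. norm (cis (- (energy k * \<theta>)) * tensor_herm k (?c k) z))"
        using elim unfolding X_def by (simp add: norm_sum)
      also have "\<dots> = (\<Sum>k<N. (\<bar>herm k (fst z)\<bar> / sqrt (energy k)) * (sqrt (energy k) * norm (?c k (snd z))))"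
        using energy_pos by (intro sum.cong) (auto simp: norm_mult tensor_herm_def less_imp_neq[THEN not_sym])
      finally have "norm (rep_L2 (X N) z) \<le> (\<Sum>k<N. (\<bar>herm k (fst z)\<bar> / sqrt (energy k)) * (sqrt (energy k) * norm (?c k (snd z))))" .
      then have "(norm (rep_L2 (X N) z))\<^sup>2 \<le> (\<Sum>k<N. (\<bar>herm k (fst z)\<bar> / sqrt (energy k)) * (sqrt (energy k) * norm (?c k (snd z))))\<^sup>2"
        by (intro power_mono) auto
      also have "\<dots> \<le> (\<Sum>k<N. (\<bar>herm k (fst z)\<bar> / sqrt (energy k))\<^sup>2) * (\<Sum>k<N. (sqrt (energy k) * norm (?c k (snd z)))\<^sup>2)"
        by (rule Cauchy_Schwarz_ineq_sum)
      also have "\<dots> = (\<Sum>k<N. (herm k (fst z))\<^sup>2 / energy k) * (\<Sum>k<N. energy k * (norm (?c k (snd z)))\<^sup>2)"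
        using energy_pos by (simp add: power_divide power_mult_distrib less_imp_le)
      also have "\<dots> \<le> (2 + 2 / b) * S"
        using elim herm_sum_bound[of "fst z" N] b_pos energy_pos
        by (intro mult_mono) (auto intro!: sum_nonneg mult_nonneg_nonneg simp: less_imp_le)
      also have "\<dots> = (1 + 1 / b) * ((norm v)\<^sup>2 + 4 / b\<^sup>2 * (norm w)\<^sup>2)"
        by (simp add: S_def field_simps)
      finally show ?case by (rule real_le_rsqrt)
    qed
  qed
qed

end

section \<open>The continuous representative\<close>

text \<open>The set of disagreement is open, and a nonempty open set is not null. This is the
  uniqueness behind \<open>continuous_rep\<close>.\<close>

lemma continuous_AE_eq_imp_eq:
  fixes g h :: "'a::euclidean_space \<Rightarrow> real"
  assumes g: "continuous_on UNIV g" and h: "continuous_on UNIV h" and eq: "AE z in lborel. g z = h z"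
  shows "g = h"
proof (rule ccontr)
  assume "g \<noteq> h"
  then have ne: "{z. g z \<noteq> h z} \<noteq> {}" by auto
  have op: "open {z. g z \<noteq> h z}" by (rule open_Collect_neq[OF g h])
  have "{z. g z \<noteq> h z} \<in> null_sets lborel"
    using eq op by (simp add: AE_iff_null_sets)
  then have "{z. g z \<noteq> h z} \<in> null_sets lebesgue" by (rule null_sets_completionI)
  then show False using open_not_negligible[OF op ne] by (simp add: negligible_iff_null_sets)
qed

lemma continuous_rep_eqI:
  assumes "continuous_on UNIV g" "AE z in lborel. u z = g z"
  shows "continuous_rep u = g"
  unfolding continuous_rep_def
proof (rule the_equality)
  fix h assume h: "continuous_on UNIV h \<and> (AE z in lborel. u z = h z)"
  then have "AE z in lborel. h z = g z" using assms(2) by (auto elim: eventually_elim2)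
  then show "h = g" using continuous_AE_eq_imp_eq[of h g] assms(1) h by blast
qed (use assms in auto)

section \<open>A kernel on the plane and the regularity of \<lambda>\<close>

text \<open>The fundamental solution of (1 - d_x^2)(1 - d_y^2). Its product form reduces it to the
  line, and unlike the kernel of 1 - \<Delta> in the plane it has no singularity; the price is a
  mixed derivative of order four.\<close>

definition plane_kernel :: "real \<times> real \<Rightarrow> real" where
  "plane_kernel z = ekernel 1 (fst z) * ekernel 1 (snd z)"

lemma plane_kernel_measurable [measurable]: "plane_kernel \<in> borel_measurable borel"
  unfolding plane_kernel_def by (subst borel_prod[symmetric]) measurable

lemma plane_kernel_nonneg: "plane_kernel z \<ge> 0"
  by (simp add: plane_kernel_def ekernel_nonneg)

lemma integrable_product_plane:
  fixes f g :: "real \<Rightarrow> real"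
  assumes f: "integrable lborel f" and g: "integrable lborel g"
  shows "integrable lborel (\<lambda>z::real \<times> real. f (fst z) * g (snd z))"
    and "(LINT z::real \<times> real|lborel. f (fst z) * g (snd z)) = (LINT x|lborel. f x) * (LINT y|lborel. g y)"
proof -
  have [measurable]: "f \<in> borel_measurable borel" "g \<in> borel_measurable borel"
    using f g by (auto dest: borel_measurable_integrable)
  have i: "integrable (lborel \<Otimes>\<^sub>M lborel) (\<lambda>z::real \<times> real. f (fst z) * g (snd z))"
    by (rule lborel_pair.Fubini_integrable) (use f g in \<open>simp_all add: abs_mult\<close>)
  then show "integrable lborel (\<lambda>z::real \<times> real. f (fst z) * g (snd z))" by (simp add: lborel_prod)
  show "(LINT z::real \<times> real|lborel. f (fst z) * g (snd z)) = (LINT x|lborel. f x) * (LINT y|lborel. g y)"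
    using lborel_pair.integral_fst'[OF i] by (simp add: lborel_prod)
qed

lemma integrable_plane_kernel: "integrable lborel plane_kernel"
  unfolding plane_kernel_def[abs_def] by (intro integrable_product_plane integrable_ekernel) simp_all

text \<open>A comparison of Harnack type, with one factor e for each variable: small translates of
  the kernel have a common integrable majorant.\<close>

lemma plane_kernel_shift_le:
  assumes "norm h \<le> 1"
  shows "plane_kernel (z + h) \<le> exp 2 * plane_kernel z"
proof -
  have e: "ekernel 1 (s + t) \<le> exp 1 * ekernel 1 s" if "\<bar>t\<bar> \<le> 1" for s t :: real
  proof -
    have "- \<bar>s + t\<bar> \<le> 1 + - \<bar>s\<bar>" using that by linarith
    then have "exp (- \<bar>s + t\<bar>) \<le> exp (1 + - \<bar>s\<bar>)" by simp
    then show ?thesis unfolding exp_add by (simp add: ekernel_def)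
  qed
  have "\<bar>fst h\<bar> \<le> 1" "\<bar>snd h\<bar> \<le> 1"
    using assms norm_fst_le[of "fst h" "snd h"] norm_snd_le[of "snd h" "fst h"] by simp_all
  then have "plane_kernel (z + h) \<le> (exp 1 * ekernel 1 (fst z)) * (exp 1 * ekernel 1 (snd z))"
    unfolding plane_kernel_def fst_add snd_add using e ekernel_nonneg[of 1] by (intro mult_mono) auto
  also have "\<dots> = exp 2 * plane_kernel z"
    by (simp add: plane_kernel_def flip: exp_add)
  finally show ?thesis .
qed

lemma continuous_plane_kernel: "isCont plane_kernel z"
  unfolding plane_kernel_def[abs_def] ekernel_def by (intro continuous_intros) simp_all

lemma plane_kernel_convolution:
  fixes m :: "real \<times> real \<Rightarrow> real"
  assumes [measurable]: "m \<in> borel_measurable borel" and C: "\<And>z. \<bar>m z\<bar> \<le> C"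
  shows "continuous_on UNIV (\<lambda>z. LINT w|lborel. plane_kernel w * m (z + w))"
    and "\<bar>LINT w|lborel. plane_kernel w * m (z + w)\<bar> \<le> C * (LINT w|lborel. plane_kernel w)"
proof -
  define g where "g z = (LINT w|lborel. plane_kernel w * m (z + w))" for z
  have C0: "C \<ge> 0" using C[of 0] by simp
  have int: "integrable lborel (\<lambda>w. plane_kernel w * m (z + w))" for z
  proof (rule Bochner_Integration.integrable_bound[OF integrable_mult_left[OF integrable_plane_kernel, of C]])
    show "AE w in lborel. norm (plane_kernel w * m (z + w)) \<le> norm (plane_kernel w * C)"
      using C C0 by (intro AE_I2) (simp add: abs_mult mult_left_mono)
  qed measurable
  have "\<bar>g z\<bar> \<le> (LINT w|lborel. plane_kernel w * C)"
    unfolding g_def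
  proof (rule order_trans[OF integral_abs_bound])
    show "(LINT w|lborel. \<bar>plane_kernel w * m (z + w)\<bar>) \<le> (LINT w|lborel. plane_kernel w * C)"
      by (intro integral_mono integrable_abs int integrable_mult_left integrable_plane_kernel)
         (simp add: abs_mult plane_kernel_nonneg mult_left_mono C)
  qed
  then show "\<bar>LINT w|lborel. plane_kernel w * m (z + w)\<bar> \<le> C * (LINT w|lborel. plane_kernel w)"
    by (simp add: g_def mult.commute)
  \<comment> \<open>After the substitution the translation acts on the continuous kernel instead of
    m, which is merely bounded and measurable.\<close>
  have g_eq: "g z = (LINT v|lborel. plane_kernel (v - z) * m v)" for z
    unfolding g_def using integral_translate(1)[of "\<lambda>v. plane_kernel (v - z) * m v" z] by simp
  have "isCont g z" for z
    unfolding continuous_at_sequentially comp_def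
  proof (intro allI impI)
    fix X :: "nat \<Rightarrow> real \<times> real" assume X: "X \<longlonglongrightarrow> z"
    then obtain N where N: "\<And>n. n \<ge> N \<Longrightarrow> norm (X n - z) < 1"
      using LIMSEQ_D[of X z 1] by auto
    have "(\<lambda>n. g (X (n + N))) \<longlonglongrightarrow> g z"
      unfolding g_eq
    proof (rule integral_dominated_convergence)
      have "integrable lborel (\<lambda>v. plane_kernel (- z + v))"
        by (rule integral_translate(2)[OF plane_kernel_measurable integrable_plane_kernel])
      then show "integrable lborel (\<lambda>v. exp 2 * plane_kernel (v - z) * C)" by simp
      show "AE v in lborel. (\<lambda>n. plane_kernel (v - X (n + N)) * m v) \<longlonglongrightarrow> plane_kernel (v - z) * m v"
      proof (intro AE_I2 tendsto_mult_right)
        fix v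
        have "(\<lambda>n. v - X (n + N)) \<longlonglongrightarrow> v - z"
          by (intro tendsto_diff tendsto_const LIMSEQ_ignore_initial_segment X)
        then show "(\<lambda>n. plane_kernel (v - X (n + N))) \<longlonglongrightarrow> plane_kernel (v - z)"
          by (rule isCont_tendsto_compose[OF continuous_plane_kernel])
      qed
      show "AE v in lborel. norm (plane_kernel (v - X (n + N)) * m v) \<le> exp 2 * plane_kernel (v - z) * C" for n
      proof (rule AE_I2)
        fix v
        have "norm (z - X (n + N)) \<le> 1" using N[of "n + N"] by (simp add: norm_minus_commute)
        from plane_kernel_shift_le[OF this, of "v - z"]
        have "plane_kernel (v - X (n + N)) \<le> exp 2 * plane_kernel (v - z)" by simp
        then show "norm (plane_kernel (v - X (n + N)) * m v) \<le> exp 2 * plane_kernel (v - z) * C"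
          unfolding real_norm_def abs_mult abs_of_nonneg[OF plane_kernel_nonneg]
          by (intro mult_mono C) (simp_all add: plane_kernel_nonneg)
      qed
    qed measurable
    then show "(\<lambda>n. g (X n)) \<longlonglongrightarrow> g z" by (rule LIMSEQ_offset)
  qed
  then show "continuous_on UNIV (\<lambda>z. LINT w|lborel. plane_kernel w * m (z + w))"
    by (simp add: continuous_on_eq_continuous_at g_def[abs_def])
qed

lemma test_function_integrable_line:
  assumes "test_function (f :: real \<Rightarrow> real)"
  shows "integrable lborel f"
proof -
  obtain C where C: "\<And>z. \<bar>f z\<bar> \<le> C * exp (- 1 * (norm z)\<^sup>2)" "C \<ge> 0"
    using test_function_gauss_bound[OF assms, of 1] by auto
  show ?thesis
    by (rule Bochner_Integration.integrable_bound[OF integrable_mult_right[OF integrable_gauss_line[of 1], of C]])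
       (use C in \<open>auto intro: test_function_measurable assms\<close>)
qed

text \<open>Here m is a version of (1 - d_x^2)(1 - d_y^2) \<open>lam\<close>, assembled from the
  weak derivatives xx, yy and xxyy. Testing with products makes the one-dimensional operators appear
  as factors, written with \<open>1\<^sup>2\<close> to match \<open>ekernel_representation\<close>
  for \<kappa> = 1.\<close>

lemma W_infty_weak_derivs:
  fixes lam :: "real \<times> real \<Rightarrow> real"
  assumes lam: "W_infty 15 lam"
  obtains m C where "m \<in> borel_measurable borel" "\<And>z. \<bar>m z\<bar> \<le> C" "AE z in lborel. \<bar>lam z\<bar> \<le> C" "lam \<in> borel_measurable borel"
    "\<And>f g. test_function f \<Longrightarrow> test_function g \<Longrightarrow>
      (LINT z|lborel. ((1\<^sup>2 * f (fst z) - deriv (deriv f) (fst z)) * (1\<^sup>2 * g (snd z) - deriv (deriv g) (snd z))) * lam z)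
        = (LINT z|lborel. (f (fst z) * g (snd z)) * m z)"
proof -
  let ?x = "(1, 0) :: real \<times> real" and ?y = "(0, 1) :: real \<times> real"
  have W: "\<exists>v. L_infty v \<and> weak_deriv es lam v" if "set es \<subseteq> {?x, ?y}" "length es \<le> 15" for es
    using lam that unfolding W_infty_def Basis_plane by blast
  obtain v1 where v1: "L_infty v1" "weak_deriv [?x, ?x] lam v1" using W[of "[?x, ?x]"] by auto
  obtain v2 where v2: "L_infty v2" "weak_deriv [?y, ?y] lam v2" using W[of "[?y, ?y]"] by auto
  obtain v3 where v3: "L_infty v3" "weak_deriv [?x, ?x, ?y, ?y] lam v3" using W[of "[?x, ?x, ?y, ?y]"] by auto
  have l: "L_infty lam" using lam by (simp add: W_infty_def)
  have [measurable]: "lam \<in> borel_measurable borel" "v1 \<in> borel_measurable borel" "v2 \<in> borel_measurable borel" "v3 \<in> borel_measurable borel"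
    using l v1 v2 v3 by (simp_all add: L_infty_def)
  obtain C0 C1 C2 C3 where Cs: "AE z in lborel. \<bar>lam z\<bar> \<le> C0" "AE z in lborel. \<bar>v1 z\<bar> \<le> C1"
    "AE z in lborel. \<bar>v2 z\<bar> \<le> C2" "AE z in lborel. \<bar>v3 z\<bar> \<le> C3"
    using l v1 v2 v3 by (auto simp: L_infty_def)
  define C where "C = \<bar>C0\<bar> + \<bar>C1\<bar> + \<bar>C2\<bar> + \<bar>C3\<bar>"
  \<comment> \<open>The truncation changes the function only on a null set and makes the bound valid
    everywhere instead of a.e.\<close>
  define m where "m z = (if \<bar>lam z - v1 z - v2 z + v3 z\<bar> \<le> C then lam z - v1 z - v2 z + v3 z else 0)" for z
  have m_AE: "AE z in lborel. m z = lam z - v1 z - v2 z + v3 z"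
    using Cs by eventually_elim (auto simp: m_def C_def)
  have [measurable]: "m \<in> borel_measurable borel" unfolding m_def by measurable
  have int: "integrable lborel (\<lambda>z. (f (fst z) * g (snd z)) * v z)"
    if f: "integrable lborel f" and g: "integrable lborel g" and v: "L_infty v" for f g :: "real \<Rightarrow> real" and v
  proof -
    obtain B where [measurable]: "v \<in> borel_measurable borel" and B: "AE z in lborel. \<bar>v z\<bar> \<le> B"
      using v by (auto simp: L_infty_def)
    show ?thesis
      by (rule Bochner_Integration.integrable_bound[OF integrable_mult_left[OF integrable_product_plane(1)[OF f g], of B]])
         (use B borel_measurable_integrable[OF integrable_product_plane(1)[OF f g]] in
           \<open>auto elim!: eventually_mono simp: abs_mult intro!: mult_left_mono\<close>)
  qed
  show ?thesis
  proof (rule that)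
    show "\<bar>m z\<bar> \<le> C" for z by (simp add: m_def C_def)
    show "AE z in lborel. \<bar>lam z\<bar> \<le> C" using Cs(1) by eventually_elim (simp add: C_def)
    fix f g :: "real \<Rightarrow> real" assume f: "test_function f" and g: "test_function g"
    note f' = test_function_deriv(1)[OF f] and g' = test_function_deriv(1)[OF g]
    note f'' = test_function_deriv(1)[OF f'] and g'' = test_function_deriv(1)[OF g']
    note ti = test_function_integrable_line
    have t: "test_function (\<lambda>z. f (fst z) * g (snd z))" by (rule test_function_tensor[OF f g])
    have e1: "(LINT z|lborel. (deriv (deriv f) (fst z) * g (snd z)) * lam z) = (LINT z|lborel. (f (fst z) * g (snd z)) * v1 z)"
      using v1(2) t unfolding weak_deriv_def by (auto simp: dir_deriv_tensor(1)[OF f] dir_deriv_tensor(1)[OF f'])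
    have e2: "(LINT z|lborel. (f (fst z) * deriv (deriv g) (snd z)) * lam z) = (LINT z|lborel. (f (fst z) * g (snd z)) * v2 z)"
      using v2(2) t unfolding weak_deriv_def by (auto simp: dir_deriv_tensor(2)[OF g] dir_deriv_tensor(2)[OF g'])
    have e3: "(LINT z|lborel. (deriv (deriv f) (fst z) * deriv (deriv g) (snd z)) * lam z) = (LINT z|lborel. (f (fst z) * g (snd z)) * v3 z)"
      using v3(2) t unfolding weak_deriv_def
      by (auto simp: dir_deriv_tensor(2)[OF g] dir_deriv_tensor(2)[OF g'] dir_deriv_tensor(1)[OF f] dir_deriv_tensor(1)[OF f'])
    have "(LINT z|lborel. ((1\<^sup>2 * f (fst z) - deriv (deriv f) (fst z)) * (1\<^sup>2 * g (snd z) - deriv (deriv g) (snd z))) * lam z)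
        = (LINT z|lborel. (f (fst z) * g (snd z)) * lam z - (deriv (deriv f) (fst z) * g (snd z)) * lam z
            - (f (fst z) * deriv (deriv g) (snd z)) * lam z + (deriv (deriv f) (fst z) * deriv (deriv g) (snd z)) * lam z)"
      by (rule Bochner_Integration.integral_cong) (simp_all add: algebra_simps)
    also have "\<dots> = (LINT z|lborel. (f (fst z) * g (snd z)) * lam z) - (LINT z|lborel. (deriv (deriv f) (fst z) * g (snd z)) * lam z)
            - (LINT z|lborel. (f (fst z) * deriv (deriv g) (snd z)) * lam z) + (LINT z|lborel. (deriv (deriv f) (fst z) * deriv (deriv g) (snd z)) * lam z)"
      using int[OF ti[OF f] ti[OF g] l] int[OF ti[OF f''] ti[OF g] l] int[OF ti[OF f] ti[OF g''] l] int[OF ti[OF f''] ti[OF g''] l]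
      by (simp only: Bochner_Integration.integral_add Bochner_Integration.integral_diff Bochner_Integration.integrable_diff)
    also have "\<dots> = (LINT z|lborel. (f (fst z) * g (snd z)) * lam z) - (LINT z|lborel. (f (fst z) * g (snd z)) * v1 z)
            - (LINT z|lborel. (f (fst z) * g (snd z)) * v2 z) + (LINT z|lborel. (f (fst z) * g (snd z)) * v3 z)"
      unfolding e1 e2 e3 ..
    also have "\<dots> = (LINT z|lborel. (f (fst z) * g (snd z)) * lam z - (f (fst z) * g (snd z)) * v1 z
            - (f (fst z) * g (snd z)) * v2 z + (f (fst z) * g (snd z)) * v3 z)"
      using int[OF ti[OF f] ti[OF g] l] int[OF ti[OF f] ti[OF g] v1(1)] int[OF ti[OF f] ti[OF g] v2(1)] int[OF ti[OF f] ti[OF g] v3(1)]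
      by (simp only: Bochner_Integration.integral_add Bochner_Integration.integral_diff Bochner_Integration.integrable_diff)
    also have "\<dots> = (LINT z|lborel. (f (fst z) * g (snd z)) * m z)"
    proof (rule integral_cong_AE)
      have [measurable]: "(\<lambda>z::real \<times> real. f (fst z) * g (snd z)) \<in> borel_measurable borel"
        by (rule test_function_measurable[OF t])
      show "(\<lambda>z. (f (fst z) * g (snd z)) * m z) \<in> borel_measurable lborel" by measurable
      show "(\<lambda>z. (f (fst z) * g (snd z)) * lam z - (f (fst z) * g (snd z)) * v1 z
            - (f (fst z) * g (snd z)) * v2 z + (f (fst z) * g (snd z)) * v3 z) \<in> borel_measurable lborel" by measurable
      show "AE z in lborel. (f (fst z) * g (snd z)) * lam z - (f (fst z) * g (snd z)) * v1 z
            - (f (fst z) * g (snd z)) * v2 z + (f (fst z) * g (snd z)) * v3 z = (f (fst z) * g (snd z)) * m z"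
        using m_AE by eventually_elim (simp only: right_diff_distrib distrib_left)
    qed
    finally show "(LINT z|lborel. ((1\<^sup>2 * f (fst z) - deriv (deriv f) (fst z)) * (1\<^sup>2 * g (snd z) - deriv (deriv g) (snd z))) * lam z)
        = (LINT z|lborel. (f (fst z) * g (snd z)) * m z)" .
  qed measurable
qed

context oscillator
begin

text \<open>Existence for the definite description in \<open>continuous_rep\<close>: the kernel
  average G of m is continuous and bounded, and by \<open>kernel_duality\<close> it has the same
  integrals against products of test functions as \<open>lam\<close>.\<close>

lemma continuous_rep_bounded:
  fixes lam :: "real \<times> real \<Rightarrow> real"
  assumes lam: "W_infty 15 lam"
  shows "continuous_on UNIV (continuous_rep lam)" and "\<exists>C. \<forall>z. \<bar>continuous_rep lam z\<bar> \<le> C"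
proof -
  obtain m C where m[measurable]: "m \<in> borel_measurable borel" and C: "\<And>z. \<bar>m z\<bar> \<le> C" and lC: "AE z in lborel. \<bar>lam z\<bar> \<le> C"
    and l[measurable]: "lam \<in> borel_measurable borel" and eq: "\<And>f g. test_function f \<Longrightarrow> test_function g \<Longrightarrow>
      (LINT z|lborel. ((1\<^sup>2 * f (fst z) - deriv (deriv f) (fst z)) * (1\<^sup>2 * g (snd z) - deriv (deriv g) (snd z))) * lam z)
        = (LINT z|lborel. (f (fst z) * g (snd z)) * m z)"
    by (rule W_infty_weak_derivs[OF lam]) blast
  define G where "G z = (LINT w|lborel. plane_kernel w * m (z + w))" for z
  have G: "continuous_on UNIV G" "\<And>z. \<bar>G z\<bar> \<le> C * (LINT w|lborel. plane_kernel w)"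
    unfolding G_def using plane_kernel_convolution[OF m C] by blast+
  have [measurable]: "G \<in> borel_measurable borel" by (rule borel_measurable_continuous_onI[OF G(1)])
  have C0: "C \<ge> 0" using C[of 0] by simp
  have dual: "(LINT z|lborel. (f (fst z) * g (snd z)) *\<^sub>R complex_of_real (lam z)) = (LINT z|lborel. (f (fst z) * g (snd z)) *\<^sub>R complex_of_real (G z))"
    if f: "test_function f" and g: "test_function g" for f g
  proof -
    note f'' = test_function_deriv(1)[OF test_function_deriv(1)[OF f]]
    note g'' = test_function_deriv(1)[OF test_function_deriv(1)[OF g]]
    note ti = test_function_integrable_line
    define p q where "p x = 1\<^sup>2 * f x - deriv (deriv f) x" and "q y = 1\<^sup>2 * g y - deriv (deriv g) y" for x y
    have ip: "integrable lborel p" and iq: "integrable lborel q"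
      unfolding p_def q_def by (intro Bochner_Integration.integrable_diff integrable_mult_right ti f f'' g g'')+
    let ?q = "\<lambda>z::real \<times> real. p (fst z) * q (snd z)" and ?f = "\<lambda>z::real \<times> real. f (fst z) * g (snd z)"
    have iqq: "integrable lborel ?q" by (rule integrable_product_plane[OF ip iq])
    have iff: "integrable lborel ?f" by (rule integrable_product_plane[OF ti[OF f] ti[OF g]])
    define B where "B = C * (LINT z|lborel. \<bar>?q z\<bar>) + C * (LINT z|lborel. \<bar>?f z\<bar>)"
    have nn: "C * (LINT z|lborel. \<bar>?q z\<bar>) \<le> B" "C * (LINT z|lborel. \<bar>?f z\<bar>) \<le> B"
      unfolding B_def using C0 by simp_all
    have lc: "AE z in lborel. norm (complex_of_real (lam z)) \<le> C" using lC by simp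
    have mc: "AE z in lborel. norm (complex_of_real (m z)) \<le> C" using C by simp
    have ml: "(\<lambda>z. complex_of_real (lam z)) \<in> borel_measurable borel" "(\<lambda>z. complex_of_real (m z)) \<in> borel_measurable borel" by measurable
    have Gc: "complex_of_real (G z) = (LINT w|lborel. plane_kernel w *\<^sub>R complex_of_real (m (z + w)))" for z
      by (simp add: G_def scaleR_conv_of_real flip: of_real_mult)
    show ?thesis
      unfolding Gc
    proof (rule kernel_duality[where q = ?q and B = B])
      fix z :: "real \<times> real"
      \<comment> \<open>Kernel and test function both factor, so the representation on the plane is
        the product of two on the line.\<close>
      have k: "plane_kernel w * ?q (z - w) = (ekernel 1 (fst w) * p (fst z - fst w)) * (ekernel 1 (snd w) * q (snd z - snd w))" for w
        by (simp add: plane_kernel_def)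
      note ef = ekernel_representation[OF zero_less_one f, of "fst z", folded p_def]
      note eg = ekernel_representation[OF zero_less_one g, of "snd z", folded q_def]
      show "integrable lborel (\<lambda>w. plane_kernel w * ?q (z - w))"
        unfolding k by (rule integrable_product_plane(1)[OF ef(1) eg(1)])
      show "?f z = (LINT w|lborel. plane_kernel w * ?q (z - w))"
        unfolding k integrable_product_plane(2)[OF ef(1) eg(1)] using ef(2) eg(2) by simp
    next
      fix w :: "real \<times> real"
      have tf: "test_function (\<lambda>x. f (1 * x + - fst w))" and tg: "test_function (\<lambda>x. g (1 * x + - snd w))"
        by (rule test_function_affine; (rule f g | simp))+
      have "(LINT z|lborel. ?q (z - w) * lam z) = (LINT z|lborel. ?f (z - w) * m z)"
        using eq[OF tf tg] unfolding deriv_affine(2)[OF f] deriv_affine(2)[OF g] by (simp add: p_def q_def)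
      then show "(LINT z|lborel. ?q (z - w) *\<^sub>R complex_of_real (lam z)) = (LINT z|lborel. ?f (z - w) *\<^sub>R complex_of_real (m z))"
        unfolding scaleR_conv_of_real of_real_mult[symmetric] integral_complex_of_real by simp
      show "integrable lborel (\<lambda>z. ?q (z - w) *\<^sub>R complex_of_real (lam z))"
        by (rule bounded_product_bound(1)[OF iqq ml(1) lc])
      show "integrable lborel (\<lambda>z. ?f (z - w) *\<^sub>R complex_of_real (m z))"
        by (rule bounded_product_bound(1)[OF iff ml(2) mc])
      show "(LINT z|lborel. norm (?q (z - w) *\<^sub>R complex_of_real (lam z))) \<le> B"
        by (rule order_trans[OF bounded_product_bound(2)[OF iqq ml(1) lc] nn(1)])
      show "(LINT z|lborel. norm (?f (z - w) *\<^sub>R complex_of_real (m z))) \<le> B"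
        by (rule order_trans[OF bounded_product_bound(2)[OF iff ml(2) mc] nn(2)])
    qed (use borel_measurable_integrable[OF iqq] borel_measurable_integrable[OF iff] integrable_plane_kernel ml in auto)
  qed
  have gl: "gauss_integrable (\<lambda>z. complex_of_real (lam z))"
    by (rule gauss_integrable_bounded_plane[of _ C]) (use lC in auto)
  have gG: "gauss_integrable (\<lambda>z. complex_of_real (G z))"
    by (rule gauss_integrable_bounded_plane[of _ "C * (LINT w|lborel. plane_kernel w)"]) (use G(2) in auto)
  have "AE z in lborel. complex_of_real (lam z) - complex_of_real (G z) = 0"
  proof (rule fundamental_lemma_plane)
    show "gauss_integrable (\<lambda>z. complex_of_real (lam z) - complex_of_real (G z))" by (rule gauss_integrable_diff[OF gl gG])
    fix f g :: "real \<Rightarrow> real" assume f: "test_function f" and g: "test_function g"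
    note t = test_function_tensor[OF f g]
    show "(LINT z|lborel. (f (fst z) * g (snd z)) *\<^sub>R (complex_of_real (lam z) - complex_of_real (G z))) = 0"
      unfolding scaleR_diff_right
      by (subst Bochner_Integration.integral_diff[OF gauss_integrable_test[OF gl t] gauss_integrable_test[OF gG t]])
         (simp only: dual[OF f g] diff_self)
  qed
  then have "AE z in lborel. lam z = G z" by eventually_elim (simp flip: of_real_diff)
  then have "continuous_rep lam = G" by (rule continuous_rep_eqI[OF G(1)])
  then show "continuous_on UNIV (continuous_rep lam)" and "\<exists>C. \<forall>z. \<bar>continuous_rep lam z\<bar> \<le> C"
    using G by auto
qed

end

section \<open>The space \<open>\<Sigma>\<^sup>2\<close>\<close>

lemma AE_cnorm_le_imp_norm_le:
  fixes u v :: "'a::euclidean_space L2"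
  assumes le: "AE z in lborel. norm (rep_L2 u z) \<le> C * norm (rep_L2 v z)" and C: "C \<ge> 0"
  shows "norm u \<le> C * norm v"
proof -
  have i: "integrable lborel (\<lambda>z. (norm (rep_L2 w z))\<^sup>2)" for w :: "'a L2"
    using sq_integrable_rep[of w] by (simp add: sq_integrable_def)
  have "(norm u)\<^sup>2 \<le> (LINT z|lborel. C\<^sup>2 * (norm (rep_L2 v z))\<^sup>2)"
    unfolding norm_L2_sq
  proof (rule integral_mono_AE[OF i integrable_mult_right[OF i]])
    show "AE z in lborel. (norm (rep_L2 u z))\<^sup>2 \<le> C\<^sup>2 * (norm (rep_L2 v z))\<^sup>2"
      using le by eventually_elim (metis norm_ge_zero power_mono power_mult_distrib)
  qed
  also have "\<dots> = (C * norm v)\<^sup>2" by (simp add: norm_L2_sq power_mult_distrib)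
  finally show ?thesis by (rule power2_le_imp_le) (use C in simp)
qed

lemma locally_integrable_rep: "locally_integrable (rep_L2 u)"
  unfolding locally_integrable_def set_integrable_def
proof (intro allI impI)
  fix K :: "'a set" assume K: "compact K"
  have "integrable lborel (\<lambda>z. indicator K z :: real)"
    by (intro integrable_real_indicator emeasure_bounded_finite compact_imp_bounded K) (simp add: borel_compact K)
  moreover have "(norm (complex_of_real (indicator K z)))\<^sup>2 = indicator K z" for z
    by (simp add: indicator_def)
  moreover have "(\<lambda>z. complex_of_real (indicator K z)) \<in> borel_measurable borel"
    using borel_compact[OF K] by measurable
  ultimately have "sq_integrable (\<lambda>z. complex_of_real (indicator K z))"
    by (simp add: sq_integrable_def)
  from Cauchy_Schwarz_integral(1)[OF this sq_integrable_rep[of u]]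
  show "integrable lborel (\<lambda>z. indicator K z *\<^sub>R rep_L2 u z)" by (simp add: scaleR_conv_of_real)
qed

lemma dyy_iff:
  "dyy u w \<longleftrightarrow> (\<forall>f. test_function f \<longrightarrow>
     (LINT z|lborel. dir_deriv (0, 1) (dir_deriv (0, 1) f) z *\<^sub>R rep_L2 u z) = (LINT z|lborel. f z *\<^sub>R rep_L2 w z))"
  unfolding dyy_def weak_deriv_def by (simp add: locally_integrable_rep)

lemma integral_test_rep_add:
  fixes u v :: "(real \<times> real) L2"
  assumes f: "test_function f"
  shows "(LINT z|lborel. f z *\<^sub>R rep_L2 (u + v) z) = (LINT z|lborel. f z *\<^sub>R rep_L2 u z) + (LINT z|lborel. f z *\<^sub>R rep_L2 v z)"
proof -
  have [measurable]: "f \<in> borel_measurable borel" by (rule test_function_measurable[OF f])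
  have "(LINT z|lborel. f z *\<^sub>R rep_L2 (u + v) z) = (LINT z|lborel. f z *\<^sub>R rep_L2 u z + f z *\<^sub>R rep_L2 v z)"
    by (rule integral_cong_AE) (use rep_add[of u v] in \<open>auto elim!: eventually_mono simp: scaleR_add_right\<close>)
  then show ?thesis
    using gauss_integrable_test[OF gauss_integrable_rep f] by simp
qed

lemma integral_test_rep_scaleR:
  fixes u :: "(real \<times> real) L2"
  assumes f: "test_function f"
  shows "(LINT z|lborel. f z *\<^sub>R rep_L2 (r *\<^sub>R u) z) = r *\<^sub>R (LINT z|lborel. f z *\<^sub>R rep_L2 u z)"
proof -
  have [measurable]: "f \<in> borel_measurable borel" by (rule test_function_measurable[OF f])
  have "(LINT z|lborel. f z *\<^sub>R rep_L2 (r *\<^sub>R u) z) = (LINT z|lborel. r *\<^sub>R (f z *\<^sub>R rep_L2 u z))"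
    by (rule integral_cong_AE) (use rep_scaleR[of r u] in \<open>auto elim!: eventually_mono simp: mult.commute\<close>)
  then show ?thesis by (simp only: integral_scaleR_right)
qed

lemma test_function_dyy: "test_function f \<Longrightarrow> test_function (dir_deriv (0, 1) (dir_deriv (0, 1) f))" for f :: "real \<times> real \<Rightarrow> real"
  by (intro test_function_dir_deriv) (simp_all add: Basis_plane)

lemma dyy_add:
  assumes "dyy u w" "dyy u' w'"
  shows "dyy (u + u') (w + w')"
  unfolding dyy_iff
proof (intro allI impI)
  fix f :: "real \<times> real \<Rightarrow> real" assume f: "test_function f"
  show "(LINT z|lborel. dir_deriv (0, 1) (dir_deriv (0, 1) f) z *\<^sub>R rep_L2 (u + u') z) = (LINT z|lborel. f z *\<^sub>R rep_L2 (w + w') z)"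
    unfolding integral_test_rep_add[OF f] integral_test_rep_add[OF test_function_dyy[OF f]]
      assms[unfolded dyy_iff, rule_format, OF f] ..
qed

lemma dyy_scaleR:
  assumes "dyy u w"
  shows "dyy (r *\<^sub>R u) (r *\<^sub>R w)"
  unfolding dyy_iff
proof (intro allI impI)
  fix f :: "real \<times> real \<Rightarrow> real" assume f: "test_function f"
  show "(LINT z|lborel. dir_deriv (0, 1) (dir_deriv (0, 1) f) z *\<^sub>R rep_L2 (r *\<^sub>R u) z) = (LINT z|lborel. f z *\<^sub>R rep_L2 (r *\<^sub>R w) z)"
    unfolding integral_test_rep_scaleR[OF f] integral_test_rep_scaleR[OF test_function_dyy[OF f]]
      assms[unfolded dyy_iff, rule_format, OF f] ..
qed

section \<open>The graph norm and the orbit bound on \<Sigma>^2\<close>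

context oscillator
begin

lemma H_plane_add: "H_plane b u v \<Longrightarrow> H_plane b u' v' \<Longrightarrow> H_plane b (u + u') (v + v')"
  unfolding H_plane_iff by (simp add: plane.P_add scaleR_add_right)

lemma H_plane_scaleR: "H_plane b u v \<Longrightarrow> H_plane b (r *\<^sub>R u) (r *\<^sub>R v)"
  unfolding H_plane_iff by (simp add: plane.P_scaleR mult.commute)

lemma H_plane_unique: "H_plane b u v \<Longrightarrow> H_plane b u v' \<Longrightarrow> v = v'"
  unfolding H_plane_iff by (rule plane.eqI) simp

lemma dyy_unique:
  assumes "dyy u w" "dyy u w'"
  shows "w = w'"
proof (rule L2_eqI)
  note gi = gauss_integrable_rep
  have "AE z in lborel. rep_L2 w z - rep_L2 w' z = 0"
  proof (rule fundamental_lemma_plane)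
    show "gauss_integrable (\<lambda>z. rep_L2 w z - rep_L2 w' z)" by (intro gauss_integrable_diff gi)
    fix f g :: "real \<Rightarrow> real" assume f: "test_function f" and g: "test_function g"
    note t = test_function_tensor[OF f g]
    have eq: "(LINT z|lborel. (f (fst z) * g (snd z)) *\<^sub>R rep_L2 w z) = (LINT z|lborel. (f (fst z) * g (snd z)) *\<^sub>R rep_L2 w' z)"
      using assms(1)[unfolded dyy_iff, rule_format, OF t] assms(2)[unfolded dyy_iff, rule_format, OF t] by simp
    show "(LINT z|lborel. (f (fst z) * g (snd z)) *\<^sub>R (rep_L2 w z - rep_L2 w' z)) = 0"
      unfolding scaleR_diff_right
      by (subst Bochner_Integration.integral_diff[OF gauss_integrable_test[OF gi t] gauss_integrable_test[OF gi t]])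
         (simp only: eq diff_self)
  qed
  then show "AE z in lborel. rep_L2 w z = rep_L2 w' z" by eventually_elim simp
qed

text \<open>\<open>Sigma2_norm\<close> is the norm of this triple in a product of three
  \<open>L2\<close> spaces, so continuity and differentiability in \<Sigma>^2 become the ordinary
  notions for a map into a normed space.\<close>

definition triple :: "(real \<times> real) L2 \<Rightarrow> (real \<times> real) L2 \<times> (real \<times> real) L2 \<times> (real \<times> real) L2" where
  "triple u = (u, (THE v. H_plane b u v), (THE w. dyy u w))"

text \<open>Uniqueness of Hu and of the weak second derivative in y removes both definite
  descriptions.\<close>

lemma triple_eq:
  assumes H: "H_plane b u v" and D: "dyy u w"
  shows "triple u = (u, v, w)"
proof -
  have "(THE v. H_plane b u v) = v"
    by (rule the_equality, rule H, rule H_plane_unique[OF _ H], assumption)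
  moreover have "(THE w. dyy u w) = w"
    by (rule the_equality, rule D, rule dyy_unique[OF _ D], assumption)
  ultimately show ?thesis by (simp add: triple_def)
qed

lemma Sigma2_norm_eq: "Sigma2_norm b u = norm (triple u)"
  by (simp add: Sigma2_norm_def triple_def norm_Pair add.assoc)

lemma Sigma2E:
  assumes "u \<in> Sigma2 b"
  obtains v w where "H_plane b u v" "dyy u w" "triple u = (u, v, w)"
proof -
  obtain v w where "H_plane b u v" "dyy u w" using assms unfolding Sigma2_def by blast
  then show ?thesis using that[OF _ _ triple_eq] by simp
qed

lemma Sigma2_add:
  assumes "u \<in> Sigma2 b" "u' \<in> Sigma2 b"
  shows "u + u' \<in> Sigma2 b" "triple (u + u') = triple u + triple u'"
proof -
  obtain v w where 1: "H_plane b u v" "dyy u w" "triple u = (u, v, w)" by (rule Sigma2E[OF assms(1)])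
  obtain v' w' where 2: "H_plane b u' v'" "dyy u' w'" "triple u' = (u', v', w')" by (rule Sigma2E[OF assms(2)])
  note H = H_plane_add[OF 1(1) 2(1)] and D = dyy_add[OF 1(2) 2(2)]
  show "u + u' \<in> Sigma2 b" using H D unfolding Sigma2_def by blast
  show "triple (u + u') = triple u + triple u'" using triple_eq[OF H D] 1(3) 2(3) by simp
qed

lemma Sigma2_scaleR:
  assumes "u \<in> Sigma2 b"
  shows "r *\<^sub>R u \<in> Sigma2 b" "triple (r *\<^sub>R u) = r *\<^sub>R triple u"
proof -
  obtain v w where 1: "H_plane b u v" "dyy u w" "triple u = (u, v, w)" by (rule Sigma2E[OF assms(1)])
  note H = H_plane_scaleR[OF 1(1), of r] and D = dyy_scaleR[OF 1(2), of r]
  show "r *\<^sub>R u \<in> Sigma2 b" using H D unfolding Sigma2_def by blast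
  show "triple (r *\<^sub>R u) = r *\<^sub>R triple u" using triple_eq[OF H D] 1(3) by simp
qed

lemma Sigma2_diff:
  assumes "u \<in> Sigma2 b" "u' \<in> Sigma2 b"
  shows "u - u' \<in> Sigma2 b" "triple (u - u') = triple u - triple u'"
proof -
  have eq: "u - u' = u + (- 1) *\<^sub>R u'" by simp
  show "u - u' \<in> Sigma2 b" "triple (u - u') = triple u - triple u'"
    unfolding eq using Sigma2_add[OF assms(1) Sigma2_scaleR(1)[OF assms(2), of "- 1"]] Sigma2_scaleR(2)[OF assms(2), of "- 1"]
    by simp_all
qed

text \<open>The constant of \<open>U_bounded\<close> once ||v||^2 + (4/b^2) ||w||^2 is estimated by
  1 + 4/b^2 times the squared \<Sigma>^2 norm.\<close>

definition sup_const :: real where "sup_const = sqrt ((1 + 1 / b) * (1 + 4 / b\<^sup>2))"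

lemma Sigma2_U_bounded:
  assumes u: "u \<in> Sigma2 b"
  shows "AE z in lborel. norm (rep_L2 (plane.U \<theta> u) z) \<le> sup_const * Sigma2_norm b u"
proof -
  obtain v w where 1: "H_plane b u v" "dyy u w" "triple u = (u, v, w)" by (rule Sigma2E[OF u])
  have "(1 + 1 / b) * ((norm v)\<^sup>2 + 4 / b\<^sup>2 * (norm w)\<^sup>2) \<le> (1 + 1 / b) * ((1 + 4 / b\<^sup>2) * (Sigma2_norm b u)\<^sup>2)"
  proof (rule mult_left_mono)
    have N: "(Sigma2_norm b u)\<^sup>2 = (norm u)\<^sup>2 + ((norm v)\<^sup>2 + (norm w)\<^sup>2)"
      unfolding Sigma2_norm_eq 1(3) by (simp add: norm_Pair)
    have "(norm v)\<^sup>2 + 4 / b\<^sup>2 * (norm w)\<^sup>2 \<le> (1 + 4 / b\<^sup>2) * ((norm v)\<^sup>2 + (norm w)\<^sup>2)"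
      by (simp add: algebra_simps)
    also have "\<dots> \<le> (1 + 4 / b\<^sup>2) * (Sigma2_norm b u)\<^sup>2"
      unfolding N by (intro mult_left_mono) auto
    finally show "(norm v)\<^sup>2 + 4 / b\<^sup>2 * (norm w)\<^sup>2 \<le> (1 + 4 / b\<^sup>2) * (Sigma2_norm b u)\<^sup>2" .
  qed (use b_pos in simp)
  then have "sqrt ((1 + 1 / b) * ((norm v)\<^sup>2 + 4 / b\<^sup>2 * (norm w)\<^sup>2)) \<le> sqrt ((1 + 1 / b) * (1 + 4 / b\<^sup>2) * (Sigma2_norm b u)\<^sup>2)"
    by (simp only: mult.assoc real_sqrt_le_mono)
  also have "\<dots> = sup_const * Sigma2_norm b u"
    unfolding sup_const_def real_sqrt_mult[of "_ * _"] real_sqrt_abs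
    by (simp add: Sigma2_norm_eq)
  finally show ?thesis using U_bounded[OF 1(1,2), of \<theta>] by (auto elim!: eventually_mono)
qed

end

section \<open>The averaged nonlinearity\<close>

text \<open>Induction on the exponent: peeling off one modulus multiplies the old estimate by M and
  adds a term from the difference of the moduli, itself at most |x - y|. The additions account for
  the factor k + 1.\<close>

lemma norm_power_mult_diff_le:
  fixes x y :: complex
  assumes "norm x \<le> M" "norm y \<le> M"
  shows "norm (of_real (norm x ^ k) * x - of_real (norm y ^ k) * y) \<le> (real k + 1) * M ^ k * norm (x - y)"
proof (induction k)
  case (Suc k)
  have M: "M \<ge> 0" using assms(1) norm_ge_zero[of x] by linarith
  let ?f = "\<lambda>x. complex_of_real (norm x ^ k) * x"
  have "of_real (norm x ^ Suc k) * x - of_real (norm y ^ Suc k) * y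
      = of_real (norm x) * (?f x - ?f y) + of_real (norm x - norm y) * ?f y"
    by (simp add: algebra_simps)
  also have "norm \<dots> \<le> norm (of_real (norm x) * (?f x - ?f y)) + norm (of_real (norm x - norm y) * ?f y)"
    by (rule norm_triangle_ineq)
  also have "\<dots> = norm x * norm (?f x - ?f y) + \<bar>norm x - norm y\<bar> * (norm y ^ k * norm y)"
    by (simp only: norm_mult norm_of_real abs_norm_cancel) (simp add: norm_power)
  also have "\<dots> \<le> M * ((real k + 1) * M ^ k * norm (x - y)) + norm (x - y) * (M ^ k * M)"
    using assms M Suc by (intro add_mono mult_mono norm_triangle_ineq3 power_mono) auto
  also have "\<dots> = (real (Suc k) + 1) * M ^ Suc k * norm (x - y)" by (simp add: algebra_simps)
  finally show ?case .
qed simp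

text \<open>Boundedness makes the product square integrable, so \<open>to_L2\<close> does not take
  its dummy value.\<close>

lemma rep_nonlin:
  fixes u :: "(real \<times> real) L2"
  assumes u: "AE z in lborel. norm (rep_L2 u z) \<le> M"
  shows "AE z in lborel. rep_L2 (nonlin \<sigma> u) z = of_real (norm (rep_L2 u z) ^ (2 * \<sigma>)) * rep_L2 u z"
  unfolding nonlin_def
proof (rule rep_to_L2)
  have i: "integrable lborel (\<lambda>z. (M ^ (2 * \<sigma>))\<^sup>2 * (norm (rep_L2 u z))\<^sup>2)"
    using sq_integrable_rep[of u] by (intro integrable_mult_right) (simp add: sq_integrable_def)
  have "integrable lborel (\<lambda>z. (norm (of_real (norm (rep_L2 u z) ^ (2 * \<sigma>)) * rep_L2 u z))\<^sup>2)"
  proof (rule Bochner_Integration.integrable_bound[OF i])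
    show "AE z in lborel. norm ((norm (of_real (norm (rep_L2 u z) ^ (2 * \<sigma>)) * rep_L2 u z))\<^sup>2)
        \<le> norm ((M ^ (2 * \<sigma>))\<^sup>2 * (norm (rep_L2 u z))\<^sup>2)"
      using u
    proof eventually_elim
      case (elim z)
      have "(norm (rep_L2 u z) ^ (2 * \<sigma>))\<^sup>2 \<le> (M ^ (2 * \<sigma>))\<^sup>2"
        using elim by (intro power_mono) auto
      then show ?case
        by (simp add: norm_mult norm_power power_mult_distrib mult_right_mono)
    qed
  qed measurable
  then show "sq_integrable (\<lambda>z. complex_of_real (norm (rep_L2 u z) ^ (2 * \<sigma>)) * rep_L2 u z)"
    by (simp add: sq_integrable_def)
qed

lemma nonlin_lipschitz:
  fixes u v :: "(real \<times> real) L2"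
  assumes u: "AE z in lborel. norm (rep_L2 u z) \<le> M" and v: "AE z in lborel. norm (rep_L2 v z) \<le> M" and M: "M \<ge> 0"
  shows "norm (nonlin \<sigma> u - nonlin \<sigma> v) \<le> (real (2 * \<sigma>) + 1) * M ^ (2 * \<sigma>) * norm (u - v)"
proof (rule AE_cnorm_le_imp_norm_le)
  show "AE z in lborel. norm (rep_L2 (nonlin \<sigma> u - nonlin \<sigma> v) z) \<le> (real (2 * \<sigma>) + 1) * M ^ (2 * \<sigma>) * norm (rep_L2 (u - v) z)"
    using rep_nonlin[OF u, of \<sigma>] rep_nonlin[OF v, of \<sigma>] rep_minus[of "nonlin \<sigma> u" "nonlin \<sigma> v"] rep_minus[of u v] u v
  proof eventually_elim
    case (elim z)
    then show ?case using norm_power_mult_diff_le[OF elim(5) elim(6), of "2 * \<sigma>"] by simp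
  qed
qed (use M in simp)

lemma nonlin_phase:
  fixes u :: "(real \<times> real) L2"
  assumes u: "AE z in lborel. norm (rep_L2 u z) \<le> M" and c: "norm c = 1"
  shows "nonlin \<sigma> (c *\<^sub>C u) = c *\<^sub>C nonlin \<sigma> u"
proof (rule L2_eqI)
  have cu: "AE z in lborel. norm (rep_L2 (c *\<^sub>C u) z) \<le> M"
    using rep_scaleC[of c u] u by eventually_elim (simp add: norm_mult c)
  show "AE z in lborel. rep_L2 (nonlin \<sigma> (c *\<^sub>C u)) z = rep_L2 (c *\<^sub>C nonlin \<sigma> u) z"
    using rep_nonlin[OF cu, of \<sigma>] rep_nonlin[OF u, of \<sigma>] rep_scaleC[of c u] rep_scaleC[of c "nonlin \<sigma> u"]
    by eventually_elim (simp add: norm_mult c)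
qed

context oscillator
begin

text \<open>A bound on the whole orbit, uniform in \<theta>. Elements of \<Sigma>^2 have one by
  \<open>Sigma2_U_bounded\<close>, and so do bounded functions in a single mode, whose orbit
  consists of phase multiples. On this common ground the two candidate solutions are
  compared.\<close>

definition U_bounded_by :: "real \<Rightarrow> (real \<times> real) L2 \<Rightarrow> bool" where
  "U_bounded_by M u \<longleftrightarrow> M \<ge> 0 \<and> (\<forall>\<theta>. AE z in lborel. norm (rep_L2 (plane.U \<theta> u) z) \<le> M)"

lemma U_scaleC: "plane.U \<theta> (c *\<^sub>C u) = c *\<^sub>C plane.U \<theta> u"
  using plane.unitary_group_U unfolding unitary_group_def by auto

lemma U_minus: "plane.U \<theta> (u - v) = plane.U \<theta> u - plane.U \<theta> v"
  by (rule plane.eqI) (simp add: plane.P_diff plane.P_U scaleC_diff_right)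

definition integrand :: "nat \<Rightarrow> (real \<times> real) L2 \<Rightarrow> real \<Rightarrow> (real \<times> real) L2" where
  "integrand \<sigma> u \<theta> = plane.U (- \<theta>) (nonlin \<sigma> (plane.U \<theta> u))"

lemma F_av_eq: "F_av b \<sigma> u = (b / (2 * pi)) *\<^sub>R integral {0 .. 2 * pi / b} (integrand \<sigma> u)"
  unfolding F_av_def integrand_def exp_group_H_plane ..

text \<open>The variable \<theta> enters through the outer and the inner group. The inner change is
  controlled by isometry of the outer group and the Lipschitz bound, the outer change by strong
  continuity at the fixed vector \<open>?x\<close>.\<close>

lemma continuous_integrand:
  assumes u: "U_bounded_by M u"
  shows "continuous_on A (integrand \<sigma> u)"
proof -
  have M: "M \<ge> 0" and bd: "AE z in lborel. norm (rep_L2 (plane.U \<theta> u) z) \<le> M" for \<theta>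
    using u by (auto simp: U_bounded_by_def)
  have cont: "((\<lambda>\<theta>. plane.U \<theta> w) \<longlongrightarrow> plane.U \<eta> w) (at \<eta>)" for w \<eta>
    using plane.U_continuous[of w] by (simp add: continuous_on_eq_continuous_at isCont_def)
  have "isCont (integrand \<sigma> u) \<eta>" for \<eta>
    unfolding isCont_def
  proof (rule LIM_zero_cancel)
    let ?x = "nonlin \<sigma> (plane.U \<eta> u)" and ?L = "(real (2 * \<sigma>) + 1) * M ^ (2 * \<sigma>)"
    have le: "norm (integrand \<sigma> u \<theta> - integrand \<sigma> u \<eta>)
        \<le> ?L * norm (plane.U \<theta> u - plane.U \<eta> u) + norm (plane.U (- \<theta>) ?x - plane.U (- \<eta>) ?x)" for \<theta>
    proof -
      have "integrand \<sigma> u \<theta> - integrand \<sigma> u \<eta>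
          = plane.U (- \<theta>) (nonlin \<sigma> (plane.U \<theta> u) - ?x) + (plane.U (- \<theta>) ?x - plane.U (- \<eta>) ?x)"
        by (simp add: integrand_def U_minus)
      then have "norm (integrand \<sigma> u \<theta> - integrand \<sigma> u \<eta>)
          \<le> norm (nonlin \<sigma> (plane.U \<theta> u) - ?x) + norm (plane.U (- \<theta>) ?x - plane.U (- \<eta>) ?x)"
        using norm_triangle_ineq[of "plane.U (- \<theta>) (nonlin \<sigma> (plane.U \<theta> u) - ?x)"] by (simp add: plane.norm_U)
      then show ?thesis using nonlin_lipschitz[OF bd[of \<theta>] bd[of \<eta>] M, of \<sigma>] by linarith
    qed
    have "((\<lambda>\<theta>. plane.U (- \<theta>) ?x) \<longlongrightarrow> plane.U (- \<eta>) ?x) (at \<eta>)"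
      using plane.U_continuous[of ?x]
      by (intro isCont_tendsto_compose[of "- \<eta>" "\<lambda>\<theta>. plane.U \<theta> ?x"] tendsto_intros)
         (simp add: continuous_on_eq_continuous_at)
    then have "((\<lambda>\<theta>. ?L * norm (plane.U \<theta> u - plane.U \<eta> u) + norm (plane.U (- \<theta>) ?x - plane.U (- \<eta>) ?x)) \<longlongrightarrow> ?L * 0 + 0) (at \<eta>)"
      using cont[where w = u and \<eta> = \<eta>]
      by (intro tendsto_intros tendsto_norm_zero LIM_zero) auto
    then have lim: "((\<lambda>\<theta>. ?L * norm (plane.U \<theta> u - plane.U \<eta> u) + norm (plane.U (- \<theta>) ?x - plane.U (- \<eta>) ?x)) \<longlongrightarrow> 0) (at \<eta>)"
      by (simp only: mult_zero_right add_0_right)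
    show "((\<lambda>\<theta>. integrand \<sigma> u \<theta> - integrand \<sigma> u \<eta>) \<longlongrightarrow> 0) (at \<eta>)"
      by (rule Lim_null_comparison[OF always_eventually[OF allI[OF le]] lim])
  qed
  then show ?thesis by (intro continuous_at_imp_continuous_on ballI)
qed

text \<open>Both group factors are isometries, so the Lipschitz constant of \<open>nonlin\<close>
  survives; the prefactor cancels the length 2 pi/b of the interval.\<close>

lemma F_av_lipschitz:
  assumes u: "U_bounded_by M u" and v: "U_bounded_by M v"
  shows "norm (F_av b \<sigma> u - F_av b \<sigma> v) \<le> (real (2 * \<sigma>) + 1) * M ^ (2 * \<sigma>) * norm (u - v)"
proof -
  let ?L = "(real (2 * \<sigma>) + 1) * M ^ (2 * \<sigma>)" and ?I = "{0 .. 2 * pi / b}"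
  have M: "M \<ge> 0" using u by (simp add: U_bounded_by_def)
  have T: "0 \<le> 2 * pi / b" using b_pos by simp
  have le: "norm (integrand \<sigma> u \<theta> - integrand \<sigma> v \<theta>) \<le> ?L * norm (u - v)" for \<theta>
  proof -
    have "norm (integrand \<sigma> u \<theta> - integrand \<sigma> v \<theta>) = norm (nonlin \<sigma> (plane.U \<theta> u) - nonlin \<sigma> (plane.U \<theta> v))"
      by (simp add: integrand_def plane.norm_U flip: U_minus)
    also have "\<dots> \<le> ?L * norm (plane.U \<theta> u - plane.U \<theta> v)"
      using u v M by (intro nonlin_lipschitz) (auto simp: U_bounded_by_def)
    also have "\<dots> = ?L * norm (u - v)" by (simp add: plane.norm_U flip: U_minus)
    finally show ?thesis .
  qed
  have c: "continuous_on ?I (integrand \<sigma> u)" "continuous_on ?I (integrand \<sigma> v)"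
    using continuous_integrand u v by blast+
  have "F_av b \<sigma> u - F_av b \<sigma> v = (b / (2 * pi)) *\<^sub>R integral ?I (\<lambda>\<theta>. integrand \<sigma> u \<theta> - integrand \<sigma> v \<theta>)"
    unfolding F_av_eq using c
    by (subst Henstock_Kurzweil_Integration.integral_diff) (auto intro: integrable_continuous_interval simp: scaleR_diff_right)
  then have "norm (F_av b \<sigma> u - F_av b \<sigma> v) = b / (2 * pi) * norm (integral ?I (\<lambda>\<theta>. integrand \<sigma> u \<theta> - integrand \<sigma> v \<theta>))"
    using b_pos by simp
  also have "\<dots> \<le> b / (2 * pi) * (?L * norm (u - v) * (2 * pi / b - 0))"
    using b_pos by (intro mult_left_mono integral_bound T continuous_on_diff c le) auto
  also have "\<dots> = ?L * norm (u - v)" using b_pos by simp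
  finally show ?thesis .
qed

section \<open>Averaging over a period and the resonant mode\<close>

text \<open>All energy gaps are integer multiples of b, so an interval of length 2 pi/b consists of
  whole periods of every nonresonant phase.\<close>

lemma integral_cis_energy:
  "integral {0 .. 2 * pi / b} (\<lambda>\<theta>. cis ((energy k - energy n) * \<theta>)) = (if k = n then of_real (2 * pi / b) else 0)"
proof (cases "k = n")
  case True
  then show ?thesis using b_pos by (simp add: scaleR_conv_of_real)
next
  case False
  define m where "m = energy k - energy n"
  have m: "m \<noteq> 0" "m = b * (real k - real n)" using False energy_inj[of k n] by (auto simp: m_def energy_def algebra_simps)
  have "((\<lambda>\<theta>. cis (m * \<theta>)) has_integral (cis (m * (2 * pi / b)) / (\<i> * of_real m) - cis (m * 0) / (\<i> * of_real m))) {0 .. 2 * pi / b}"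
  proof (rule fundamental_theorem_of_calculus)
    show "0 \<le> 2 * pi / b" using b_pos by simp
    fix x :: real
    have "((\<lambda>\<theta>. cis (m * \<theta>) / (\<i> * of_real m)) has_vector_derivative (\<i> * of_real m * cis (m * x)) / (\<i> * of_real m)) (at x)"
      by (rule has_vector_derivative_divide[OF cis_derivative])
    then show "((\<lambda>\<theta>. cis (m * \<theta>) / (\<i> * of_real m)) has_vector_derivative cis (m * x)) (at x within {0 .. 2 * pi / b})"
      using m by (simp add: has_vector_derivative_at_within)
  qed
  moreover have "cis (m * (2 * pi / b)) = 1"
  proof -
    have "m * (2 * pi / b) = 2 * pi * of_int (int k - int n)" using b_pos by (simp add: m(2) field_simps)
    then show ?thesis by (simp add: cis_multiple_2pi del: of_int_diff)
  qed
  ultimately show ?thesis using False by (simp add: m_def integral_unique)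
qed

text \<open>On one mode the inner group is a phase, which passes through \<open>nonlin\<close> by
  gauge invariance. Together with the outer group it makes the k-th component rotate with frequency
  \<open>energy k - energy n\<close>, and averaging keeps k = n.\<close>

lemma F_av_eigenvector:
  assumes e: "proj n e = e" and bd: "AE z in lborel. norm (rep_L2 e z) \<le> M"
  shows "F_av b \<sigma> e = proj n (nonlin \<sigma> e)"
proof (rule plane.eqI)
  fix k
  let ?I = "{0 .. 2 * pi / b}" and ?N = "nonlin \<sigma> e"
  have Ue: "plane.U \<theta> e = cis (- (energy n * \<theta>)) *\<^sub>C e" for \<theta>
    using plane.U_P[of \<theta> n e] e by simp
  \<comment> \<open>The given M carries no sign, whereas \<open>U_bounded_by\<close> includes
    nonnegativity.\<close>
  have "AE z in lborel. norm (rep_L2 e z) \<le> max 0 M" using bd by eventually_elim simp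
  then have "AE z in lborel. norm (rep_L2 (plane.U \<theta> e) z) \<le> max 0 M" for \<theta>
    unfolding Ue using rep_scaleC[of "cis (- (energy n * \<theta>))" e] by eventually_elim (simp add: norm_mult)
  then have "U_bounded_by (max 0 M) e" by (simp add: U_bounded_by_def)
  then have int: "integrand \<sigma> e integrable_on ?I"
    by (intro integrable_continuous_interval continuous_integrand)
  have P: "proj k (integrand \<sigma> e \<theta>) = cis ((energy k - energy n) * \<theta>) *\<^sub>C proj k ?N" for \<theta>
    unfolding integrand_def Ue
    by (simp add: nonlin_phase[OF bd] plane.P_U plane.P_scaleC cis_mult algebra_simps)
  have ic: "(\<lambda>\<theta>. cis ((energy k - energy n) * \<theta>)) integrable_on ?I"
    by (intro integrable_continuous_interval continuous_at_imp_continuous_on ballI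
        has_vector_derivative_continuous[OF cis_derivative])
  have "proj k (F_av b \<sigma> e) = (b / (2 * pi)) *\<^sub>R integral ?I (proj k \<circ> integrand \<sigma> e)"
    unfolding F_av_eq plane.P_scaleR integral_linear[OF int plane.bounded_linear_P] ..
  also have "integral ?I (proj k \<circ> integrand \<sigma> e) = integral ?I ((\<lambda>c. c *\<^sub>C proj k ?N) \<circ> (\<lambda>\<theta>. cis ((energy k - energy n) * \<theta>)))"
    by (simp add: comp_def P)
  also have "\<dots> = (if k = n then of_real (2 * pi / b) else 0) *\<^sub>C proj k ?N"
    unfolding integral_linear[OF ic bounded_bilinear.bounded_linear_left[OF bounded_bilinear_scaleC]] integral_cis_energy ..
  also have "(b / (2 * pi)) *\<^sub>R \<dots> = (if k = n then proj k ?N else 0)"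
    using b_pos by (simp add: scaleR_eq_scaleC flip: of_real_mult)
  finally show "proj k (F_av b \<sigma> e) = proj k (proj n ?N)" by (simp add: plane.P_P)
qed

definition herm_moment :: "nat \<Rightarrow> nat \<Rightarrow> real" where
  "herm_moment n \<sigma> = (LINT x|lborel. \<bar>herm n x\<bar> ^ (2 * \<sigma> + 2))"

lemma proj_tensor:
  assumes "AE z in lborel. rep_L2 e z = tensor_herm n g z" and g: "sq_integrable g"
  shows "proj n e = e"
proof (rule L2_eqI)
  have "AE y in lborel. hcoef n (rep_L2 e) y = hcoef n (tensor_herm n g) y"
    using sq_integrable_tensor_herm[OF g, of n] by (intro hcoef_cong assms) (auto simp: sq_integrable_def)
  then have "AE y in lborel. hcoef n (rep_L2 e) y = g y" by (simp add: hcoef_tensor)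
  from proj_eqI[OF this] show "AE z in lborel. rep_L2 (proj n e) z = rep_L2 e z"
    using assms(1) by eventually_elim simp
qed

text \<open>With y fixed, the factor |g|^(2\<sigma>) g leaves the integral in x, and the n-th
  coefficient of |h g|^(2\<sigma>) h g is the integral of |h|^(2\<sigma>+2) times this
  factor.\<close>

lemma rep_F_av_tensor:
  assumes e: "AE z in lborel. rep_L2 e z = tensor_herm n g z" and g: "sq_integrable g"
    and bd: "AE z in lborel. norm (rep_L2 e z) \<le> M"
  shows "AE z in lborel. rep_L2 (F_av b \<sigma> e) z = of_real (herm_moment n \<sigma> * norm (g (snd z)) ^ (2 * \<sigma>)) * rep_L2 e z"
proof -
  let ?f = "\<lambda>z. of_real (norm (tensor_herm n g z) ^ (2 * \<sigma>)) * tensor_herm n g z"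
  have "tensor_herm n g \<in> borel_measurable borel"
    using sq_integrable_tensor_herm[OF g, of n] by (simp add: sq_integrable_def)
  then have m: "?f \<in> borel_measurable borel" by measurable
  have "AE z in lborel. rep_L2 (nonlin \<sigma> e) z = ?f z"
    using rep_nonlin[OF bd, of \<sigma>] e by eventually_elim simp
  then have "AE y in lborel. hcoef n (rep_L2 (nonlin \<sigma> e)) y = hcoef n ?f y"
    by (intro hcoef_cong m) simp_all
  moreover have "hcoef n ?f y = of_real (herm_moment n \<sigma> * norm (g y) ^ (2 * \<sigma>)) * g y" for y
  proof -
    have "herm n x *\<^sub>R ?f (x, y) = of_real (\<bar>herm n x\<bar> ^ (2 * \<sigma> + 2)) * (of_real (norm (g y) ^ (2 * \<sigma>)) * g y)" for x
    proof -
      \<comment> \<open>Replaces the two real factors \<open>herm n x\<close> by their moduli,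
        raising the power from \<open>2 * \<sigma>\<close> to
        \<open>2 * \<sigma> + 2\<close>.\<close>
      have "complex_of_real (herm n x) * complex_of_real (herm n x) = complex_of_real \<bar>herm n x\<bar> * complex_of_real \<bar>herm n x\<bar>"
        by (simp flip: of_real_mult)
      then show ?thesis
        by (simp add: tensor_herm_def scaleR_conv_of_real norm_mult power_mult_distrib mult_ac)
    qed
    then show ?thesis
      unfolding hcoef_def herm_moment_def by (simp only: integral_mult_left_zero integral_complex_of_real) simp
  qed
  ultimately have "AE y in lborel. hcoef n (rep_L2 (nonlin \<sigma> e)) y = of_real (herm_moment n \<sigma> * norm (g y) ^ (2 * \<sigma>)) * g y"
    by simp
  from proj_eqI[OF this]
  show ?thesis
    unfolding F_av_eigenvector[OF proj_tensor[OF e g] bd] using e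
    by eventually_elim (simp add: tensor_herm_def)
qed

end

section \<open>The explicit solution\<close>

text \<open>The weight exp(-2At) makes |D|^2 nonincreasing; working with the square avoids the point
  0, where the norm is not differentiable.\<close>

lemma gronwall_zero:
  fixes D :: "real \<Rightarrow> 'a::real_inner"
  assumes T: "T \<ge> 0" and D: "\<And>t. t \<in> {0..T} \<Longrightarrow> (D has_vector_derivative D' t) (at t within {0..T})"
    and le: "\<And>t. t \<in> {0..T} \<Longrightarrow> norm (D' t) \<le> A * norm (D t)" and D0: "D 0 = 0"
  shows "D T = 0"
proof -
  define E where "E t = (D t \<bullet> D t) * exp (- (2 * A) * t)" for t
  have cont: "continuous_on {0..T} D"
    unfolding continuous_on_eq_continuous_within using D has_vector_derivative_continuous by blast
  have "E T \<le> E 0"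
  proof (rule DERIV_nonpos_imp_decreasing_open[OF T])
    show "continuous_on {0..T} E" unfolding E_def by (intro continuous_intros cont)
    fix t assume t: "0 < t" "t < T"
    have "(D has_vector_derivative D' t) (at t)"
      using D[of t] t at_within_Icc_at[of 0 t T] by simp
    then have DD: "((\<lambda>t. D t \<bullet> D t) has_real_derivative D t \<bullet> D' t + D' t \<bullet> D t) (at t)"
      unfolding has_real_derivative_iff_has_vector_derivative
      by (intro bounded_bilinear.has_vector_derivative[OF bounded_bilinear_inner])
    have "((\<lambda>t. exp (- (2 * A) * t)) has_real_derivative exp (- (2 * A) * t) * (- (2 * A))) (at t)"
      by (auto intro!: derivative_eq_intros)
    from DERIV_mult[OF DD this]
    have "(E has_real_derivative (D t \<bullet> D' t + D' t \<bullet> D t) * exp (- (2 * A) * t)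
        + exp (- (2 * A) * t) * (- (2 * A)) * (D t \<bullet> D t)) (at t)" unfolding E_def .
    moreover have "(D t \<bullet> D' t + D' t \<bullet> D t) * exp (- (2 * A) * t) + exp (- (2 * A) * t) * (- (2 * A)) * (D t \<bullet> D t)
        = 2 * exp (- (2 * A) * t) * (D t \<bullet> D' t - A * (D t \<bullet> D t))"
      by (simp add: inner_commute algebra_simps)
    moreover have "D t \<bullet> D' t \<le> A * (D t \<bullet> D t)"
    proof -
      have "D t \<bullet> D' t \<le> norm (D t) * norm (D' t)" by (rule norm_cauchy_schwarz)
      also have "\<dots> \<le> norm (D t) * (A * norm (D t))" using le[of t] t by (intro mult_left_mono) auto
      finally show ?thesis by (simp add: dot_square_norm power2_eq_square mult_ac)
    qed
    ultimately show "\<exists>y. (E has_real_derivative y) (at t) \<and> y \<le> 0"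
      by (auto intro!: exI mult_nonneg_nonpos)
  qed
  then have "D T \<bullet> D T \<le> 0" by (simp add: E_def D0 mult_le_0_iff)
  then show ?thesis by (simp add: dot_square_norm)
qed

lemma norm_cis_taylor: "norm (cis x - 1 - \<i> * of_real x) \<le> x\<^sup>2"
proof -
  have "norm (cis x - 1 - \<i> * of_real x) = norm (iexp x - (\<Sum>k\<le>1. (\<i> * x) ^ k / fact k))"
    by (simp add: cis_conv_exp diff_diff_eq)
  also have "\<dots> \<le> \<bar>x\<bar> ^ Suc 1 / fact (Suc 1)" by (rule iexp_approx1)
  also have "\<dots> \<le> x\<^sup>2" by (simp add: power2_eq_square flip: abs_mult)
  finally show ?thesis .
qed

context oscillator
begin

text \<open>Pairing with \<open>herm j\<close> makes the coefficient \<open>a j\<close> vanish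
  unless j = n, because the energies are distinct; the rest is then zero by totality. The phase c is
  the freedom left in a normalized eigenfunction.\<close>

lemma eigenfunction_line:
  assumes chi: "harm_osc b 1 chi (energy n *\<^sub>R chi)" and nrm: "norm chi = 1"
  obtains c where "norm c = 1" "AE x in lborel. rep_L2 chi x = c * complex_of_real (herm n x)"
proof -
  let ?u = "rep_L2 chi" and ?v = "rep_L2 (energy n *\<^sub>R chi)"
  have gu: "gauss_integrable (rep_L2 w)" for w :: "real L2"
    by (rule gauss_integrable_sq_line) simp_all
  define a where "a j = (LINT x|lborel. herm j x *\<^sub>R ?u x)" for j
  have "(LINT x|lborel. herm j x *\<^sub>R ?v x) = energy j *\<^sub>R a j" for j
    unfolding a_def
  proof (rule weak_oscillator_line[OF gu gu])
    fix f :: "real \<Rightarrow> real" assume f: "test_function f"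
    show "(LINT x|lborel. (- (1/2) * deriv (deriv f) x + (1/2) * b\<^sup>2 * x\<^sup>2 * f x) *\<^sub>R ?u x) = (LINT x|lborel. f x *\<^sub>R ?v x)"
      using chi[unfolded harm_osc_def, rule_format, OF f] by (simp add: dir_deriv_real)
  qed
  moreover have "(LINT x|lborel. herm j x *\<^sub>R ?v x) = energy n *\<^sub>R a j" for j
  proof -
    have "(LINT x|lborel. herm j x *\<^sub>R ?v x) = (LINT x|lborel. energy n *\<^sub>R (herm j x *\<^sub>R ?u x))"
      by (rule integral_cong_AE) (use rep_scaleR[of "energy n" chi] in \<open>auto elim!: eventually_mono simp: mult.commute\<close>)
    then show ?thesis unfolding a_def by (simp only: integral_scaleR_right)
  qed
  ultimately have "energy j *\<^sub>R a j = energy n *\<^sub>R a j" for j by metis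
  then have aj: "a j = 0" if "j \<noteq> n" for j
    using that energy_inj[of j n] by (metis scaleR_right_imp_eq)
  have gh: "gauss_integrable (\<lambda>x. complex_of_real (herm n x))"
    by (rule gauss_integrable_sq_line) (auto intro: sq_integrable_herm)
  have gw: "gauss_integrable (\<lambda>x. ?u x - a n * complex_of_real (herm n x))"
    by (intro gauss_integrable_diff gauss_integrable_cmult gu gh)
  have ae: "AE x in lborel. ?u x - a n * complex_of_real (herm n x) = 0"
  proof (rule hermite_total[OF gw])
    fix j
    have i: "integrable lborel (\<lambda>x. herm j x * herm n x)" unfolding herm_def by (rule integrable_pg_mult)
    have i2: "integrable lborel (\<lambda>x. (herm j x * herm n x) *\<^sub>R a n)" using i by simp
    have "(LINT x|lborel. herm j x *\<^sub>R (?u x - a n * complex_of_real (herm n x)))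
        = (LINT x|lborel. herm j x *\<^sub>R ?u x - (herm j x * herm n x) *\<^sub>R a n)"
      by (simp add: scaleR_conv_of_real algebra_simps)
    also have "\<dots> = a j - (LINT x|lborel. herm j x * herm n x) *\<^sub>R a n"
      using integrable_gauss_bounded[OF gu gauss_bounded_herm] i i2 by (simp add: a_def)
    also have "\<dots> = 0" using aj[of j] by (simp add: herm_orthonormal)
    finally show "(LINT x|lborel. herm j x *\<^sub>R (?u x - a n * complex_of_real (herm n x))) = 0" .
  qed
  have "1 = (LINT x|lborel. (norm (?u x))\<^sup>2)" using norm_L2_sq[of chi] nrm by simp
  also have "\<dots> = (LINT x|lborel. (norm (a n))\<^sup>2 * (herm n x)\<^sup>2)"
    by (rule integral_cong_AE) (use ae in \<open>auto elim!: eventually_mono simp: norm_mult power_mult_distrib\<close>)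
  also have "\<dots> = (norm (a n))\<^sup>2" by (simp add: herm_sq)
  finally have "norm (a n) = 1" by (metis norm_ge_zero one_power2 power2_eq_iff_nonneg zero_le_one)
  moreover have "AE x in lborel. ?u x = a n * complex_of_real (herm n x)" using ae by eventually_elim simp
  ultimately show ?thesis by (rule that)
qed

text \<open>The trace of the continuous representative is bounded and measurable, so
  \<open>to_L2\<close> does not take its dummy value.\<close>

lemma rep_mult_trace:
  assumes lam: "W_infty 15 lam"
  shows "AE z in lborel. rep_L2 (mult_trace lam u) z = of_real (continuous_rep lam (0, snd z)) * rep_L2 u z"
  unfolding mult_trace_def
proof (rule rep_to_L2)
  obtain C where C: "\<And>z. \<bar>continuous_rep lam z\<bar> \<le> C" using continuous_rep_bounded(2)[OF lam] by blast
  have "continuous_on UNIV (\<lambda>z::real \<times> real. continuous_rep lam (0, snd z))"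
    by (rule continuous_on_compose2[OF continuous_rep_bounded(1)[OF lam]]) (auto intro!: continuous_intros)
  then have [measurable]: "(\<lambda>z::real \<times> real. continuous_rep lam (0, snd z)) \<in> borel_measurable borel"
    by (rule borel_measurable_continuous_onI)
  have "integrable lborel (\<lambda>z. (norm (of_real (continuous_rep lam (0, snd z)) * rep_L2 u z))\<^sup>2)"
  proof (rule Bochner_Integration.integrable_bound)
    show "integrable lborel (\<lambda>z. C\<^sup>2 * (norm (rep_L2 u z))\<^sup>2)"
      using sq_integrable_rep[of u] by (intro integrable_mult_right) (simp add: sq_integrable_def)
    have "(continuous_rep lam (0, snd z))\<^sup>2 \<le> C\<^sup>2" for z :: "real \<times> real"
      using C[of "(0, snd z)"] by (metis abs_ge_zero power2_abs power_mono)
    then show "AE z in lborel. norm ((norm (complex_of_real (continuous_rep lam (0, snd z)) * rep_L2 u z))\<^sup>2) \<le> norm (C\<^sup>2 * (norm (rep_L2 u z))\<^sup>2)"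
      by (intro AE_I2) (simp add: norm_mult power_mult_distrib mult_right_mono)
  qed measurable
  then show "sq_integrable (\<lambda>z. complex_of_real (continuous_rep lam (0, snd z)) * rep_L2 u z)"
    by (simp add: sq_integrable_def)
qed

lemma mult_trace_lipschitz:
  assumes lam: "W_infty 15 lam" and C: "\<And>z. \<bar>continuous_rep lam z\<bar> \<le> C"
  shows "norm (mult_trace lam u - mult_trace lam v) \<le> C * norm (u - v)"
proof (rule AE_cnorm_le_imp_norm_le)
  show "C \<ge> 0" using C[of 0] by simp
  show "AE z in lborel. norm (rep_L2 (mult_trace lam u - mult_trace lam v) z) \<le> C * norm (rep_L2 (u - v) z)"
    using rep_mult_trace[OF lam, of u] rep_mult_trace[OF lam, of v] rep_minus[of "mult_trace lam u" "mult_trace lam v"] rep_minus[of u v]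
  proof eventually_elim
    case (elim z)
    then have "norm (rep_L2 (mult_trace lam u - mult_trace lam v) z) = \<bar>continuous_rep lam (0, snd z)\<bar> * norm (rep_L2 (u - v) z)"
      by (simp add: norm_mult flip: right_diff_distrib)
    also have "\<dots> \<le> C * norm (rep_L2 (u - v) z)" by (intro mult_right_mono C) simp
    finally show ?case .
  qed
qed

text \<open>Turns the limit in the \<Sigma>^2 norm into a vector derivative of the triple. Its first
  component is the derivative in L2, and the resulting continuity bounds the \<Sigma>^2 norm on
  compact time intervals.\<close>

lemma C1_Sigma2_triple_derivative:
  assumes C1: "C1_Sigma2 b J \<phi> \<phi>'" and t: "t \<in> J"
  shows "((\<lambda>s. triple (\<phi> s)) has_vector_derivative triple (\<phi>' t)) (at t within J)"
proof -
  have mem: "\<phi> s \<in> Sigma2 b" "\<phi>' s \<in> Sigma2 b" if "s \<in> J" for s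
    using C1 that unfolding C1_Sigma2_def by auto
  have lim: "((\<lambda>s. Sigma2_norm b ((1 / (s - t)) *\<^sub>R (\<phi> s - \<phi> t) - \<phi>' t)) \<longlongrightarrow> 0) (at t within J)"
    using C1 t unfolding C1_Sigma2_def by blast
  let ?R = "\<lambda>s. (1 / norm (s - t)) *\<^sub>R (triple (\<phi> s) - (triple (\<phi> t) + (s - t) *\<^sub>R triple (\<phi>' t)))"
  have "eventually (\<lambda>s. norm (?R s) \<le> Sigma2_norm b ((1 / (s - t)) *\<^sub>R (\<phi> s - \<phi> t) - \<phi>' t)) (at t within J)"
    unfolding eventually_at_filter
  proof (intro always_eventually allI impI)
    fix s assume s: "s \<noteq> t" "s \<in> J"
    have "triple ((1 / (s - t)) *\<^sub>R (\<phi> s - \<phi> t) - \<phi>' t) = (1 / (s - t)) *\<^sub>R (triple (\<phi> s) - triple (\<phi> t)) - triple (\<phi>' t)"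
      using mem[OF s(2)] mem[OF t] by (simp add: Sigma2_diff Sigma2_scaleR)
    also have "\<dots> = (1 / (s - t)) *\<^sub>R (triple (\<phi> s) - (triple (\<phi> t) + (s - t) *\<^sub>R triple (\<phi>' t)))"
      using s by (simp add: scaleR_diff_right scaleR_add_right)
    finally have "Sigma2_norm b ((1 / (s - t)) *\<^sub>R (\<phi> s - \<phi> t) - \<phi>' t) = norm (?R s)"
      unfolding Sigma2_norm_eq by simp
    then show "norm (?R s) \<le> Sigma2_norm b ((1 / (s - t)) *\<^sub>R (\<phi> s - \<phi> t) - \<phi>' t)" by simp
  qed
  then have "(?R \<longlongrightarrow> 0) (at t within J)" by (rule Lim_null_comparison[OF _ lim])
  then show ?thesis
    unfolding has_vector_derivative_def has_derivative_within by (simp add: bounded_linear_scaleR_left)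
qed

section \<open>The phase-rotated datum and its uniqueness\<close>

text \<open>The time of evaluation T is itself the end of the Gronwall interval, so all constants
  may depend on T and only the compact interval \<open>{0..T}\<close> matters.\<close>

theorem explicit_solution:
  fixes n \<sigma> :: nat and lam :: "real \<times> real \<Rightarrow> real" and T :: real
  assumes lam: "W_infty 15 lam" and \<psi>\<^sub>0: "\<psi>\<^sub>0 \<in> Sigma2 b"
    and \<beta>: "sq_integrable \<beta>" and rep\<psi>: "AE z in lborel. rep_L2 \<psi>\<^sub>0 z = tensor_herm n \<beta> z"
    and C1: "C1_Sigma2 b J \<phi> \<phi>'" and init: "\<phi> 0 = \<psi>\<^sub>0" and T: "T \<ge> 0" "{0..T} \<subseteq> J"
    and eq: "\<And>t. t \<in> {0..T} \<Longrightarrow> \<i> *\<^sub>C \<phi>' t = mult_trace lam (F_av b \<sigma> (\<phi> t))"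
  shows "AE z in lborel. rep_L2 (\<phi> T) z =
    cis (- (T * (continuous_rep lam (0, snd z) * norm (\<beta> (snd z)) ^ (2 * \<sigma>) * herm_moment n \<sigma>))) * tensor_herm n \<beta> z"
proof -
  define l where "l y = continuous_rep lam (0, y)" for y
  define \<kappa> where "\<kappa> = herm_moment n \<sigma>"
  define \<Omega> where "\<Omega> y = l y * norm (\<beta> y) ^ (2 * \<sigma>) * \<kappa>" for y
  have [measurable]: "\<beta> \<in> borel_measurable borel" using \<beta> by (simp add: sq_integrable_def)
  have "continuous_on UNIV l" unfolding l_def
    by (rule continuous_on_compose2[OF continuous_rep_bounded(1)[OF lam]]) (auto intro!: continuous_intros)
  then have [measurable]: "l \<in> borel_measurable borel" by (rule borel_measurable_continuous_onI)
  have [measurable]: "\<Omega> \<in> borel_measurable borel" unfolding \<Omega>_def by measurable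
  obtain \<Lambda> where \<Lambda>: "\<And>z. \<bar>continuous_rep lam z\<bar> \<le> \<Lambda>" using continuous_rep_bounded(2)[OF lam] by blast
  have \<Lambda>0: "\<Lambda> \<ge> 0" using \<Lambda>[of 0] by simp
  have U0: "plane.U 0 u = u" for u using plane.unitary_group_U unfolding unitary_group_def by auto
  \<comment> \<open>The orbit bound at \<theta> = 0; the maximum with 0 fixes the sign.\<close>
  define M\<^sub>0 where "M\<^sub>0 = max 0 (sup_const * Sigma2_norm b \<psi>\<^sub>0)"
  have bd0: "AE z in lborel. norm (rep_L2 \<psi>\<^sub>0 z) \<le> M\<^sub>0"
    using Sigma2_U_bounded[OF \<psi>\<^sub>0, of 0] by (auto simp: U0 M\<^sub>0_def elim!: eventually_mono)
  \<comment> \<open>Reflects that the amplitude \<beta>, being the n-th coefficient of the bounded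
    function \<open>\<psi>\<^sub>0\<close>, is bounded a.e. by \<open>M\<^sub>0\<close> times the L1
    norm of \<open>herm n\<close>.\<close>
  define W where "W = \<Lambda> * (M\<^sub>0 * (LINT x|lborel. \<bar>herm n x\<bar>)) ^ (2 * \<sigma>) * \<kappa>"
  have \<kappa>0: "\<kappa> \<ge> 0" by (simp add: \<kappa>_def herm_moment_def)
  have \<Omega>_le: "AE y in lborel. \<bar>\<Omega> y\<bar> \<le> W"
  proof -
    have th: "AE z in lborel. norm (tensor_herm n \<beta> z) \<le> M\<^sub>0"
      using bd0 rep\<psi> by eventually_elim simp
    show ?thesis
      using AE_plane_section[OF th]
    proof eventually_elim
      case (elim y)
      have ih: "integrable lborel (\<lambda>x. \<bar>herm n x\<bar>)" unfolding herm_def by (intro integrable_abs integrable_pg)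
      have "norm (\<beta> y) = norm (hcoef n (tensor_herm n \<beta>) y)" by (simp add: hcoef_tensor)
      also have "\<dots> \<le> (LINT x|lborel. norm (herm n x *\<^sub>R tensor_herm n \<beta> (x, y)))"
        unfolding hcoef_def by (rule integral_norm_bound)
      also have "\<dots> \<le> (LINT x|lborel. M\<^sub>0 * \<bar>herm n x\<bar>)"
      proof (rule integral_mono_AE)
        have "integrable lborel (\<lambda>x. (herm n x * herm n x) *\<^sub>R \<beta> y)"
          unfolding herm_def by (intro integrable_scaleR_left integrable_pg_mult)
        then show "integrable lborel (\<lambda>x. norm (herm n x *\<^sub>R tensor_herm n \<beta> (x, y)))"
          by (intro integrable_norm) (simp add: tensor_herm_def)
        show "AE x in lborel. norm (herm n x *\<^sub>R tensor_herm n \<beta> (x, y)) \<le> M\<^sub>0 * \<bar>herm n x\<bar>"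
          using elim
        proof eventually_elim
          case (elim x)
          have "\<bar>herm n x\<bar> * norm (tensor_herm n \<beta> (x, y)) \<le> \<bar>herm n x\<bar> * M\<^sub>0" by (intro mult_left_mono elim) simp
          then show ?case by (simp add: mult.commute)
        qed
      qed (intro integrable_mult_right ih)
      finally have "norm (\<beta> y) \<le> M\<^sub>0 * (LINT x|lborel. \<bar>herm n x\<bar>)" by simp
      then have "norm (\<beta> y) ^ (2 * \<sigma>) \<le> (M\<^sub>0 * (LINT x|lborel. \<bar>herm n x\<bar>)) ^ (2 * \<sigma>)" by (intro power_mono) auto
      then have "\<bar>l y\<bar> * norm (\<beta> y) ^ (2 * \<sigma>) * \<kappa> \<le> W"
        unfolding W_def using \<Lambda>[of "(0, y)"] \<Lambda>0 \<kappa>0 by (intro mult_right_mono mult_mono) (auto simp: l_def)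
      then show ?case using \<kappa>0 by (simp add: \<Omega>_def abs_mult)
    qed
  qed
  define g where "g t y = cis (- (t * \<Omega> y)) * \<beta> y" for t y
  have g: "sq_integrable (g t)" for t
    using \<beta> unfolding g_def cis_conv_exp by (simp add: sq_integrable_def norm_mult)
  define \<psi> where "\<psi> t = to_L2 (tensor_herm n (g t))" for t
  have rep\<psi>t: "AE z in lborel. rep_L2 (\<psi> t) z = tensor_herm n (g t) z" for t
    unfolding \<psi>_def by (intro rep_to_L2 sq_integrable_tensor_herm g)
  have tg: "tensor_herm n (g t) z = cis (- (t * \<Omega> (snd z))) * tensor_herm n \<beta> z" for t z
    by (simp add: tensor_herm_def g_def)
  have \<psi>_0: "\<psi> 0 = \<psi>\<^sub>0"
  proof (rule L2_eqI)
    show "AE z in lborel. rep_L2 (\<psi> 0) z = rep_L2 \<psi>\<^sub>0 z"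
      using rep\<psi>t[of 0] rep\<psi> by eventually_elim (simp add: tg)
  qed
  have bd: "AE z in lborel. norm (rep_L2 (\<psi> t) z) \<le> M\<^sub>0" for t
    using rep\<psi>t[of t] bd0 rep\<psi> by eventually_elim (simp add: tg norm_mult)
  have U\<psi>: "plane.U \<theta> (\<psi> t) = cis (- (energy n * \<theta>)) *\<^sub>C \<psi> t" for \<theta> t
    using plane.U_P[of \<theta> n "\<psi> t"] proj_tensor[OF rep\<psi>t g] by simp
  have ub\<psi>: "U_bounded_by M (\<psi> t)" if "M \<ge> M\<^sub>0" for M t
  proof -
    have "AE z in lborel. norm (rep_L2 (plane.U \<theta> (\<psi> t)) z) \<le> M" for \<theta>
      unfolding U\<psi> using rep_scaleC[of "cis (- (energy n * \<theta>))" "\<psi> t"] bd[of t]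
    proof eventually_elim
      case (elim z)
      then show ?case using that by (simp add: norm_mult)
    qed
    moreover have "M \<ge> 0" using that by (simp add: M\<^sub>0_def)
    ultimately show ?thesis by (simp add: U_bounded_by_def)
  qed
  define V where "V u = (- \<i>) *\<^sub>C mult_trace lam (F_av b \<sigma> u)" for u
  have repV: "AE z in lborel. rep_L2 (V (\<psi> t)) z = - \<i> * of_real (\<Omega> (snd z)) * rep_L2 (\<psi> t) z" for t
    unfolding V_def
    using rep_scaleC[of "- \<i>" "mult_trace lam (F_av b \<sigma> (\<psi> t))"] rep_mult_trace[OF lam, of "F_av b \<sigma> (\<psi> t)"]
      rep_F_av_tensor[OF rep\<psi>t[of t] g bd, of \<sigma>]
    by eventually_elim (simp add: \<Omega>_def l_def \<kappa>_def g_def norm_mult mult_ac)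
  have d\<psi>: "(\<psi> has_vector_derivative V (\<psi> t)) (at t)" for t
  proof -
    \<comment> \<open>The a.e. bound on \<Omega> makes the Taylor remainder of the phase quadratic
      in h uniformly in y; this gives differentiability in L2.\<close>
    have rem: "norm (\<psi> (t + h) - \<psi> t - h *\<^sub>R V (\<psi> t)) \<le> (h\<^sup>2 * W\<^sup>2) * norm (\<psi> t)" for h
    proof (rule AE_cnorm_le_imp_norm_le)
      show "AE z in lborel. norm (rep_L2 (\<psi> (t + h) - \<psi> t - h *\<^sub>R V (\<psi> t)) z) \<le> h\<^sup>2 * W\<^sup>2 * norm (rep_L2 (\<psi> t) z)"
        using rep_minus[of "\<psi> (t + h) - \<psi> t" "h *\<^sub>R V (\<psi> t)"] rep_minus[of "\<psi> (t + h)" "\<psi> t"]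
          rep_scaleR[of h "V (\<psi> t)"] repV[of t] rep\<psi>t[of t] rep\<psi>t[of "t + h"] AE_snd[OF \<Omega>_le]
      proof eventually_elim
        case (elim z)
        let ?x = "- (h * \<Omega> (snd z))"
        have "cis (- ((t + h) * \<Omega> (snd z))) = cis ?x * cis (- (t * \<Omega> (snd z)))"
          by (simp add: cis_mult algebra_simps)
        then have "rep_L2 (\<psi> (t + h) - \<psi> t - h *\<^sub>R V (\<psi> t)) z = (cis ?x - 1 - \<i> * of_real ?x) * rep_L2 (\<psi> t) z"
          using elim by (simp add: tg scaleR_conv_of_real algebra_simps)
        then have "norm (rep_L2 (\<psi> (t + h) - \<psi> t - h *\<^sub>R V (\<psi> t)) z) \<le> ?x\<^sup>2 * norm (rep_L2 (\<psi> t) z)"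
          using mult_right_mono[OF norm_cis_taylor[of ?x], of "norm (rep_L2 (\<psi> t) z)"] by (simp only: norm_mult norm_ge_zero)
        also have "?x\<^sup>2 \<le> h\<^sup>2 * W\<^sup>2"
          using elim(7) by (simp add: power_mult_distrib) (metis abs_ge_zero mult_left_mono power2_abs power_mono zero_le_power2)
        finally show ?case by (simp add: mult_right_mono)
      qed
    qed simp
    have "((\<lambda>h. norm (\<psi> (t + h) - \<psi> t - h *\<^sub>R V (\<psi> t)) / norm h) \<longlongrightarrow> 0) (at 0)"
    proof (rule Lim_null_comparison)
      show "eventually (\<lambda>h. norm (norm (\<psi> (t + h) - \<psi> t - h *\<^sub>R V (\<psi> t)) / norm h) \<le> \<bar>h\<bar> * (W\<^sup>2 * norm (\<psi> t))) (at 0)"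
        unfolding eventually_at_filter
      proof (intro always_eventually allI impI)
        fix h :: real assume "h \<noteq> 0"
        then have "norm (\<psi> (t + h) - \<psi> t - h *\<^sub>R V (\<psi> t)) / \<bar>h\<bar> \<le> (h\<^sup>2 * W\<^sup>2) * norm (\<psi> t) / \<bar>h\<bar>"
          by (intro divide_right_mono rem) simp
        also have "\<dots> = \<bar>h\<bar> * (W\<^sup>2 * norm (\<psi> t))"
          using \<open>h \<noteq> 0\<close> by (cases h "0::real" rule: linorder_cases) (simp_all add: power2_eq_square)
        finally show "norm (norm (\<psi> (t + h) - \<psi> t - h *\<^sub>R V (\<psi> t)) / norm h) \<le> \<bar>h\<bar> * (W\<^sup>2 * norm (\<psi> t))" by simp
      qed
      show "((\<lambda>h. \<bar>h\<bar> * (W\<^sup>2 * norm (\<psi> t))) \<longlongrightarrow> 0) (at 0)"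
        by (intro tendsto_mult_left_zero tendsto_rabs_zero tendsto_ident_at)
    qed
    then show ?thesis
      by (simp add: has_vector_derivative_def has_derivative_at bounded_linear_scaleR_left)
  qed
  have \<phi>V: "\<phi>' t = V (\<phi> t)" if "t \<in> {0..T}" for t
  proof -
    have "\<phi>' t = (- \<i>) *\<^sub>C (\<i> *\<^sub>C \<phi>' t)" by simp
    then show ?thesis unfolding V_def eq[OF that] .
  qed
  have dtriple: "((\<lambda>s. triple (\<phi> s)) has_vector_derivative triple (\<phi>' t)) (at t within {0..T})" if "t \<in> {0..T}" for t
    using C1_Sigma2_triple_derivative[OF C1, of t] that T(2) has_vector_derivative_within_subset by blast
  have d\<phi>: "(\<phi> has_vector_derivative V (\<phi> t)) (at t within {0..T})" if "t \<in> {0..T}" for t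
    using bounded_linear.has_vector_derivative[OF bounded_linear_fst dtriple[OF that]] \<phi>V[OF that]
    by (simp add: triple_def)
  \<comment> \<open>Continuity of the triple on a compact interval bounds the \<Sigma>^2 norm of
    \<phi>, and with it the orbits of all \<open>\<phi> t\<close>, uniformly in time.\<close>
  have "continuous_on {0..T} (\<lambda>s. triple (\<phi> s))"
    unfolding continuous_on_eq_continuous_within using dtriple has_vector_derivative_continuous by blast
  then have "bounded ((\<lambda>s. triple (\<phi> s)) ` {0..T})"
    by (intro compact_imp_bounded compact_continuous_image) auto
  then obtain N where N: "\<And>t. t \<in> {0..T} \<Longrightarrow> Sigma2_norm b (\<phi> t) \<le> N"
    unfolding Sigma2_norm_eq bounded_iff by blast
  \<comment> \<open>One radius for both solutions, since \<open>F_av_lipschitz\<close> compares two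
    vectors with the same orbit bound.\<close>
  define M where "M = max M\<^sub>0 (sup_const * N)"
  have M0: "M \<ge> M\<^sub>0" "M \<ge> 0" by (auto simp: M_def M\<^sub>0_def)
  have sc: "sup_const \<ge> 0" using b_pos by (simp add: sup_const_def)
  have ub\<phi>: "U_bounded_by M (\<phi> t)" if t: "t \<in> {0..T}" for t
  proof -
    have "\<phi> t \<in> Sigma2 b" using C1 t T(2) unfolding C1_Sigma2_def by blast
    moreover have "sup_const * Sigma2_norm b (\<phi> t) \<le> M"
      using mult_left_mono[OF N[OF t] sc] by (simp add: M_def)
    ultimately have "AE z in lborel. norm (rep_L2 (plane.U \<theta> (\<phi> t)) z) \<le> M" for \<theta>
      using Sigma2_U_bounded[of "\<phi> t" \<theta>] by (auto elim!: eventually_mono)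
    then show ?thesis using M0 by (simp add: U_bounded_by_def)
  qed
  define A where "A = \<Lambda> * ((real (2 * \<sigma>) + 1) * M ^ (2 * \<sigma>))"
  have "\<phi> T - \<psi> T = 0"
  proof (rule gronwall_zero[OF T(1)])
    fix t assume t: "t \<in> {0..T}"
    show "((\<lambda>t. \<phi> t - \<psi> t) has_vector_derivative V (\<phi> t) - V (\<psi> t)) (at t within {0..T})"
      by (intro has_vector_derivative_diff d\<phi> t has_vector_derivative_at_within[OF d\<psi>])
    have "norm (V (\<phi> t) - V (\<psi> t)) = norm (mult_trace lam (F_av b \<sigma> (\<phi> t)) - mult_trace lam (F_av b \<sigma> (\<psi> t)))"
      unfolding V_def by (simp add: norm_scaleC flip: scaleC_diff_right)
    also have "\<dots> \<le> \<Lambda> * norm (F_av b \<sigma> (\<phi> t) - F_av b \<sigma> (\<psi> t))"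
      by (rule mult_trace_lipschitz[OF lam \<Lambda>])
    also have "\<dots> \<le> \<Lambda> * ((real (2 * \<sigma>) + 1) * M ^ (2 * \<sigma>) * norm (\<phi> t - \<psi> t))"
      by (intro mult_left_mono F_av_lipschitz ub\<phi> t ub\<psi> M0 \<Lambda>0)
    finally show "norm (V (\<phi> t) - V (\<psi> t)) \<le> A * norm (\<phi> t - \<psi> t)" by (simp add: A_def mult_ac)
  qed (simp add: init \<psi>_0)
  then have "\<phi> T = \<psi> T" by simp
  then show ?thesis
    using rep\<psi>t[of T] by (simp add: tg \<Omega>_def l_def \<kappa>_def)
qed

end

section \<open>Return to the given eigenfunction and amplitude\<close>

theorem corollary1p3:
  fixes b :: real and \<sigma> n :: nat
    and lam :: "real \<times> real \<Rightarrow> real"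
    and \<alpha>\<^sub>0 :: "real \<Rightarrow> complex"
    and chi :: "real L2"
    and \<psi>\<^sub>0 :: "(real \<times> real) L2"
    and \<phi> :: "real \<Rightarrow> (real \<times> real) L2"
    and Tmax :: ereal
    and \<omega> :: "real \<Rightarrow> real"
  assumes "b > 0" and "\<sigma> \<ge> 1"
    and "W_infty 15 lam"
    and "harm_osc b 1 chi ((b * (real n + 1/2)) *\<^sub>R chi)" and "norm chi = 1"
    and "AE (x, y) in lborel. rep_L2 \<psi>\<^sub>0 (x, y) = \<alpha>\<^sub>0 y * rep_L2 chi x"
    and "\<psi>\<^sub>0 \<in> Sigma2 b"
    and "maximal_solution b \<sigma> lam \<psi>\<^sub>0 Tmax \<phi>"
    and "\<And>y. \<omega> y = continuous_rep lam (0, y) * norm (\<alpha>\<^sub>0 y) ^ (2 * \<sigma>)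
                    * Lp_norm (2 * real \<sigma> + 2) chi ^ (2 * \<sigma> + 2)"
  shows "\<forall>t. 0 \<le> t \<and> ereal t < Tmax \<longrightarrow>
           (AE (x, y) in lborel. rep_L2 (\<phi> t) (x, y) =
              \<alpha>\<^sub>0 y * rep_L2 chi x * exp (- \<i> * complex_of_real (t * \<omega> y)))"
proof (intro allI impI)
  fix t assume t: "0 \<le> t \<and> ereal t < Tmax"
  interpret oscillator b by standard (rule assms(1))
  have chi: "harm_osc b 1 chi (energy n *\<^sub>R chi)" using assms(4) by (simp add: energy_def)
  obtain c where c: "norm c = 1" "AE x in lborel. rep_L2 chi x = c * complex_of_real (herm n x)"
    by (rule eigenfunction_line[OF chi assms(5)])
  have init: "AE z in lborel. rep_L2 \<psi>\<^sub>0 z = \<alpha>\<^sub>0 (snd z) * rep_L2 chi (fst z)"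
    using assms(6) by (simp add: case_prod_unfold)
  \<comment> \<open>The amplitude \<open>\<alpha>\<^sub>0\<close> is an arbitrary function, whereas
    this coefficient of \<open>\<psi>\<^sub>0\<close> is measurable and square integrable by
    construction; the two agree a.e. up to the phase c.\<close>
  define \<beta> where "\<beta> = hcoef n (rep_L2 \<psi>\<^sub>0)"
  have \<beta>: "sq_integrable \<beta>" unfolding \<beta>_def by (rule sq_integrable_hcoef) simp
  have \<beta>_eq: "AE y in lborel. \<beta> y = \<alpha>\<^sub>0 y * c"
    using AE_plane_section[OF init]
  proof eventually_elim
    case (elim y)
    have "AE x in lborel. rep_L2 \<psi>\<^sub>0 (x, y) = herm n x *\<^sub>R (\<alpha>\<^sub>0 y * c)"
      using elim c(2) by eventually_elim (simp add: scaleR_conv_of_real)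
    then have "\<beta> y = (LINT x|lborel. herm n x *\<^sub>R (herm n x *\<^sub>R (\<alpha>\<^sub>0 y * c)))"
      unfolding \<beta>_def hcoef_def
      by (intro integral_cong_AE) (auto elim!: eventually_mono intro!: borel_measurable_scaleR measurable_compose[OF _ measurable_rep])
    also have "\<dots> = hcoef n (tensor_herm n (\<lambda>y. \<alpha>\<^sub>0 y * c)) y" by (simp add: hcoef_def tensor_herm_def)
    finally show ?case by (simp add: hcoef_tensor)
  qed
  have chi_plane: "AE z::real \<times> real in lborel. rep_L2 chi (fst z) = c * complex_of_real (herm n (fst z))"
  proof (rule AE_planeI)
    have [measurable]: "(\<lambda>z::real \<times> real. rep_L2 chi (fst z)) \<in> borel_measurable borel"
      "(\<lambda>z::real \<times> real. c * complex_of_real (herm n (fst z))) \<in> borel_measurable borel"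
      by (subst borel_prod[symmetric], measurable)+
    show "{z::real \<times> real. rep_L2 chi (fst z) = c * complex_of_real (herm n (fst z))} \<in> sets borel" by measurable
  qed (use c(2) in simp)
  have rep\<psi>: "AE z in lborel. rep_L2 \<psi>\<^sub>0 z = tensor_herm n \<beta> z"
    using init chi_plane AE_snd[OF \<beta>_eq] by eventually_elim (simp add: tensor_herm_def scaleR_conv_of_real mult_ac)
  \<comment> \<open>The phase c does not affect moduli, and the power undoes the root in
    \<open>Lp_norm\<close>. Zero bases, where real powers take the conventional value 0, are
    separated in the integrand and in the root.\<close>
  have Lp: "Lp_norm (2 * real \<sigma> + 2) chi ^ (2 * \<sigma> + 2) = herm_moment n \<sigma>"
  proof -
    have p: "2 * real \<sigma> + 2 = real (2 * \<sigma> + 2)" by simp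
    have "(LINT x|lborel. norm (rep_L2 chi x) powr (2 * real \<sigma> + 2)) = herm_moment n \<sigma>"
      unfolding herm_moment_def
    proof (rule integral_cong_AE)
      show "AE x in lborel. norm (rep_L2 chi x) powr (2 * real \<sigma> + 2) = \<bar>herm n x\<bar> ^ (2 * \<sigma> + 2)"
        using c(2)
      proof eventually_elim
        case (elim x)
        then have "norm (rep_L2 chi x) = \<bar>herm n x\<bar>" by (simp add: norm_mult c(1))
        then show ?case
          unfolding p by (cases "herm n x = 0") (simp, simp only: powr_realpow zero_less_abs_iff not_False_eq_True)
      qed
    qed measurable
    moreover have "herm_moment n \<sigma> \<ge> 0" by (simp add: herm_moment_def)
    ultimately show ?thesis
      unfolding Lp_norm_def p
      by (cases "herm_moment n \<sigma> = 0") (simp, subst powr_power, simp_all)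
  qed
  obtain \<phi>' where C1: "C1_Sigma2 b (time_interval Tmax) \<phi> \<phi>'"
    and eq: "\<And>t. t \<in> time_interval Tmax \<Longrightarrow> \<i> *\<^sub>C \<phi>' t = mult_trace lam (F_av b \<sigma> (\<phi> t))" and i0: "\<phi> 0 = \<psi>\<^sub>0"
    using assms(8) unfolding maximal_solution_def solution_def by blast
  have sub: "{0..t} \<subseteq> time_interval Tmax"
    using t by (auto simp: time_interval_def intro: le_less_trans[of _ "ereal t"])
  have "AE z in lborel. rep_L2 (\<phi> t) z =
    cis (- (t * (continuous_rep lam (0, snd z) * norm (\<beta> (snd z)) ^ (2 * \<sigma>) * herm_moment n \<sigma>))) * tensor_herm n \<beta> z"
    by (rule explicit_solution[OF assms(3,7) \<beta> rep\<psi> C1 i0 _ sub]) (use t sub eq in auto)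
  then have "AE z in lborel. rep_L2 (\<phi> t) z = \<alpha>\<^sub>0 (snd z) * rep_L2 chi (fst z) * exp (- \<i> * complex_of_real (t * \<omega> (snd z)))"
    using AE_snd[OF \<beta>_eq] rep\<psi> init
  proof eventually_elim
    case (elim z)
    \<comment> \<open>Since |c| = 1, the frequency computed from \<beta> is that of
      \<open>\<alpha>\<^sub>0\<close>, while c itself stays inside the eigenfunction.\<close>
    have "norm (\<beta> (snd z)) = norm (\<alpha>\<^sub>0 (snd z))" using elim(2) by (simp add: norm_mult c(1))
    then have "cis (- (t * (continuous_rep lam (0, snd z) * norm (\<beta> (snd z)) ^ (2 * \<sigma>) * herm_moment n \<sigma>)))
        = exp (- \<i> * complex_of_real (t * \<omega> (snd z)))"
      unfolding assms(9) Lp cis_conv_exp by simp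
    then show ?case using elim by simp
  qed
  then show "AE (x, y) in lborel. rep_L2 (\<phi> t) (x, y) =
      \<alpha>\<^sub>0 y * rep_L2 chi x * exp (- \<i> * complex_of_real (t * \<omega> y))"
    by (simp add: case_prod_unfold)
qed

end
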